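(* Let $m\ge 2$ be an integer and $H$ a real number with $\log H \ge s(m)e^{s(m)}$. Then \[ \omega (m, H) \le \begin{cases} 2+ \frac{4.93}{\log \log H}, &m=2;\\ 3+ \frac{6.49}{\log \log H}, &m=3;\\ 4+ \frac{15.7}{\log \log H}, &m=4;\\ m +\left(1-\frac{2\kappa_m}{(\log m)^2}\right)\left(1-\frac{\kappa_m}{\log m}\right) \cdot \frac{m^2 \log m}{\log \log H}, & 5\leq m\leq 14;\\ m +\left(1-\frac{1+\kappa_m}{(\log m)^2}\right)\left(1-\frac{\kappa_m}{\log m}\right) \cdot \frac{m^2 \log m}{\log \log H}, &m \ge 15. \end{cases} \] Moreover, \[ \lim_{m\to\infty}\kappa_m=\kappa=\sum_{p\ \mathrm{prime}}\frac{\log p}{p(p-1)}=0.75536661083\dots . \]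
   Context: For $m,H\ge 1$, $\omega(m,H)$ denotes the infimum of the real numbers $r>0$ such that $|\lambda_0+\lambda_1e+\lambda_2e^2+\dots+\lambda_me^m|>H^{-r}$ for all $(\lambda_0,\dots,\lambda_m)\in\mathbb{Z}^{m+1}\setminus\{0\}$ with $\max_{1\le i\le m}|\lambda_i|\le H$. Set $s(2)=e$ and $s(m)=m(\log m)^2$ for $m\ge 3$. For real $y\ge 2$ and $x>1$ put $w_y(x)=1-\frac{y}{x}-\frac{y-1}{\log y}\frac{\log x}{x}$. For $m\ge 2$ define \[ \kappa_m=\frac1m\sum_{\substack{p\le \frac{m+1}{2}\\ p \text{ prime}}}\ \min_{0\le j\le m}\left\{\left\lfloor \frac jp\right\rfloor+\left\lfloor\frac{m-j}{p}\right\rfloor\right\}\frac{\log p}{p-1}\,w_p\!\left(s(m)e^{s(m)}\right). \] *)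

theory Defs
  imports "HOL-Analysis.Analysis" "HOL-Computational_Algebra.Primes"
begin

definition omega :: "nat \<Rightarrow> real \<Rightarrow> real" where
  "omega m H = Inf {r::real. r > 0 \<and>
     (\<forall>lam::nat \<Rightarrow> int. (\<exists>i\<in>{0..m}. lam i \<noteq> 0) \<and> (\<forall>i\<in>{1..m}. \<bar>real_of_int (lam i)\<bar> \<le> H)
        \<longrightarrow> \<bar>\<Sum>i=0..m. real_of_int (lam i) * exp 1 ^ i\<bar> > H powr (- r))}"

definition s_fun :: "nat \<Rightarrow> real" where
  "s_fun m = (if m = 2 then exp 1 else real m * (ln (real m))^2)"

definition w_fun :: "real \<Rightarrow> real \<Rightarrow> real" where
  "w_fun y x = 1 - y / x - (y - 1) / ln y * (ln x / x)"

definition kappa_m :: "nat \<Rightarrow> real" where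
  "kappa_m m = (1 / real m) *
     (\<Sum>p\<in>{p::nat. prime p \<and> real p \<le> (real m + 1) / 2}.
        real (Min ((\<lambda>j. j div p + (m - j) div p) ` {0..m}))
        * (ln (real p) / (real p - 1))
        * w_fun (real p) (s_fun m * exp (s_fun m)))"

definition kappa :: real where
  "kappa = (\<Sum>n. if prime n then ln (real n) / (real n * (real n - 1)) else 0)"

definition omega_bound :: "nat \<Rightarrow> real \<Rightarrow> real" where
  "omega_bound m H =
    (if m = 2 then 2 + 4.93 / ln (ln H)
     else if m = 3 then 3 + 6.49 / ln (ln H)
     else if m = 4 then 4 + 15.7 / ln (ln H)
     else if m \<le> 14 then real m + (1 - 2 * kappa_m m / (ln (real m))^2)
        * (1 - kappa_m m / ln (real m)) * ((real m)^2 * ln (real m) / ln (ln H))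
     else real m + (1 - (1 + kappa_m m) / (ln (real m))^2)
        * (1 - kappa_m m / ln (real m)) * ((real m)^2 * ln (real m) / ln (ln H)))"

end

theory Submission
  imports Defs "HOL-Computational_Algebra.Polynomial" "HOL-Real_Asymp.Real_Asymp"
begin

text \<open>
  Hermite's method. Let \<open>\<Pi> = x (x - 1) \<dots> (x - m)\<close> and \<open>f\<^sub>k = \<Pi>\<^sup>q \<Pi> / (x - k)\<close>, and let \<open>F\<^sub>k\<close> be the sum of all
  derivatives of \<open>f\<^sub>k\<close>. Then \<open>e\<^sup>j F\<^sub>k(0) - F\<^sub>k(j)\<close> is small by the mean value theorem, and all \<open>F\<^sub>k(j)\<close>
  are divisible by \<open>q!\<close> times an extra factor: modulo a prime \<open>p\<close>, at least \<open>(m + 1) div p\<close> of the nodes are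
  congruent to \<open>j\<close>, and each of them contributes the full \<open>p\<close>-part of \<open>q!\<close>. For \<open>\<lambda> \<noteq> 0\<close> some \<open>k\<close> makes the
  integer \<open>\<Sum>\<lambda>\<^sub>j F\<^sub>k(j)\<close> nonzero, because a functional that vanishes on all \<open>f\<^sub>k\<close> vanishes on every
  polynomial. A suitable \<open>q\<close> then gives the measure, up to an explicit inequality in \<open>m\<close>, which is checked
  numerically for \<open>m < 25\<close> and asymptotically for \<open>m \<ge> 25\<close>.

  The digits of \<open>\<kappa>\<close> come from \<open>\<kappa> = \<Sum>k\<ge>2. \<mu>(k) \<zeta>'(k) / \<zeta>(k)\<close>, truncated, with the zeta values enclosed by the
  Euler--Maclaurin formula.
\<close>

section \<open>Nonvanishing of the approximations\<close>

text \<open>The claimed coefficients decrease in \<open>kappa_m m\<close>, and the factors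
  \<open>w_fun\<close> only lower \<open>kappa_m m\<close>; so the bound is proved with
  \<open>gain_rate m / m\<close> in its place. The loss in Legendre's formula is charged separately:
  it is a multiple of \<open>ln (q + 1)\<close>, negligible because for \<open>m\<close> at least 5
  the hypothesis on \<open>H\<close> forces \<open>q + 1\<close> to be at least
  \<open>exp (s_fun m)\<close>. At that threshold put \<open>y = 1 / ln m\<close> and
  \<open>k = gain_rate m / m\<close>. Divided by \<open>m^2 ln m\<close>, the coefficient that the
  method yields and the one claimed for large \<open>m\<close> are both \<open>1 - k y\<close> up to
  order \<open>y^2\<close>, and the claimed one is larger by about \<open>k y^2\<close>. Terms of
  relative size \<open>1 / m\<close> compete with this margin. Hence the argument is uniform once
  \<open>m / (ln m)^2\<close> is large enough, whereas for small \<open>m\<close> the constants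
  matter; this is also why the node polynomial is bounded by \<open>m! / (exp 1 * harm m)\<close>
  rather than by \<open>m!\<close>. The uniform argument needs \<open>gain_rate m / m\<close> to
  stay below \<open>19/25\<close>, which comes from the numerical value of \<open>kappa\<close>, so
  the digits serve the measure as well.\<close>

definition deriv_sum :: "real poly \<Rightarrow> real poly" where
  "deriv_sum f = (\<Sum>i\<le>degree f. (pderiv ^^ i) f)"

lemma higher_pderiv_eq_0: "degree f < i \<Longrightarrow> (pderiv ^^ i) (f :: real poly) = 0"
proof (induction i arbitrary: f)
  case (Suc i)
  show ?case
  proof (cases "degree f = 0")
    case True
    then have "pderiv f = 0"
      by (simp add: pderiv_eq_0_iff)
    then have "(pderiv ^^ j) (pderiv f) = 0" for j
      by (induction j) auto
    then show ?thesis
      by (simp add: funpow_Suc_right del: funpow.simps)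
  next
    case False
    with Suc show ?thesis
      by (simp add: funpow_Suc_right degree_pderiv del: funpow.simps)
  qed
qed auto

text \<open>Additivity needs a common truncation point for polynomials of different degrees.\<close>

lemma deriv_sum_eq: "degree f \<le> n \<Longrightarrow> deriv_sum f = (\<Sum>i\<le>n. (pderiv ^^ i) f)"
  unfolding deriv_sum_def
  by (rule sum.mono_neutral_left) (auto intro: higher_pderiv_eq_0)

lemma deriv_sum_add: "deriv_sum (f + g) = deriv_sum f + deriv_sum g"
proof -
  let ?n = "max (degree f) (degree g)"
  have "degree (f + g) \<le> ?n" by (rule degree_add_le_max)
  then show ?thesis
    by (simp add: deriv_sum_eq[of _ ?n] higher_pderiv_add sum.distrib)
qed

lemma deriv_sum_smult: "deriv_sum (smult c f) = smult c (deriv_sum f)"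
proof -
  have "deriv_sum (smult c f) = (\<Sum>i\<le>degree f. [:c:] * (pderiv ^^ i) f)"
    by (subst deriv_sum_eq[of _ "degree f"]) (simp_all add: degree_smult_le higher_pderiv_smult)
  also have "\<dots> = [:c:] * deriv_sum f"
    by (simp only: deriv_sum_def sum_distrib_left)
  finally show ?thesis by simp
qed

text \<open>With \<open>F = deriv_sum f\<close> this makes \<open>exp (- x) * F x\<close> a
  primitive of \<open>- exp (- x) * f x\<close>, the source of Hermite's identity.\<close>

lemma pderiv_deriv_sum: "pderiv (deriv_sum f) = deriv_sum f - f"
proof -
  let ?n = "degree f"
  have "deriv_sum f = (\<Sum>i\<le>Suc ?n. (pderiv ^^ i) f)"
    by (rule deriv_sum_eq) simp
  also have "\<dots> = f + (\<Sum>i\<le>?n. pderiv ((pderiv ^^ i) f))"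
    by (subst sum.atMost_Suc_shift) simp
  finally show ?thesis
    using higher_pderiv_sum[of 1 "\<lambda>i. (pderiv ^^ i) f" "{..?n}"]
    by (simp add: deriv_sum_def)
qed

text \<open>\<open>deriv_sum\<close> inverts \<open>1 - d/dx\<close>, by telescoping. So a linear
  form in the values of \<open>deriv_sum f\<close> at the nodes, taken at
  \<open>f = g - pderiv g\<close>, sees only the values of \<open>g\<close> itself.\<close>

lemma deriv_sum_diff_pderiv: "deriv_sum (g - pderiv g) = g"
proof -
  let ?n = "degree g"
  have *: "deriv_sum g = g + deriv_sum (pderiv g)"
  proof -
    have "deriv_sum g = (\<Sum>i\<le>Suc ?n. (pderiv ^^ i) g)"
      by (rule deriv_sum_eq) simp
    also have "\<dots> = g + (\<Sum>i\<le>?n. (pderiv ^^ i) (pderiv g))"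
      by (subst sum.atMost_Suc_shift) (simp add: funpow_swap1)
    also have "(\<Sum>i\<le>?n. (pderiv ^^ i) (pderiv g)) = deriv_sum (pderiv g)"
      by (rule deriv_sum_eq[symmetric]) (simp add: degree_pderiv)
    finally show ?thesis .
  qed
  have "deriv_sum (g + smult (-1) (pderiv g)) = g"
    unfolding deriv_sum_add deriv_sum_smult using * by simp
  then show ?thesis by simp
qed

text \<open>Abstracts from \<open>\<Phi> f\<close>, the sum of
  \<open>lam j * poly (deriv_sum f) j\<close>, the only facts that the elimination argument
  uses.\<close>

locale vanishing =
  fixes \<Phi> :: "real poly \<Rightarrow> real" and m :: nat and lam :: "nat \<Rightarrow> real"
  assumes add: "\<Phi> (f + g) = \<Phi> f + \<Phi> g"
    and smult: "\<Phi> (smult c f) = c * \<Phi> f"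
    and diff: "\<Phi> (g - pderiv g) = (\<Sum>j\<le>m. lam j * poly g (real j))"

section \<open>The node polynomial and its coprimality to its derivative\<close>

definition node_poly :: "nat \<Rightarrow> real poly" where
  "node_poly m = (\<Prod>i\<le>m. [:- real i, 1:])"

lemma poly_node_poly: "poly (node_poly m) x = (\<Prod>i\<le>m. x - real i)"
  by (simp add: node_poly_def poly_prod)

lemma poly_node_poly_eq_0: "j \<le> m \<Longrightarrow> poly (node_poly m) (real j) = 0"
  by (auto simp: poly_node_poly)

lemma degree_node_poly: "degree (node_poly m) = Suc m"
  by (simp add: node_poly_def degree_prod_eq_sum_degree)

lemma lead_coeff_node_poly: "lead_coeff (node_poly m) = 1"
  by (simp add: node_poly_def lead_coeff_prod)

lemma node_poly_nonzero: "node_poly m \<noteq> 0"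
  using lead_coeff_node_poly[of m] by force

text \<open>All roots are simple. The induction adjoins one linear factor \<open>a\<close>, modulo
  which \<open>node_poly m\<close> is a nonzero constant; an explicit Bezout identity is what
  \<open>vanish_descend\<close> multiplies by.\<close>

lemma node_poly_bezout: "\<exists>u v. u * pderiv (node_poly m) + v * node_poly m = 1"
proof (induction m)
  case 0
  have "1 * pderiv (node_poly 0) + 0 * node_poly 0 = 1"
    by (simp add: node_poly_def pderiv_pCons)
  then show ?case by blast
next
  case (Suc m)
  define a where "a = [:- real (Suc m), 1:]"
  define p where "p = node_poly m"
  obtain u v where uv: "u * pderiv p + v * p = 1"
    using Suc p_def by auto
  have np: "node_poly (Suc m) = p * a"
    by (simp add: node_poly_def p_def a_def)
  have da: "pderiv a = 1"
    by (simp add: a_def pderiv_pCons)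
  have "poly p (real (Suc m)) \<noteq> 0"
    by (auto simp: p_def poly_node_poly)
  then obtain c where c: "c \<noteq> 0" "poly p (real (Suc m)) = c" by auto
  obtain r where r: "p = r * a + [:c:]"
    by (metis a_def c(2) mult.commute synthetic_div_correct' )
  define k where "k = inverse c"
  have kp: "smult k p = smult k r * a + 1"
    using r c by (simp add: k_def smult_add_right one_pCons)
  define P where "P = smult k p"
  define R where "R = smult k r"
  have PR: "P - R * a = 1" using kp by (simp add: P_def R_def)
  have D: "pderiv (node_poly (Suc m)) = pderiv p * a + p"
    by (simp add: np pderiv_mult da mult.commute)
  \<comment> \<open>Modulo \<open>p\<close> the derivative is \<open>p' a\<close>, and modulo \<open>a\<close> it is \<open>p\<close>; both are units there.\<close>
  define X where "X = v + (1 - v * p) * [:k:] + u * R"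
  have 1: "(u * (- R)) * pderiv (node_poly (Suc m)) = 1 - p * X"
  proof -
    have "(u * (- R)) * pderiv (node_poly (Suc m)) = - (u * pderiv p) * (R * a) - u * R * p"
      by (simp add: D algebra_simps)
    also have "R * a = P - 1" using PR by (simp add: algebra_simps)
    also have "u * pderiv p = 1 - v * p" using uv by (simp add: algebra_simps)
    also have "- (1 - v * p) * (P - 1) - u * R * p = 1 - p * X"
      by (simp add: X_def P_def algebra_simps)
    finally show ?thesis .
  qed
  have 2: "[:k:] * pderiv (node_poly (Suc m)) = 1 + a * (R + smult k (pderiv p))"
    using PR by (simp add: D P_def algebra_simps smult_add_right)
  define Y where "Y = R + smult k (pderiv p)"
  define d where "d = pderiv (node_poly (Suc m))"
  have 1: "(u * (- R)) * d + p * X = 1" using 1 by (simp add: d_def)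
  have 2: "[:k:] * d + a * (- Y) = 1" using 2 by (simp add: Y_def d_def algebra_simps)
  \<comment> \<open>In the product of the two identities every term contains either \<open>d\<close>
    or \<open>p * a\<close>, which is the new node polynomial.\<close>
  have "1 = ((u * (- R)) * d + p * X) * ([:k:] * d + a * (- Y))"
    by (simp only: 1 2 mult_1)
  also have "\<dots> = ((u * (- R)) * ([:k:] * d + a * (- Y)) + p * X * [:k:]) * d + (- X * Y) * node_poly (Suc m)"
    by (simp add: np algebra_simps)
  finally show ?case unfolding d_def by metis
qed

context vanishing
begin

lemma zero: "\<Phi> 0 = 0"
  using smult[of 0 0] by simp

lemma minus: "\<Phi> (f - g) = \<Phi> f - \<Phi> g"
  using add[of f "smult (-1) g"] smult[of "-1" g] by simp

text \<open>Reduction of the degree by relations: \<open>G\<close> below is divisible by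
  \<open>node_poly m\<close>, so \<open>diff\<close> gives \<open>\<Phi> (G - pderiv G) = 0\<close>,
  and \<open>G - pderiv G\<close> is \<open>node_poly m ^ q\<close> times a polynomial with the
  leading term of \<open>P\<close>. Subtracting it lowers the degree as long as that exceeds
  \<open>m\<close>.\<close>

lemma vanish_all_multiples:
  assumes "\<And>P. degree P \<le> m \<Longrightarrow> \<Phi> (node_poly m ^ q * P) = 0"
  shows "\<Phi> (node_poly m ^ q * P) = 0"
proof (induction "degree P" arbitrary: P rule: less_induct)
  case less
  show ?case
  proof (cases "degree P \<le> m")
    case True
    then show ?thesis by (rule assms)
  next
    case False
    define n where "n = degree P - Suc m"
    have n: "degree P = Suc m + n" using False by (simp add: n_def)
    define M where "M = monom (lead_coeff P) n"
    have P0: "P \<noteq> 0" using False by auto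
    have degM: "degree M = n" using P0 by (simp add: M_def degree_monom_eq)
    define G where "G = node_poly m ^ Suc q * M"
    define T where "T = smult (real (Suc q)) (pderiv (node_poly m)) * M + node_poly m * pderiv M"
    have "pderiv G = node_poly m ^ q * T"
      by (simp add: G_def T_def pderiv_mult pderiv_power_Suc algebra_simps del: power_Suc)
         (simp add: algebra_simps)
    then have eq: "G - pderiv G = node_poly m ^ q * (node_poly m * M - T)"
      by (simp add: G_def algebra_simps)
    have "\<Phi> (G - pderiv G) = 0"
      unfolding diff by (simp add: G_def poly_node_poly_eq_0)
    then have 0: "\<Phi> (node_poly m ^ q * (node_poly m * M - T)) = 0" by (simp add: eq)
    have degT: "degree T < degree P"
    proof -
      have "degree (smult (real (Suc q)) (pderiv (node_poly m)) * M) \<le> m + n"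
        by (rule order.trans[OF degree_mult_le]) (simp add: degree_pderiv degree_node_poly degM)
      moreover have "degree (node_poly m * pderiv M) \<le> m + n"
      proof (cases "pderiv M = 0")
        case False
        then have "n \<noteq> 0" using degM by (auto simp: pderiv_eq_0_iff)
        then show ?thesis
          by (intro order.trans[OF degree_mult_le]) (simp add: degree_pderiv degree_node_poly degM)
      qed auto
      ultimately have "degree T \<le> m + n" unfolding T_def by (rule degree_add_le)
      then show ?thesis using n by simp
    qed
    define Q where "Q = P - (node_poly m * M - T)"
    have "degree (P - node_poly m * M) < degree P"
    proof -
      have "M \<noteq> 0" using P0 by (simp add: M_def)
      then have d: "degree (node_poly m * M) = degree P"
        using n by (simp add: degree_mult_eq node_poly_nonzero degree_node_poly degM)
      have "lead_coeff (node_poly m * M) = lead_coeff P"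
        by (simp add: lead_coeff_mult lead_coeff_node_poly degM) (simp add: M_def)
      then have "coeff (P - node_poly m * M) (degree P) = 0" using d by simp
      moreover have "degree (P - node_poly m * M) \<le> degree P"
        using degree_diff_le_max[of P "node_poly m * M"] d by simp
      ultimately show ?thesis
        using n by (metis add_Suc degree_0 eq_zero_or_degree_less zero_less_Suc)
    qed
    then have "degree Q < degree P"
      using degT unfolding Q_def by (metis degree_add_less diff_diff_eq2 add.commute diff_add_eq)
    then have "\<Phi> (node_poly m ^ q * Q) = 0" by (rule less)
    then show ?thesis
      using 0 add[of "node_poly m ^ q * Q" "node_poly m ^ q * (node_poly m * M - T)"]
      by (simp add: Q_def algebra_simps)
  qed
qed

text \<open>For \<open>G = node_poly m ^ Suc q * R\<close> the only part of
  \<open>G - pderiv G\<close> not divisible by \<open>node_poly m ^ Suc q\<close> is a multiple of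
  \<open>node_poly m ^ q * pderiv (node_poly m) * R\<close>, so \<open>\<Phi>\<close> vanishes
  there; the Bezout identity turns this into all multiples of
  \<open>node_poly m ^ q\<close>.\<close>

lemma vanish_descend:
  assumes "\<And>P. \<Phi> (node_poly m ^ Suc q * P) = 0"
  shows "\<Phi> (node_poly m ^ q * P) = 0"
proof -
  obtain u v where uv: "u * pderiv (node_poly m) + v * node_poly m = 1"
    using node_poly_bezout by blast
  have *: "\<Phi> (node_poly m ^ q * (pderiv (node_poly m) * R)) = 0" for R
  proof -
    define G where "G = node_poly m ^ Suc q * R"
    have eq: "G - pderiv G = node_poly m ^ Suc q * (R - pderiv R)
        - smult (real (Suc q)) (node_poly m ^ q * (pderiv (node_poly m) * R))"
      by (simp add: G_def pderiv_mult pderiv_power_Suc algebra_simps del: power_Suc)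
    have "\<Phi> (G - pderiv G) = 0"
      unfolding diff by (simp add: G_def poly_node_poly_eq_0)
    then have "real (Suc q) * \<Phi> (node_poly m ^ q * (pderiv (node_poly m) * R)) = 0"
      unfolding eq minus smult assms by simp
    then show ?thesis by simp
  qed
  have "node_poly m ^ q * P = node_poly m ^ q * P * (u * pderiv (node_poly m) + v * node_poly m)"
    using uv by simp
  also have "\<dots> = node_poly m ^ q * (pderiv (node_poly m) * (u * P)) + node_poly m ^ Suc q * (v * P)"
    by (simp add: algebra_simps)
  finally show ?thesis
    using * assms by (simp add: add)
qed

lemma vanish_everywhere:
  assumes "\<And>P. degree P \<le> m \<Longrightarrow> \<Phi> (node_poly m ^ q * P) = 0"
  shows "\<Phi> P = 0"
proof -
  have "\<forall>P. \<Phi> (node_poly m ^ q * P) = 0"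
    using vanish_all_multiples assms by blast
  then have "\<forall>P. \<Phi> (node_poly m ^ 0 * P) = 0"
  proof (induction q)
    case (Suc q)
    then show ?case using vanish_descend by blast
  qed
  then show ?thesis by simp
qed

end

section \<open>The Lagrange basis and the nonvanishing theorem\<close>

definition omit_poly :: "nat \<Rightarrow> nat \<Rightarrow> real poly" where
  "omit_poly m k = (\<Prod>i\<in>{..m} - {k}. [:- real i, 1:])"

lemma degree_omit_poly: "k \<le> m \<Longrightarrow> degree (omit_poly m k) = m"
  by (simp add: omit_poly_def degree_prod_eq_sum_degree)

lemma poly_omit_poly: "poly (omit_poly m k) x = (\<Prod>i\<in>{..m} - {k}. x - real i)"
  by (simp add: omit_poly_def poly_prod)

text \<open>The two sides agree at \<open>m + 1\<close> nodes and have degree at most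
  \<open>m\<close>. Hence vanishing on the \<open>m + 1\<close> approximants already gives the
  hypothesis of \<open>vanish_everywhere\<close>.\<close>

lemma lagrange_interpolation_basis:
  assumes "degree P \<le> m"
  shows "P = (\<Sum>k\<le>m. smult (poly P (real k) / poly (omit_poly m k) (real k)) (omit_poly m k))"
    (is "P = ?S")
proof -
  have nz: "poly (omit_poly m k) (real k) \<noteq> 0" for k
    by (auto simp: poly_omit_poly)
  have eq: "poly ?S (real j) = poly P (real j)" if "j \<le> m" for j
  proof -
    have "poly ?S (real j) = (\<Sum>k\<le>m. poly P (real k) / poly (omit_poly m k) (real k) * poly (omit_poly m k) (real j))"
      by (simp add: poly_sum)
    also have "\<dots> = (\<Sum>k\<le>m. if k = j then poly P (real j) else 0)"
    proof (rule sum.cong)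
      fix k assume "k \<in> {..m}"
      have "poly (omit_poly m k) (real j) = 0" if "k \<noteq> j"
        using that \<open>j \<le> m\<close> by (auto simp: poly_omit_poly)
      then show "poly P (real k) / poly (omit_poly m k) (real k) * poly (omit_poly m k) (real j)
          = (if k = j then poly P (real j) else 0)"
        using nz[of j] by auto
    qed simp
    also have "\<dots> = poly P (real j)" using that by simp
    finally show ?thesis .
  qed
  have "degree ?S \<le> m"
    by (intro degree_sum_le) (auto intro: order.trans[OF degree_smult_le] simp: degree_omit_poly)
  then have "degree (P - ?S) \<le> m"
    using assms degree_diff_le by blast
  moreover have "card (real ` {..m}) \<le> card {x. poly (P - ?S) x = 0}" if "P - ?S \<noteq> 0"
    using eq by (intro card_mono poly_roots_finite that) auto
  moreover have "card (real ` {..m}) = Suc m"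
    by (subst card_image) (auto simp: inj_on_def)
  ultimately have "P - ?S = 0"
    using card_poly_roots_bound[of "P - ?S"] by fastforce
  then show ?thesis by simp
qed

theorem exists_nonvanishing_approximant:
  fixes lam :: "nat \<Rightarrow> real"
  assumes "\<exists>i\<le>m. lam i \<noteq> 0"
  shows "\<exists>k\<le>m. (\<Sum>j\<le>m. lam j * poly (deriv_sum (node_poly m ^ q * omit_poly m k)) (real j)) \<noteq> 0"
proof (rule ccontr)
  assume "\<not> ?thesis"
  define \<Phi> where "\<Phi> f = (\<Sum>j\<le>m. lam j * poly (deriv_sum f) (real j))" for f
  from \<open>\<not> ?thesis\<close> have van: "\<Phi> (node_poly m ^ q * omit_poly m k) = 0" if "k \<le> m" for k
    using that by (auto simp: \<Phi>_def)
  interpret vanishing \<Phi> m lam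
  proof
    show "\<Phi> (f + g) = \<Phi> f + \<Phi> g" for f g
      by (simp add: \<Phi>_def deriv_sum_add algebra_simps sum.distrib)
    show "\<Phi> (smult c f) = c * \<Phi> f" for c f
      by (simp add: \<Phi>_def deriv_sum_smult sum_distrib_left algebra_simps)
    show "\<Phi> (g - pderiv g) = (\<Sum>j\<le>m. lam j * poly g (real j))" for g
      by (simp add: \<Phi>_def deriv_sum_diff_pderiv)
  qed
  have sum: "\<Phi> (\<Sum>k\<in>A. f k) = (\<Sum>k\<in>A. \<Phi> (f k))" if "finite A" for A :: "nat set" and f
    using that by (induction A) (auto simp: zero add)
  have "\<Phi> (node_poly m ^ q * P) = 0" if "degree P \<le> m" for P
    by (subst lagrange_interpolation_basis[OF that])
       (simp add: sum_distrib_left sum smult van)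
  then have all: "\<Phi> P = 0" for P
    by (rule vanish_everywhere)
  obtain i where i: "i \<le> m" "lam i \<noteq> 0" using assms by blast
  \<comment> \<open>\<open>?g\<close> vanishes at every node except \<open>i\<close>, so
    \<open>diff\<close> isolates \<open>lam i\<close>.\<close>
  let ?g = "omit_poly m i"
  have "0 = (\<Sum>j\<le>m. lam j * poly ?g (real j))"
    using diff[of ?g] all by simp
  also have "\<dots> = (\<Sum>j\<le>m. if j = i then lam i * poly ?g (real i) else 0)"
    by (rule sum.cong) (auto simp: poly_omit_poly)
  also have "\<dots> = lam i * poly ?g (real i)" using i by simp
  finally show False using i by (auto simp: poly_omit_poly)
qed

section \<open>Common factors\<close>

text \<open>Divisibility of all Hurwitz coefficients: \<open>poly (deriv_sum f) 0\<close> is their sum, and the binomial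
  theorem makes the notion multiplicative.\<close>

definition hdvd :: "int \<Rightarrow> real poly \<Rightarrow> bool" where
  "hdvd d f \<longleftrightarrow> (\<forall>n. \<exists>z::int. fact n * coeff f n = of_int (d * z))"

lemma hdvd_mult:
  assumes "hdvd d f" "hdvd e g"
  shows "hdvd (d * e) (f * g)"
  unfolding hdvd_def
proof
  fix n
  obtain u where u: "\<And>n. fact n * coeff f n = of_int (d * u n)"
    using assms(1) unfolding hdvd_def by metis
  obtain v where v: "\<And>n. fact n * coeff g n = of_int (e * v n)"
    using assms(2) unfolding hdvd_def by metis
  have "fact n * coeff (f * g) n
      = (\<Sum>i\<le>n. real (n choose i) * ((fact i * coeff f i) * (fact (n - i) * coeff g (n - i))))"
    unfolding coeff_mult sum_distrib_left
  proof (rule sum.cong)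
    fix i assume "i \<in> {..n}"
    then have "(fact n :: real) = real (n choose i) * fact i * fact (n - i)"
      by (simp add: binomial_fact field_simps)
    then show "fact n * (coeff f i * coeff g (n - i))
        = real (n choose i) * ((fact i * coeff f i) * (fact (n - i) * coeff g (n - i)))"
      by (simp add: algebra_simps)
  qed simp
  also have "\<dots> = of_int ((d * e) * (\<Sum>i\<le>n. int (n choose i) * (u i * v (n - i))))"
    unfolding u v by (simp add: sum_distrib_left algebra_simps)
  finally show "\<exists>z::int. fact n * coeff (f * g) n = of_int (d * e * z)" by blast
qed

lemma hdvd_1: "hdvd 1 1"
  by (auto simp: hdvd_def coeff_1 intro: exI[of _ "1::int"] exI[of _ "0::int"])

lemma hdvd_prod:
  assumes "finite A" "\<And>i. i \<in> A \<Longrightarrow> hdvd (d i) (f i)"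
  shows "hdvd (prod d A) (prod f A)"
  using assms by (induction A) (auto intro: hdvd_mult hdvd_1)

lemma hdvd_linear_power_1: "hdvd 1 ([:of_int a, 1:] ^ n)"
proof (induction n)
  case (Suc n)
  have "hdvd 1 [:of_int a, 1:]"
    unfolding hdvd_def
  proof
    fix n show "\<exists>z::int. fact n * coeff [:of_int a, 1 :: real:] n = of_int (1 * z)"
      by (cases n; cases "n - 1") (auto intro: exI[of _ "1::int"] exI[of _ "0::int"])
  qed
  from hdvd_mult[OF this Suc] show ?case by simp
qed (simp add: hdvd_1)

section \<open>Legendre's formula in recursive form, with bounds for primes in factorials\<close>

lemma multiplicity_fact_rec:
  fixes p :: nat
  assumes "prime p"
  shows "multiplicity p (fact n :: nat) = n div p + multiplicity p (fact (n div p) :: nat)"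
proof (induction n)
  case (Suc n)
  have mult: "multiplicity p (fact (Suc k) :: nat) = multiplicity p (Suc k) + multiplicity p (fact k :: nat)" for k
    using assms by (simp only: fact_Suc of_nat_id) (subst prime_elem_multiplicity_mult_distrib; simp)
  show ?case
  proof (cases "p dvd Suc n")
    case True
    then obtain t where t: "Suc n = p * t" by blast
    then have "t > 0" using gr0I by force
    then obtain k where k: "t = Suc k" using gr0_implies_Suc by blast
    have p0: "p > 0" using assms prime_gt_0_nat by blast
    have d1: "Suc n div p = Suc k" using t k p0 by simp
    have d2: "n div p = k"
      using True d1 by (metis Suc_inject dvd_imp_mod_0 div_Suc)
    have "multiplicity p (Suc n) = Suc (multiplicity p (Suc k))"
      unfolding t k using assms by (subst multiplicity_times_same) auto
    then show ?thesis using Suc mult[of n] mult[of k] d1 d2 by simp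
  next
    case False
    then have "Suc n div p = n div p"
      by (simp add: div_Suc dvd_eq_mod_eq_0)
    moreover have "multiplicity p (Suc n) = 0" using False by (rule not_dvd_imp_multiplicity_0)
    ultimately show ?thesis using Suc mult[of n] by simp
  qed
qed simp

lemma multiplicity_fact_le:
  fixes p :: nat
  assumes "prime p"
  shows "multiplicity p (fact n :: nat) \<le> n"
proof (induction n rule: less_induct)
  case (less n)
  show ?case
  proof (cases "n = 0")
    case False
    have p: "p \<ge> 2" using assms prime_ge_2_nat by blast
    then have "n div p < n" using False by simp
    moreover have "2 * (n div p) \<le> n"
      using p by (metis div_times_less_eq_dividend le_trans mult.commute mult_le_mono1)
    ultimately show ?thesis
      using less[of "n div p"] multiplicity_fact_rec[OF assms, of n] by linarith
  qed simp
qed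

text \<open>The chord of the concave logarithm between \<open>1\<close> and \<open>p\<close>; it
  will be applied to a base-\<open>p\<close> digit \<open>t\<close>.\<close>

lemma ln_le_frac_lin:
  fixes p t :: real
  assumes "p > 1" "0 \<le> t" "t \<le> p - 1"
  shows "t / (p - 1) * ln p \<le> ln (t + 1)"
proof -
  define h where "h = t / (p - 1)"
  have h: "0 \<le> h" "h \<le> 1" using assms by (auto simp: h_def field_simps)
  have "(1 - h) * ln 1 + h * ln p \<le> ln ((1 - h) *\<^sub>R 1 + h *\<^sub>R p)"
    using concave_onD[OF ln_concave, of h 1 p] h assms by simp
  moreover have "h * (p - 1) = t"
    using assms by (simp add: h_def)
  then have "1 - h + h * p = t + 1"
    by (simp add: algebra_simps)
  ultimately show ?thesis unfolding h_def[symmetric] by simp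
qed

text \<open>Each base-\<open>p\<close> digit \<open>t\<close> of \<open>n\<close> costs
  \<open>t / (p - 1)\<close> compared with \<open>n / (p - 1)\<close>, which by concavity is at most
  \<open>ln (t + 1) / ln p\<close>. The product of the numbers \<open>t + 1\<close> over all digits
  is at most \<open>n + 1\<close>, so the total loss is only logarithmic.\<close>

lemma multiplicity_fact_ge:
  fixes p :: nat
  assumes "prime p"
  shows "real n / (real p - 1) - ln (real n + 1) / ln (real p) \<le> real (multiplicity p (fact n :: nat))"
proof (induction n rule: less_induct)
  case (less n)
  show ?case
  proof (cases "n = 0")
    case False
    have p: "p \<ge> 2" using assms prime_ge_2_nat by blast
    define r where "r = n div p"
    define t where "t = n mod p"
    have n: "real n = real p * real r + real t"
      unfolding r_def t_def by (metis mult_div_mod_eq of_nat_add of_nat_mult)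
    have t: "real t \<le> real p - 1"
      using p mod_less_divisor[of p n] unfolding t_def by linarith
    have "r < n" using p False by (simp add: r_def)
    then have IH: "real r / (real p - 1) - ln (real r + 1) / ln (real p) \<le> real (multiplicity p (fact r :: nat))"
      by (rule less)
    have lnp: "ln (real p) > 0" using p by simp
    have "real t / (real p - 1) * ln (real p) \<le> ln (real t + 1)"
      using p t by (intro ln_le_frac_lin) auto
    also have "\<dots> \<le> ln ((real n + 1) / (real r + 1))"
    proof -
      have "(real t + 1) * (real r + 1) \<le> real n + 1"
        using mult_right_mono[OF t, of "real r"] by (simp add: n algebra_simps)
      then show ?thesis
        using p by (subst ln_le_cancel_iff) (auto simp: field_simps)
    qed
    also have "\<dots> = ln (real n + 1) - ln (real r + 1)"
      by (rule ln_divide_pos) auto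
    finally have "real t / (real p - 1) \<le> (ln (real n + 1) - ln (real r + 1)) / ln (real p)"
      using lnp by (simp add: field_simps)
    then have "real t / (real p - 1) \<le> ln (real n + 1) / ln (real p) - ln (real r + 1) / ln (real p)"
      by (simp add: diff_divide_distrib)
    moreover have "real n = real r * (real p - 1) + real r + real t"
      by (simp add: n algebra_simps)
    then have "real n / (real p - 1) = real r + real r / (real p - 1) + real t / (real p - 1)"
      using p by (simp add: add_divide_distrib)
    ultimately show ?thesis
      using IH multiplicity_fact_rec[OF assms, of n] unfolding r_def by simp
  qed simp
qed

text \<open>With \<open>r = q - n\<close>, the Hurwitz coefficient is \<open>q! / r!\<close> times
  \<open>(p b) ^ r\<close>. The power of \<open>p\<close> lost with \<open>r!\<close> is at most
  \<open>p ^ r\<close> and is returned by \<open>(p b) ^ r\<close>, so the whole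
  \<open>p\<close>-part of \<open>q!\<close> survives.\<close>

lemma hdvd_linear_power:
  fixes p :: nat
  assumes "prime p"
  shows "hdvd (int p ^ multiplicity p (fact q :: nat)) ([:of_int (int p * b), 1:] ^ q)"
  unfolding hdvd_def
proof
  fix n
  show "\<exists>z::int. fact n * coeff ([:of_int (int p * b), 1 :: real:] ^ q) n
      = of_int (int p ^ multiplicity p (fact q :: nat) * z)"
  proof (cases "n \<le> q")
    case False
    then have "coeff ([:of_int (int p * b), 1 :: real:] ^ q) n = 0"
      by (intro coeff_eq_0) (simp add: degree_linear_power)
    then show ?thesis by (intro exI[of _ "0::int"]) simp
  next
    case True
    define r where "r = q - n"
    define x :: nat where "x = fact n * (q choose n) * p ^ r"
    have x: "x * fact r = fact q * p ^ r"
      using binomial_fact_lemma[OF True] unfolding x_def r_def by (metis mult.assoc mult.commute)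
    define c where "c = multiplicity p (fact r :: nat)"
    have c: "c \<le> r" unfolding c_def by (rule multiplicity_fact_le[OF assms])
    obtain u where u: "fact r = p ^ c * u" "\<not> p dvd u"
      using multiplicity_decompose'[of "fact r" p] assms unfolding c_def
      by (metis fact_nonzero not_prime_unit)
    have "x * u * p ^ c = fact q * p ^ (r - c) * p ^ c"
      using x u(1) c by (simp add: algebra_simps flip: power_add)
    then have "x * u = fact q * p ^ (r - c)"
      using assms by (simp add: prime_gt_0_nat)
    then have "p ^ multiplicity p (fact q :: nat) dvd x * u"
      using multiplicity_dvd dvd_mult2 by metis
    moreover have "coprime (p ^ multiplicity p (fact q :: nat)) u"
      using assms u(2) by (simp add: prime_imp_coprime)
    ultimately have "p ^ multiplicity p (fact q :: nat) dvd x"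
      by (simp add: coprime_dvd_mult_left_iff)
    then obtain y where y: "x = p ^ multiplicity p (fact q :: nat) * y" by blast
    have "fact n * coeff ([:of_int (int p * b), 1 :: real:] ^ q) n
        = fact n * real (q choose n) * (real p * of_int b) ^ r"
      using True by (simp add: coeff_linear_poly_power r_def)
    also have "\<dots> = real x * of_int b ^ r"
      by (simp add: x_def power_mult_distrib)
    also have "\<dots> = of_int (int p ^ multiplicity p (fact q :: nat) * (int y * b ^ r))"
      by (simp add: y)
    finally show ?thesis by blast
  qed
qed

section \<open>Divisors of the approximations at the nodes\<close>

lemma poly_deriv_sum_0: "poly (deriv_sum f) 0 = (\<Sum>n\<le>degree f. fact n * coeff f n)"
  by (simp add: deriv_sum_def poly_sum)
     (simp add: poly_0_coeff_0 coeff_higher_pderiv flip: pochhammer_fact)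

lemma hdvd_poly_deriv_sum_0:
  assumes "hdvd d f"
  shows "\<exists>z::int. poly (deriv_sum f) 0 = of_int (d * z)"
proof -
  obtain u where u: "\<And>n. fact n * coeff f n = of_int (d * u n)"
    using assms unfolding hdvd_def by metis
  have "poly (deriv_sum f) 0 = of_int (d * (\<Sum>n\<le>degree f. u n))"
    by (simp add: poly_deriv_sum_0 u sum_distrib_left)
  then show ?thesis by blast
qed

lemma deriv_sum_shift: "poly (deriv_sum f) a = poly (deriv_sum (pcompose f [:a, 1:])) 0"
proof -
  have "(pderiv ^^ i) (pcompose f [:a, 1:]) = pcompose ((pderiv ^^ i) f) [:a, 1:]" for i
    by (induction i) (auto simp: pderiv_pcompose pderiv_pCons)
  then show ?thesis
    by (simp add: deriv_sum_def degree_pcompose poly_sum poly_pcompose)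
qed

text \<open>Every complete block of \<open>p\<close> consecutive nodes contains one node congruent
  to \<open>j\<close>; if no block is complete, \<open>j\<close> itself still counts. The
  \<open>max 1\<close> is what keeps the plain factor \<open>fact q\<close> at large primes.\<close>

lemma residue_class_card:
  fixes p m j :: nat
  assumes "p > 0" "j \<le> m"
  shows "max 1 (Suc m div p) \<le> card {i. i \<le> m \<and> int p dvd int j - int i}"
proof -
  let ?I = "{i. i \<le> m \<and> int p dvd int j - int i}"
  have fin: "finite ?I" by simp
  have "j \<in> ?I" using assms by simp
  then have "card ?I \<ge> 1" using fin by (metis One_nat_def Suc_leI card_gt_0_iff empty_iff)
  moreover have "Suc m div p \<le> card ?I"
  proof -
    have "(\<lambda>t. p * t + j mod p) ` {..<Suc m div p} \<subseteq> ?I"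
    proof (safe)
      fix t assume "t < Suc m div p"
      then have "p * Suc t \<le> p * (Suc m div p)" by (intro mult_le_mono) auto
      also have "\<dots> \<le> Suc m" by simp
      finally have "p * t + p \<le> Suc m" by simp
      then show "p * t + j mod p \<le> m"
        using mod_less_divisor[OF assms(1), of j] by linarith
      have "int j - int (p * t + j mod p) = int p * (int (j div p) - int t)"
        by (simp add: algebra_simps) (metis mod_mult_div_eq of_nat_add of_nat_mult)
      then show "int p dvd int j - int (p * t + j mod p)" by simp
    qed
    then have "card ((\<lambda>t. p * t + j mod p) ` {..<Suc m div p}) \<le> card ?I"
      using fin card_mono by blast
    then show ?thesis
      using assms by (subst (asm) card_image) (auto simp: inj_on_def)
  qed
  ultimately show ?thesis by simp
qed

lemma pcompose_power: "pcompose (f ^ n) g = pcompose f g ^ n" for f g :: "real poly"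
  by (induction n) (simp_all add: pcompose_mult pcompose_1)

definition approximant :: "nat \<Rightarrow> nat \<Rightarrow> nat \<Rightarrow> real poly" where
  "approximant m q k = node_poly m ^ q * omit_poly m k"

text \<open>After moving \<open>j\<close> to the origin, each node congruent to \<open>j\<close>
  contributes a factor \<open>(x + p b) ^ q\<close>, hence the full \<open>p\<close>-part of
  \<open>q!\<close>. The remaining linear factors are only used as having integral Hurwitz
  coefficients.\<close>

lemma approximant_prime_power_dvd:
  fixes p :: nat
  assumes "prime p" "j \<le> m" "k \<le> m"
  shows "\<exists>z::int. poly (deriv_sum (approximant m q k)) (real j)
    = of_int (int p ^ (multiplicity p (fact q :: nat) * max 1 (Suc m div p)) * z)"
proof -
  define e where "e = multiplicity p (fact q :: nat)"
  define I where "I = {i. i \<le> m \<and> int p dvd int j - int i}"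
  let ?lin = "\<lambda>i. [:of_int (int j - int i), 1 :: real:]"
  \<comment> \<open>The exponent \<open>1\<close> is written out so that
    \<open>hdvd_linear_power_1\<close> applies to the second product as well.\<close>
  have shift: "pcompose (approximant m q k) [:real j, 1:]
      = (\<Prod>i\<le>m. ?lin i ^ q) * (\<Prod>i\<in>{..m} - {k}. ?lin i ^ 1)"
    by (simp add: approximant_def node_poly_def omit_poly_def pcompose_mult pcompose_prod
        pcompose_power pcompose_pCons flip: prod_power_distrib)
  have "hdvd (if i \<in> I then int p ^ e else 1) (?lin i ^ q)" for i
  proof (cases "i \<in> I")
    case True
    then obtain b where "int j - int i = int p * b" by (auto simp: I_def)
    then show ?thesis using True hdvd_linear_power[OF assms(1), of q b] by (simp add: e_def)
  qed (use hdvd_linear_power_1[of "int j - int i" q] in simp)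
  then have "hdvd ((\<Prod>i\<le>m. if i \<in> I then int p ^ e else 1) * (\<Prod>i\<in>{..m} - {k}. 1))
      (pcompose (approximant m q k) [:real j, 1:])"
    unfolding shift by (intro hdvd_mult hdvd_prod hdvd_linear_power_1) auto
  then obtain z where z: "poly (deriv_sum (approximant m q k)) (real j)
      = of_int ((\<Prod>i\<le>m. if i \<in> I then int p ^ e else 1) * z)"
    using hdvd_poly_deriv_sum_0 deriv_sum_shift[of _ "real j"] by force
  have "(\<Prod>i\<le>m. if i \<in> I then int p ^ e else 1) = (int p ^ e) ^ card I"
    by (subst prod.If_cases) (simp_all add: I_def Int_absorb1 Collect_mono_iff subset_iff)
  then have "int p ^ (e * max 1 (Suc m div p)) dvd (\<Prod>i\<le>m. if i \<in> I then int p ^ e else 1)"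
    using residue_class_card[OF prime_gt_0_nat[OF assms(1)] assms(2)]
    by (auto simp: I_def simp flip: power_mult intro!: le_imp_power_dvd mult_le_mono)
  then obtain y where "(\<Prod>i\<le>m. if i \<in> I then int p ^ e else 1) = int p ^ (e * max 1 (Suc m div p)) * y"
    by blast
  then show ?thesis unfolding e_def[symmetric] z by (metis mult.assoc)
qed

text \<open>For larger primes \<open>Suc m div p\<close> is at most \<open>1\<close>, and nothing is
  gained beyond \<open>fact q\<close>.\<close>

definition extra_primes :: "nat \<Rightarrow> nat set" where
  "extra_primes m = {p. prime p \<and> real p \<le> (real m + 1) / 2}"

lemma finite_extra_primes: "finite (extra_primes m)"
  by (rule finite_subset[of _ "{..m+1}"]) (auto simp: extra_primes_def)

text \<open>One of the \<open>Suc m div p\<close> copies of the \<open>p\<close>-part already sits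
  in \<open>fact q\<close>, whence the exponent \<open>Suc m div p - 1\<close>.\<close>

definition common_factor :: "nat \<Rightarrow> nat \<Rightarrow> nat" where
  "common_factor m q = fact q * (\<Prod>p\<in>extra_primes m. p ^ (multiplicity p (fact q :: nat) * (Suc m div p - 1)))"

lemma common_factor_pos: "common_factor m q > 0"
  by (auto simp: common_factor_def extra_primes_def prime_gt_0_nat intro!: prod_pos)

lemma approximant_common_factor_dvd:
  assumes "j \<le> m" "k \<le> m"
  shows "\<exists>z::int. poly (deriv_sum (approximant m q k)) (real j) = of_int (int (common_factor m q) * z)"
proof -
  \<comment> \<open>Any prime would do: only the integrality of the value is extracted here.\<close>
  have "prime (2::nat)" by simp
  then obtain z0 :: int where z0: "poly (deriv_sum (approximant m q k)) (real j) = of_int z0"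
    using approximant_prime_power_dvd[OF _ assms] by metis
  have "common_factor m q dvd nat \<bar>z0\<bar>"
  proof (cases "z0 = 0")
    case False
    show ?thesis
    proof (rule multiplicity_le_imp_dvd)
      show "common_factor m q \<noteq> 0" using common_factor_pos[of m q] by simp
      fix p :: nat assume p: "prime p"
      have "multiplicity p (\<Prod>p\<in>extra_primes m. p ^ (multiplicity p (fact q :: nat) * (Suc m div p - 1)))
          = (if p \<in> extra_primes m then multiplicity p (fact q :: nat) * (Suc m div p - 1) else 0)"
        by (rule multiplicity_prod_prime_powers) (rule finite_extra_primes, auto simp: p extra_primes_def)
      moreover have "(\<Prod>p\<in>extra_primes m. p ^ (multiplicity p (fact q :: nat) * (Suc m div p - 1))) \<noteq> 0"
        using common_factor_pos[of m q] by (auto simp: common_factor_def)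
      ultimately have "multiplicity p (common_factor m q)
          \<le> multiplicity p (fact q :: nat) + multiplicity p (fact q :: nat) * (Suc m div p - 1)"
        unfolding common_factor_def using p
        by (subst prime_elem_multiplicity_mult_distrib) auto
      also have "\<dots> = multiplicity p (fact q :: nat) * max 1 (Suc m div p)"
        by (cases "Suc m div p") auto
      also have "\<dots> \<le> multiplicity p (nat \<bar>z0\<bar>)"
      proof (rule multiplicity_geI)
        show "nat \<bar>z0\<bar> \<noteq> 0" using False by simp
        show "\<not> is_unit p" using p not_prime_unit by blast
        obtain z where "of_int z0 = (of_int (int p ^ (multiplicity p (fact q :: nat) * max 1 (Suc m div p)) * z) :: real)"
          using approximant_prime_power_dvd[OF p assms] z0 by metis
        then have "z0 = int p ^ (multiplicity p (fact q :: nat) * max 1 (Suc m div p)) * z"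
          using of_int_eq_iff by blast
        then have "int (p ^ (multiplicity p (fact q :: nat) * max 1 (Suc m div p))) dvd z0"
          by (auto simp del: dvd_imp_mod_0)
        then show "p ^ (multiplicity p (fact q :: nat) * max 1 (Suc m div p)) dvd nat \<bar>z0\<bar>"
          by (metis int_dvd_int_iff dvd_abs_iff int_nat_eq abs_ge_zero)
      qed
      finally show "multiplicity p (common_factor m q) \<le> multiplicity p (nat \<bar>z0\<bar>)" .
    qed
  qed simp
  then have "int (common_factor m q) dvd z0"
    by (metis int_dvd_int_iff dvd_abs_iff int_nat_eq abs_ge_zero)
  then show ?thesis using z0 by auto
qed

section \<open>Size of the approximations\<close>

lemma ln_ratio_bounds:
  fixes x :: real
  assumes "x > 1"
  shows "2 * ((x - 1) / (x + 1)) \<le> ln x"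
    and "ln x \<le> 2 * ((x - 1) / (x + 1)) + 2 / 3 * ((x - 1) / (x + 1)) ^ 3 / (1 - ((x - 1) / (x + 1)) ^ 2)"
  using ln_approx_bounds[of x 1] assms by (simp_all add: mult_ac)

text \<open>These control the increments of \<open>(n + 1/2) * ln n - n\<close> against those of
  \<open>ln (fact n)\<close>. The upper error is put in telescoping form, so that its total from
  \<open>n = 1\<close> on is at most \<open>1/12\<close>.\<close>

lemma ln_Suc_minus_ln:
  fixes n :: real
  assumes "n > 0"
  shows "1 \<le> (n + 1/2) * (ln (n + 1) - ln n)"
    and "(n + 1/2) * (ln (n + 1) - ln n) \<le> 1 + 1 / (12 * n) - 1 / (12 * (n + 1))"
proof -
  have eq: "ln (n + 1) - ln n = ln ((n + 1) / n)"
    using assms by (simp add: ln_divide_pos)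
  have z: "((n + 1) / n - 1) / ((n + 1) / n + 1) = 1 / (2 * n + 1)"
    using assms by (simp add: field_simps)
  have gt: "(n + 1) / n > 1" using assms by simp
  from ln_ratio_bounds(1)[OF gt] have 1: "2 / (2 * n + 1) \<le> ln (n + 1) - ln n"
    unfolding z eq by simp
  from mult_left_mono[OF 1, of "n + 1/2"] show "1 \<le> (n + 1/2) * (ln (n + 1) - ln n)"
    using assms by (simp add: field_simps)
  define y where "y = 2 * n + 1"
  have y: "y > 1" using assms by (simp add: y_def)
  have "ln (n + 1) - ln n \<le> 2 * (1 / y) + 2 / 3 * (1 / y) ^ 3 / (1 - (1 / y) ^ 2)"
    using ln_ratio_bounds(2)[OF gt] unfolding z eq y_def by simp
  also have "\<dots> = 2 / y * (1 + 1 / (3 * (y ^ 2 - 1)))"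
  proof -
    have "y ^ 2 - 1 \<noteq> 0" using y by (simp add: power2_eq_square) (smt (verit) mult_less_cancel_right1)
    then show ?thesis using y by (simp add: field_simps power2_eq_square power3_eq_cube)
  qed
  finally have "(y / 2) * (ln (n + 1) - ln n) \<le> (y / 2) * (2 / y * (1 + 1 / (3 * (y ^ 2 - 1))))"
    using y by (intro mult_left_mono) auto
  also have "\<dots> = 1 + 1 / (3 * (y ^ 2 - 1))" using y by simp
  also have "y ^ 2 - 1 = 4 * n * (n + 1)" by (simp add: y_def power2_eq_square algebra_simps)
  also have "1 + 1 / (3 * (4 * n * (n + 1))) = 1 + 1 / (12 * n) - 1 / (12 * (n + 1))"
  proof -
    have "1 / (12 * n) - 1 / (12 * (n + 1)) = (1 / 12) * (1 / n - 1 / (n + 1))"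
      by (simp add: right_diff_distrib)
    also have "1 / n - 1 / (n + 1) = 1 / (n * (n + 1))"
      using assms by (simp add: divide_simps)
    finally show ?thesis by simp
  qed
  finally show "(n + 1/2) * (ln (n + 1) - ln n) \<le> 1 + 1 / (12 * n) - 1 / (12 * (n + 1))"
    by (simp add: y_def add_divide_distrib)
qed

lemma ln_fact_upper:
  assumes "n \<ge> 1"
  shows "ln (fact n) \<le> (real n + 1/2) * ln (real n) - real n + 1"
  using assms
proof (induction n rule: nat_induct_at_least)
  case (Suc n)
  define x where "x = real n"
  have x: "x > 0" "real (Suc n) = x + 1" using Suc by (auto simp: x_def)
  have "ln (fact (Suc n)) = ln (x + 1) + ln (fact n :: real)"
    by (simp add: ln_mult_pos add.commute x_def)
  moreover have "ln (fact n) \<le> (x + 1/2) * ln x - x + 1"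
    using Suc by (simp add: x_def)
  moreover have "(x + 1 + 1/2) * ln (x + 1) = (x + 1/2) * (ln (x + 1) - ln x) + (x + 1/2) * ln x + ln (x + 1)"
    by (simp add: algebra_simps)
  ultimately show ?case
    unfolding x(2) using ln_Suc_minus_ln(1)[OF x(1)] by linarith
qed simp

lemma ln_fact_lower:
  assumes "n \<ge> 1"
  shows "(real n + 1/2) * ln (real n) - real n + 11/12 \<le> ln (fact n)"
proof -
  \<comment> \<open>The term \<open>1 / (12 * n)\<close> makes the induction telescope; at
    \<open>n = 1\<close> both sides are \<open>0\<close>.\<close>
  have "(real n + 1/2) * ln (real n) - real n + 11/12 + 1 / (12 * real n) \<le> ln (fact n)"
    using assms
  proof (induction n rule: nat_induct_at_least)
    case (Suc n)
    define x where "x = real n"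
    have x: "x > 0" "real (Suc n) = x + 1" using Suc by (auto simp: x_def)
    have "ln (fact (Suc n)) = ln (x + 1) + ln (fact n :: real)"
      by (simp add: ln_mult_pos add.commute x_def)
    moreover have "(x + 1/2) * ln x - x + 11/12 + 1 / (12 * x) \<le> ln (fact n)"
      using Suc by (simp add: x_def)
    moreover have "(x + 1 + 1/2) * ln (x + 1) = (x + 1/2) * (ln (x + 1) - ln x) + (x + 1/2) * ln x + ln (x + 1)"
      by (simp add: algebra_simps)
    ultimately show ?case
      unfolding x(2) using ln_Suc_minus_ln(2)[OF x(1)] by linarith
  qed simp
  moreover have "1 / (12 * real n) \<ge> 0" by simp
  ultimately show ?thesis by linarith
qed

section \<open>Coefficient majorants and the value at the origin\<close>

definition dominated :: "real poly \<Rightarrow> real poly \<Rightarrow> bool" where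
  "dominated f g \<longleftrightarrow> (\<forall>n. \<bar>coeff f n\<bar> \<le> coeff g n)"

lemma dominated_mult:
  assumes "dominated f f'" "dominated g g'"
  shows "dominated (f * g) (f' * g')"
  unfolding dominated_def
proof
  fix n
  have "\<bar>coeff (f * g) n\<bar> \<le> (\<Sum>i\<le>n. \<bar>coeff f i * coeff g (n - i)\<bar>)"
    unfolding coeff_mult by (rule sum_abs)
  also have "\<dots> \<le> (\<Sum>i\<le>n. coeff f' i * coeff g' (n - i))"
    unfolding abs_mult
    by (intro sum_mono mult_mono) (use assms in \<open>auto simp: dominated_def intro: order.trans[OF abs_ge_zero]\<close>)
  finally show "\<bar>coeff (f * g) n\<bar> \<le> coeff (f' * g') n" by (simp add: coeff_mult)
qed

lemma dominated_1: "dominated 1 1"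
  by (simp add: dominated_def coeff_1)

lemma dominated_prod:
  assumes "finite A" "\<And>i. i \<in> A \<Longrightarrow> dominated (f i) g"
  shows "dominated (prod f A) (g ^ card A)"
  using assms by (induction A) (auto intro: dominated_mult dominated_1)

lemma dominated_power: "dominated f g \<Longrightarrow> dominated (f ^ n) (g ^ n)"
  by (induction n) (auto intro: dominated_mult dominated_1)

lemma dominated_linear: "i \<le> m \<Longrightarrow> dominated [:- real i, 1:] [:real m, 1:]"
  by (auto simp: dominated_def coeff_pCons split: nat.splits)

lemma dominated_approximant:
  assumes "k \<le> m"
  shows "dominated (approximant m q k) ([:real m, 1:] ^ (Suc m * q + m))"
proof -
  have "dominated (node_poly m) ([:real m, 1:] ^ card {..m})"
    unfolding node_poly_def by (rule dominated_prod) (auto simp: dominated_linear)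
  then have "dominated (node_poly m) ([:real m, 1:] ^ Suc m)" by simp
  moreover have "dominated (omit_poly m k) ([:real m, 1:] ^ card ({..m} - {k}))"
    unfolding omit_poly_def by (rule dominated_prod) (auto simp: dominated_linear)
  then have "dominated (omit_poly m k) ([:real m, 1:] ^ m)" using assms by simp
  ultimately show ?thesis
    unfolding approximant_def power_add power_mult by (intro dominated_mult dominated_power)
qed

lemma degree_approximant: "k \<le> m \<Longrightarrow> degree (approximant m q k) = Suc m * q + m"
proof -
  assume "k \<le> m"
  moreover have "omit_poly m k \<noteq> 0" by (auto simp: omit_poly_def)
  ultimately show ?thesis
    by (simp add: approximant_def degree_mult_eq node_poly_nonzero degree_power_eq degree_node_poly
        degree_omit_poly mult.commute)
qed

lemma sum_power_fact_le_exp: "(x::real) \<ge> 0 \<Longrightarrow> (\<Sum>i\<le>n. x ^ i / fact i) \<le> exp x"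
proof -
  assume "x \<ge> 0"
  have "(\<Sum>i<Suc n. x ^ i /\<^sub>R fact i) \<le> (\<Sum>i. x ^ i /\<^sub>R fact i)"
    by (rule sum_le_suminf) (use \<open>x \<ge> 0\<close> in \<open>auto simp: summable_exp\<close>)
  then show ?thesis unfolding exp_def lessThan_Suc_atMost by (simp add: field_simps)
qed

text \<open>The majorant \<open>(x + m) ^ L\<close> turns \<open>fact n\<close> times the
  \<open>n\<close>-th coefficient into \<open>L! * m ^ (L - n) / (L - n)!\<close>, and the sum of
  these is a partial sum of \<open>L! * exp m\<close>.\<close>

lemma approximant_at_0_bound:
  assumes "k \<le> m"
  shows "\<bar>poly (deriv_sum (approximant m q k)) 0\<bar> \<le> exp (real m) * fact (Suc m * q + m)"
proof -
  define L where "L = Suc m * q + m"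
  have "\<bar>poly (deriv_sum (approximant m q k)) 0\<bar> \<le> (\<Sum>n\<le>L. \<bar>fact n * coeff (approximant m q k) n\<bar>)"
    unfolding poly_deriv_sum_0 degree_approximant[OF assms] L_def by (rule sum_abs)
  also have "\<dots> \<le> (\<Sum>n\<le>L. fact L * (real m ^ (L - n) / fact (L - n)))"
  proof (rule sum_mono)
    fix n assume n: "n \<in> {..L}"
    have "\<bar>coeff (approximant m q k) n\<bar> \<le> coeff ([:real m, 1:] ^ L) n"
      using dominated_approximant[OF assms, of q] by (simp add: dominated_def L_def)
    also have "\<dots> = real (L choose n) * real m ^ (L - n)"
      using n by (simp add: coeff_linear_poly_power)
    finally have "fact n * \<bar>coeff (approximant m q k) n\<bar> \<le> fact n * (real (L choose n) * real m ^ (L - n))"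
      by (intro mult_left_mono) auto
    also have "real (L choose n) = fact L / (fact n * fact (L - n))"
      using n by (simp add: binomial_fact)
    finally show "\<bar>fact n * coeff (approximant m q k) n\<bar> \<le> fact L * (real m ^ (L - n) / fact (L - n))"
      by (simp add: abs_mult)
  qed
  also have "\<dots> = fact L * (\<Sum>n\<le>L. real m ^ (L - n) / fact (L - n))"
    by (simp add: sum_distrib_left)
  also have "(\<Sum>n\<le>L. real m ^ (L - n) / fact (L - n)) = (\<Sum>n\<le>L. real m ^ n / fact n)"
    by (rule sum.reindex_bij_witness[of _ "\<lambda>i. L - i" "\<lambda>i. L - i"]) auto
  also have "fact L * \<dots> \<le> fact L * exp (real m)"
    by (intro mult_left_mono sum_power_fact_le_exp) auto
  finally show ?thesis by (simp add: L_def mult.commute)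
qed

text \<open>Cauchy's mean value theorem for \<open>exp (- x) * F x\<close> against
  \<open>exp (- x)\<close>, in place of Hermite's integral: comparing with \<open>exp (- x)\<close>
  cancels the exponential at the intermediate point.\<close>

lemma deriv_sum_remainder:
  assumes "a > 0"
  shows "\<exists>c. 0 < c \<and> c < a \<and>
    exp a * poly (deriv_sum f) 0 - poly (deriv_sum f) a = (exp a - 1) * poly f c"
proof -
  let ?F = "deriv_sum f"
  let ?g = "\<lambda>x::real. exp (- x) * poly ?F x"
  have d1: "(?g has_real_derivative - exp (- x) * poly f x) (at x)" for x
    by (rule derivative_eq_intros refl poly_DERIV)+ (simp add: pderiv_deriv_sum algebra_simps)
  have d2: "((\<lambda>x::real. exp (- x)) has_real_derivative - exp (- x)) (at x)" for x
    by (rule derivative_eq_intros refl)+ simp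
  have "\<exists>c. 0 < c \<and> c < a \<and>
      (?g a - ?g 0) * - exp (- c) = (exp (- a) - exp (- 0)) * (- exp (- c) * poly f c)"
    by (rule GMVT'[OF assms]) (intro DERIV_isCont[OF d1] DERIV_isCont[OF d2] d1 d2)+
  then obtain c where c: "0 < c" "c < a"
    "(?g a - ?g 0) * - exp (- c) = (exp (- a) - exp (- 0)) * (- exp (- c) * poly f c)"
    by blast
  then have "exp (- c) * (?g a - ?g 0) = exp (- c) * ((exp (- a) - 1) * poly f c)"
    by (simp add: algebra_simps)
  then have "?g a - ?g 0 = (exp (- a) - 1) * poly f c" by simp
  then have "exp a * (?g a - ?g 0) = exp a * ((exp (- a) - 1) * poly f c)" by simp
  then have "poly ?F a - exp a * poly ?F 0 = (1 - exp a) * poly f c"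
    by (simp add: right_diff_distrib left_diff_distrib flip: mult.assoc exp_add)
  then show ?thesis using c by (intro exI[of _ c]) (simp add: algebra_simps)
qed

lemma approximant_remainder_bound:
  assumes "k \<le> m" "1 \<le> j" "j \<le> m"
    and M: "\<And>x. 0 \<le> x \<Longrightarrow> x \<le> real m \<Longrightarrow> \<bar>poly (node_poly m) x\<bar> \<le> M"
    and B: "\<And>x. 0 \<le> x \<Longrightarrow> x \<le> real m \<Longrightarrow> \<bar>poly (omit_poly m k) x\<bar> \<le> B"
  shows "\<bar>exp (real j) * poly (deriv_sum (approximant m q k)) 0 - poly (deriv_sum (approximant m q k)) (real j)\<bar>
    \<le> (exp (real j) - 1) * (M ^ q * B)"
proof -
  obtain c where c: "0 < c" "c < real j" and
    eq: "exp (real j) * poly (deriv_sum (approximant m q k)) 0 - poly (deriv_sum (approximant m q k)) (real j)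
      = (exp (real j) - 1) * poly (approximant m q k) c"
    using deriv_sum_remainder[of "real j" "approximant m q k"] assms(2) by auto
  have "c \<le> real m" using c assms by simp
  with c M[of c] B[of c] have "\<bar>poly (node_poly m) c\<bar> \<le> M" "\<bar>poly (omit_poly m k) c\<bar> \<le> B" by auto
  then have "\<bar>poly (approximant m q k) c\<bar> \<le> M ^ q * B"
    unfolding approximant_def poly_mult poly_power abs_mult power_abs
    by (intro mult_mono power_mono) (auto intro: order.trans[OF abs_ge_zero])
  then show ?thesis
    unfolding eq abs_mult by (intro mult_mono) auto
qed

text \<open>The sum of \<open>lam j * F j\<close> is a nonzero multiple of \<open>D\<close>, and
  equals \<open>F 0\<close> times the linear form minus remainders. By \<open>small\<close> the
  remainders take at most \<open>D / 2\<close>; the other half must come from the linear form, since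
  \<open>F 0\<close> has bounded size.\<close>

theorem linear_form_lower_bound:
  fixes lam :: "nat \<Rightarrow> int"
  assumes nz: "\<exists>i\<le>m. lam i \<noteq> 0" and H: "\<And>i. 1 \<le> i \<Longrightarrow> i \<le> m \<Longrightarrow> \<bar>real_of_int (lam i)\<bar> \<le> H"
    and M: "\<And>x. 0 \<le> x \<Longrightarrow> x \<le> real m \<Longrightarrow> \<bar>poly (node_poly m) x\<bar> \<le> M"
    and B: "\<And>x k. k \<le> m \<Longrightarrow> 0 \<le> x \<Longrightarrow> x \<le> real m \<Longrightarrow> \<bar>poly (omit_poly m k) x\<bar> \<le> B"
    and small: "H * ((\<Sum>j=1..m. exp (real j) - 1) * (M ^ q * B)) \<le> real (common_factor m q) / 2"
  shows "real (common_factor m q) / (2 * (exp (real m) * fact (Suc m * q + m)))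
    \<le> \<bar>\<Sum>i=0..m. real_of_int (lam i) * exp 1 ^ i\<bar>"
proof -
  define D where "D = real (common_factor m q)"
  have D: "D > 0" using common_factor_pos by (simp add: D_def)
  have exp1: "exp (1::real) ^ i = exp (real i)" for i
    using exp_of_nat_mult[of i "1::real"] by simp
  have "\<exists>i\<le>m. real_of_int (lam i) \<noteq> 0" using nz by auto
  from exists_nonvanishing_approximant[OF this, of q] obtain k where k: "k \<le> m"
    and W: "(\<Sum>j\<le>m. real_of_int (lam j) * poly (deriv_sum (approximant m q k)) (real j)) \<noteq> 0"
    unfolding approximant_def by blast
  define F where "F x = poly (deriv_sum (approximant m q k)) x" for x
  have "\<exists>z. \<forall>j\<le>m. F (real j) = of_int (int (common_factor m q) * z j)"
    unfolding F_def using approximant_common_factor_dvd[OF _ k, of _ q] by metis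
  then obtain z where z: "\<And>j. j \<le> m \<Longrightarrow> F (real j) = of_int (int (common_factor m q) * z j)" by blast
  define Z where "Z = (\<Sum>j\<le>m. lam j * z j)"
  have sumZ: "(\<Sum>j\<le>m. real_of_int (lam j) * F (real j)) = D * of_int Z"
    by (simp add: z Z_def D_def sum_distrib_left algebra_simps)
  with W have "Z \<noteq> 0" unfolding F_def by auto
  then have "1 \<le> \<bar>real_of_int Z\<bar>" by linarith
  then have "D \<le> \<bar>D * of_int Z\<bar>" using D by (simp add: abs_mult)
  also have "D * of_int Z = F 0 * (\<Sum>i\<le>m. real_of_int (lam i) * exp 1 ^ i)
      - (\<Sum>i\<le>m. real_of_int (lam i) * (exp (real i) * F 0 - F (real i)))"
    unfolding sumZ[symmetric] exp1 by (simp add: sum_distrib_left sum_subtractf algebra_simps)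
  \<comment> \<open>The term \<open>i = 0\<close> is \<open>lam 0 * (F 0 - F 0)\<close>, so exactly
    the coefficients bounded by \<open>H\<close> remain.\<close>
  also have "(\<Sum>i\<le>m. real_of_int (lam i) * (exp (real i) * F 0 - F (real i)))
      = (\<Sum>i=1..m. real_of_int (lam i) * (exp (real i) * F 0 - F (real i)))"
    by (rule sum.mono_neutral_right) (auto simp: not_less_eq_eq)
  also have "\<bar>F 0 * (\<Sum>i\<le>m. real_of_int (lam i) * exp 1 ^ i)
      - (\<Sum>i=1..m. real_of_int (lam i) * (exp (real i) * F 0 - F (real i)))\<bar> \<le> \<bar>F 0\<bar> * \<bar>\<Sum>i\<le>m. real_of_int (lam i) * exp 1 ^ i\<bar>
      + \<bar>\<Sum>i=1..m. real_of_int (lam i) * (exp (real i) * F 0 - F (real i))\<bar>"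
    unfolding abs_mult[symmetric] by (rule abs_triangle_ineq4)
  also have "\<bar>\<Sum>i=1..m. real_of_int (lam i) * (exp (real i) * F 0 - F (real i))\<bar>
      \<le> (\<Sum>i=1..m. H * ((exp (real i) - 1) * (M ^ q * B)))"
  proof (intro order.trans[OF sum_abs] sum_mono)
    fix i assume i: "i \<in> {1..m}"
    have "\<bar>real_of_int (lam i)\<bar> \<le> H" using H i by simp
    moreover have "\<bar>exp (real i) * F 0 - F (real i)\<bar> \<le> (exp (real i) - 1) * (M ^ q * B)"
      unfolding F_def using i by (intro approximant_remainder_bound k M B) auto
    ultimately show "\<bar>real_of_int (lam i) * (exp (real i) * F 0 - F (real i))\<bar>
        \<le> H * ((exp (real i) - 1) * (M ^ q * B))"
      unfolding abs_mult by (intro mult_mono) (auto intro: order.trans[OF abs_ge_zero])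
  qed
  also have "\<dots> = H * ((\<Sum>j=1..m. exp (real j) - 1) * (M ^ q * B))"
    by (simp add: sum_distrib_left sum_distrib_right)
  also have "\<dots> \<le> D / 2" using small by (simp add: D_def)
  finally have "D / 2 \<le> \<bar>F 0\<bar> * \<bar>\<Sum>i\<le>m. real_of_int (lam i) * exp 1 ^ i\<bar>" by simp
  also have "\<dots> \<le> (exp (real m) * fact (Suc m * q + m)) * \<bar>\<Sum>i\<le>m. real_of_int (lam i) * exp 1 ^ i\<bar>"
    unfolding F_def by (intro mult_right_mono approximant_at_0_bound k) auto
  finally show ?thesis
    by (simp add: D_def field_simps atLeast0AtMost)
qed

section \<open>Reduction to a numerical inequality\<close>

text \<open>\<open>gain_rate m\<close> is \<open>m \<kappa>\<^sub>m\<close> without the factors \<open>w\<^sub>p\<close>; \<open>gain_loss m\<close> multiplies the logarithmic error term of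
  Legendre's formula.\<close>

definition gain_rate :: "nat \<Rightarrow> real" where
  "gain_rate m = (\<Sum>p\<in>extra_primes m. real (Suc m div p - 1) * (ln (real p) / (real p - 1)))"

definition gain_loss :: "nat \<Rightarrow> real" where
  "gain_loss m = (\<Sum>p\<in>extra_primes m. real (Suc m div p - 1))"

lemma gain_loss_nonneg: "gain_loss m \<ge> 0"
  by (auto simp: gain_loss_def intro: sum_nonneg)

lemma gain_rate_nonneg: "gain_rate m \<ge> 0"
  by (auto simp: gain_rate_def extra_primes_def dest: prime_gt_1_nat intro!: sum_nonneg mult_nonneg_nonneg divide_nonneg_nonneg)

text \<open>The gain is linear in \<open>q\<close>, hence of the same order as the geometric growth
  \<open>mu\<close> of the approximants, and the loss is logarithmic. Both come from
  \<open>multiplicity_fact_ge\<close> at each extra prime.\<close>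

lemma ln_common_factor_ge:
  "ln (fact q) + gain_rate m * real q - gain_loss m * ln (real q + 1) \<le> ln (real (common_factor m q))"
proof -
  have pos: "real p ^ (multiplicity p (fact q :: nat) * (Suc m div p - 1)) > 0" if "p \<in> extra_primes m" for p
    using that by (auto simp: extra_primes_def prime_gt_0_nat)
  have "ln (real (common_factor m q))
      = ln (fact q) + ln (\<Prod>p\<in>extra_primes m. real p ^ (multiplicity p (fact q :: nat) * (Suc m div p - 1)))"
    unfolding common_factor_def of_nat_mult of_nat_prod of_nat_power of_nat_fact
    by (rule ln_mult_pos) (auto intro!: prod_pos pos)
  also have "ln (\<Prod>p\<in>extra_primes m. real p ^ (multiplicity p (fact q :: nat) * (Suc m div p - 1)))
      = (\<Sum>p\<in>extra_primes m. ln (real p ^ (multiplicity p (fact q :: nat) * (Suc m div p - 1))))"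
    by (rule ln_prod) (auto intro: finite_extra_primes pos)
  finally have eq: "ln (real (common_factor m q)) = ln (fact q)
      + (\<Sum>p\<in>extra_primes m. ln (real p ^ (multiplicity p (fact q :: nat) * (Suc m div p - 1))))" .
  have "(\<Sum>p\<in>extra_primes m. real (Suc m div p - 1) * (ln (real p) / (real p - 1)) * real q
        - real (Suc m div p - 1) * ln (real q + 1))
      \<le> (\<Sum>p\<in>extra_primes m. ln (real p ^ (multiplicity p (fact q :: nat) * (Suc m div p - 1))))"
  proof (rule sum_mono)
    fix p assume "p \<in> extra_primes m"
    then have p: "prime p" by (simp add: extra_primes_def)
    then have p2: "p \<ge> 2" by (rule prime_ge_2_nat)
    have "ln (real p) * (real q / (real p - 1) - ln (real q + 1) / ln (real p))
        \<le> ln (real p) * real (multiplicity p (fact q :: nat))"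
      using p2 by (intro mult_left_mono multiplicity_fact_ge p) auto
    then have "real q * ln (real p) / (real p - 1) - ln (real q + 1)
        \<le> ln (real p) * real (multiplicity p (fact q :: nat))"
      using p2 by (simp add: right_diff_distrib mult.commute)
    from mult_left_mono[OF this, of "real (Suc m div p - 1)"]
    show "real (Suc m div p - 1) * (ln (real p) / (real p - 1)) * real q
        - real (Suc m div p - 1) * ln (real q + 1)
        \<le> ln (real p ^ (multiplicity p (fact q :: nat) * (Suc m div p - 1)))"
      using p2 by (simp add: ln_realpow right_diff_distrib mult_ac)
  qed
  then show ?thesis
    unfolding eq gain_rate_def gain_loss_def sum_subtractf sum_distrib_right by linarith
qed

lemma affine_ln_over_id_antimono:
  fixes b E x y :: real
  assumes "b \<ge> 0" "E \<ge> 0" "exp 1 \<le> x" "x \<le> y"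
  shows "(b * ln y + E) / y \<le> (b * ln x + E) / x"
proof -
  have x: "x > 0" using assms(3) exp_gt_zero order.strict_trans2 by blast
  have lx: "ln x \<ge> 1" using assms(3) x by (simp add: ln_ge_iff)
  have "ln (y / x) \<le> y / x - 1" using x assms by (intro ln_le_minus_one) auto
  then have "ln y \<le> ln x + (y / x - 1)" using x assms by (simp add: ln_divide_pos)
  also have "(y / x - 1) \<le> (y / x - 1) * ln x"
    using lx x assms by (intro mult_le_cancel_left1[THEN iffD2]) (auto simp: field_simps)
  finally have l: "ln y \<le> y / x * ln x" by (simp add: algebra_simps)
  have "b * ln y \<le> b * (y / x * ln x)" using l assms by (intro mult_left_mono) auto
  moreover have "E \<le> E * (y / x)" using x assms by (intro mult_le_cancel_left1[THEN iffD2]) auto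
  moreover have "(b * ln x + E) / x * y = b * (y / x * ln x) + E * (y / x)"
    by (simp add: add_divide_distrib distrib_right)
  ultimately have "b * ln y + E \<le> (b * ln x + E) / x * y"
    by linarith
  then show ?thesis using x assms by (simp add: divide_simps)
qed

text \<open>The degree parameter is \<open>l = q + 1 = \<lceil>x\<rceil>\<close>, where \<open>x (ln x - c1) = ln H\<close>. All error terms are monotone in \<open>x\<close>,
  so it suffices to control them at a lower bound \<open>exp u1\<close> of \<open>x\<close>.\<close>

theorem omega_le_of_numeric:
  fixes m :: nat and H mu B S u1 eps c1 g C :: real
  defines "K \<equiv> gain_rate m" and "N \<equiv> gain_loss m"
  assumes m: "m \<ge> 1" and H: "H > 0"
    and M: "\<And>x. 0 \<le> x \<Longrightarrow> x \<le> real m \<Longrightarrow> \<bar>poly (node_poly m) x\<bar> \<le> exp mu"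
    and B: "\<And>x k. k \<le> m \<Longrightarrow> 0 \<le> x \<Longrightarrow> x \<le> real m \<Longrightarrow> \<bar>poly (omit_poly m k) x\<bar> \<le> B"
    and S: "(\<Sum>j=1..m. exp (real j) - 1) * B \<le> S" "S > 0"
    and K: "K \<le> (real m + 1) * ln (real m + 1)"
    and u1: "u1 \<ge> 1"
    and E: "ln (2 * S) - 11/12 - mu + K \<ge> 0"
    and eps: "((N + 1/2) * u1 + (ln (2 * S) - 11/12 - mu + K)) / exp u1 \<le> eps"
    and c1: "c1 = 1 + mu - K + eps"
    and g: "(real m + 1) * ln (real m + 1) - real m - K + real m * c1
      + ((real m + N) * u1 + ((real m + N) / exp u1 + ln 2 + real m + 1/12
          + (real m + 1/2) * ln (real m + 1))) / exp u1 \<le> g" "g > 0"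
    and pos: "u1 > c1" and start: "exp u1 * (u1 - c1) \<le> ln H"
    and main: "g * (u1 + ln (u1 - c1)) < C * (u1 - c1)"
    and slope: "1 \<le> c1 + ln (u1 - c1)"
  shows "omega m H \<le> real m + C / ln (ln H)"
proof -
  define t where "t = ln H"
  define x1 where "x1 = exp u1"
  define Ec where "Ec = ln (2 * S) - 11/12 - mu + K"
  have x1: "exp 1 \<le> x1" "x1 > 0" using u1 by (auto simp: x1_def)
  have N0: "N \<ge> 0" unfolding N_def by (rule gain_loss_nonneg)
  have "t > 0" using start pos by (metis exp_gt_zero mult_pos_pos order.strict_trans2 diff_gt_0_iff_gt t_def)
  obtain x where x: "x1 \<le> x" "x * (ln x - c1) = t"
  proof -
    define X where "X = max (max x1 (exp (c1 + 1))) t"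
    have X: "X \<ge> x1" "X \<ge> exp (c1 + 1)" "X \<ge> t" by (auto simp: X_def)
    have "X > 0" using X x1 by linarith
    then have "c1 + 1 \<le> ln X" using X(2) by (simp add: ln_ge_iff)
    then have "ln X - c1 \<ge> 1" by linarith
    then have "X * 1 \<le> X * (ln X - c1)" using \<open>X > 0\<close> by (intro mult_left_mono) auto
    then have "t \<le> X * (ln X - c1)" using X by linarith
    moreover have "x1 * (ln x1 - c1) \<le> t" using start by (simp add: x1_def t_def)
    moreover have "continuous_on {x1..X} (\<lambda>x. x * (ln x - c1))"
      using x1 by (intro continuous_intros) auto
    ultimately have "\<exists>x\<ge>x1. x \<le> X \<and> x * (ln x - c1) = t"
      using X by (intro IVT') auto
    then show ?thesis using that by blast
  qed
  have x0: "x > 0" using x x1 by linarith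
  define u where "u = ln x"
  have u: "u \<ge> u1" using x(1) x0 by (simp add: u_def x1_def ln_ge_iff)
  have t: "t = x * (u - c1)" using x by (simp add: u_def)
  have x3: "x \<ge> 1" using u u1 x0 by (simp add: u_def ln_ge_iff) (smt (verit) exp_ge_add_one_self)
  define l where "l = nat \<lceil>x\<rceil>"
  have l: "x \<le> real l" "real l \<le> x + 1" using x0 unfolding l_def by linarith+
  have l1: "l \<ge> 1" using l x3 by linarith
  have lx1: "real l \<ge> x1" using l x by linarith
  define q where "q = l - 1"
  have q: "real q + 1 = real l" "l = Suc q" using l1 by (auto simp: q_def)
  define v where "v = ln (real l)"
  have v: "v \<ge> u" using l x0 by (simp add: v_def u_def)
  have "fact l = real l * fact q" using q(2) by simp
  then have lnq: "ln (fact q) = ln (fact l) - v"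
    using l1 by (simp add: ln_mult_pos v_def)
  have fq: "(real l - 1/2) * v - real l + 11/12 \<le> ln (fact q)"
    using ln_fact_lower[OF l1] lnq by (simp add: v_def algebra_simps)
  define D where "D = ln (real (common_factor m q))"
  have D: "ln (fact q) + K * (real l - 1) - N * v \<le> D"
    using ln_common_factor_ge[of q m] unfolding D_def K_def N_def q(1) v_def by (simp flip: q(1))
  have expD: "exp D = real (common_factor m q)" unfolding D_def using common_factor_pos by simp

  have "((N + 1/2) * v + Ec) / real l \<le> ((N + 1/2) * ln x1 + Ec) / x1"
    unfolding v_def using N0 E x1 lx1 by (intro affine_ln_over_id_antimono) (auto simp: Ec_def)
  also have "\<dots> \<le> eps" using eps by (simp add: x1_def Ec_def)
  finally have epsl: "(N + 1/2) * v + Ec \<le> real l * eps"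
    using l1 by (simp add: divide_simps mult.commute)
  \<comment> \<open>The chain establishes \<open>small\<close> in logarithmic form:
    \<open>ln H + ln 2 + ln S + q * mu\<close> is at most \<open>D\<close>. In \<open>c1\<close> the
    part \<open>1 + mu - K\<close> is the main term, and \<open>eps\<close> pays for everything
    logarithmic in \<open>l\<close>.\<close>
  have "t \<le> real l * (v - c1)"
    unfolding t using l x0 v u pos by (intro mult_mono) auto
  also have "\<dots> = real l * (v - 1 - mu + K) - real l * eps" by (simp add: c1 algebra_simps)
  also have "\<dots> \<le> real l * (v - 1 - mu + K) - (N + 1/2) * v - Ec" using epsl by linarith
  also have "\<dots> \<le> D - ln 2 - ln S - real q * mu"
  proof -
    have "ln (2 * S) = ln 2 + ln S" using S by (simp add: ln_mult_pos)
    moreover have "real q * mu = (real l - 1) * mu" unfolding q(1)[symmetric] by simp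
    ultimately show ?thesis using fq D unfolding Ec_def by (simp add: algebra_simps)
  qed
  finally have "exp t \<le> exp (D - ln 2 - ln S - real q * mu)" by simp
  also have "\<dots> = exp D / 2 / S / exp mu ^ q"
    using S by (simp add: exp_diff exp_of_nat_mult)
  finally have "H \<le> real (common_factor m q) / 2 / S / exp mu ^ q"
    using H by (simp add: t_def expD)
  then have HS: "H * (S * exp mu ^ q) \<le> real (common_factor m q) / 2"
    using S by (simp add: field_simps)
  have small: "H * ((\<Sum>j=1..m. exp (real j) - 1) * (exp mu ^ q * B)) \<le> real (common_factor m q) / 2"
  proof -
    have "(\<Sum>j=1..m. exp (real j) - 1) * (exp mu ^ q * B) = ((\<Sum>j=1..m. exp (real j) - 1) * B) * exp mu ^ q"
      by simp
    also have "\<dots> \<le> S * exp mu ^ q" using S by (intro mult_right_mono) auto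
    finally show ?thesis using HS H by (meson mult_left_mono order.trans less_imp_le)
  qed

  \<comment> \<open>\<open>L\<close> is the degree of the approximants. Since
    \<open>Suc L = Suc m * l\<close>, Stirling's formula is applied to \<open>Suc L\<close> and the
    last factor removed again.\<close>
  define L where "L = Suc m * q + m"
  have L: "real (Suc L) = (real m + 1) * real l" "Suc L = Suc m * l"
    by (simp_all add: L_def algebra_simps q(2))
  define w where "w = ln (real m + 1)"
  have w0: "w \<ge> 0" by (simp add: w_def)
  have lnSL: "ln (real (Suc L)) = w + v"
    unfolding L(1) w_def v_def using l1 by (intro ln_mult_pos) auto
  have "ln (fact L) = ln (fact (Suc L)) - (w + v)"
    unfolding lnSL[symmetric] by (simp add: ln_mult_pos del: of_nat_Suc)
  moreover have "ln (fact (Suc L)) \<le> ((real m + 1) * real l + 1/2) * (w + v) - (real m + 1) * real l + 1"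
    using ln_fact_upper[of "Suc L", unfolded lnSL, unfolded L(1)] by simp
  ultimately have fL: "ln (fact L) \<le> ((real m + 1) * real l - 1/2) * (w + v) - (real m + 1) * real l + 1"
    by (simp only: algebra_simps)
  \<comment> \<open>\<open>exp (- a)\<close> is the lower bound of
    \<open>linear_form_lower_bound\<close>; the goal is
    \<open>a \<le> m * t + x * g\<close>.\<close>
  define a where "a = ln 2 + real m + ln (fact L) - D"
  have "a \<le> ln 2 + real m + 1/12 - w / 2 + K
      + (real m * (real l * v) + real l * ((real m + 1) * w - real m - K)) + N * v"
    unfolding a_def using fL fq D by (simp add: algebra_simps add_divide_distrib)
  \<comment> \<open>The integer \<open>l\<close> is now eliminated by \<open>l \<le> x + 1\<close>
    and \<open>v \<le> u + 1 / x\<close>. The hypothesis on \<open>K\<close> keeps the bracket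
    multiplied by \<open>l\<close> nonnegative.\<close>
  also have "\<dots> \<le> ln 2 + real m + 1/12 - w / 2 + K
      + (x + 1) * (real m * (u + 1 / x) + ((real m + 1) * w - real m - K)) + N * (u + 1 / x)"
  proof -
    have vle: "v \<le> u + 1 / x"
    proof -
      have "v \<le> ln (x + 1)" using l l1 by (simp add: v_def)
      also have "\<dots> = u + ln (1 + 1 / x)"
        using x0 unfolding u_def by (subst ln_mult_pos[symmetric]) (auto simp: algebra_simps add_pos_pos)
      also have "ln (1 + 1 / x) \<le> 1 / x" using x0 by (intro ln_add_one_self_le_self) auto
      finally show ?thesis by simp
    qed
    have "real m * 1 \<le> real m * v" using u u1 v by (intro mult_left_mono) auto
    moreover have "K \<le> (real m + 1) * w" using K by (simp add: w_def)
    ultimately have nn: "0 \<le> real m * v + ((real m + 1) * w - real m - K)" by linarith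
    have "real l * (real m * v + ((real m + 1) * w - real m - K))
        \<le> (x + 1) * (real m * (u + 1 / x) + ((real m + 1) * w - real m - K))"
      using l nn vle x0 by (intro mult_mono add_mono mult_left_mono) auto
    moreover have "N * v \<le> N * (u + 1 / x)" using N0 vle by (intro mult_left_mono)
    ultimately show ?thesis by (simp add: algebra_simps)
  qed
  also have "\<dots> = real m * (x * u) + x * ((real m + 1) * w - real m - K) + (real m + N) * u + (real m + N) / x
      + (ln 2 + real m + 1/12 + (real m + 1/2) * w)"
    using x0 by (simp add: field_simps)
  also have "\<dots> = real m * t + x * (((real m + 1) * w - real m - K + real m * c1)
      + ((real m + N) * u + ((real m + N) / x + (ln 2 + real m + 1/12 + (real m + 1/2) * w))) / x)"
    using x0 by (simp add: t field_simps)
  also have "\<dots> \<le> real m * t + x * g"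
  proof -
    let ?E2 = "ln 2 + real m + 1/12 + (real m + 1/2) * w"
    have "((real m + N) * u + ((real m + N) / x + ?E2)) / x \<le> ((real m + N) * u + ((real m + N) / x1 + ?E2)) / x"
      using x x0 x1 N0 by (intro divide_right_mono add_left_mono add_right_mono divide_left_mono) auto
    also have "\<dots> \<le> ((real m + N) * ln x1 + ((real m + N) / x1 + ?E2)) / x1"
      unfolding u_def using N0 x1 x w0 by (intro affine_ln_over_id_antimono) auto
    finally have "(real m + 1) * w - real m - K + real m * c1
        + ((real m + N) * u + ((real m + N) / x + ?E2)) / x \<le> g"
      using g(1) by (simp add: x1_def w_def algebra_simps)
    then show ?thesis using x0 by (intro add_left_mono mult_left_mono) auto
  qed
  finally have a_le: "a \<le> real m * t + x * g" .

  \<comment> \<open>It remains to carry \<open>main\<close> from \<open>u1\<close> to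
    \<open>u\<close>. The tangent of \<open>ln\<close> at \<open>v1\<close> bounds the left side by
    a linear function of slope \<open>g * (1 + 1 / v1)\<close>, and \<open>slope\<close> together
    with \<open>main\<close> shows that this is at most \<open>C\<close>.\<close>
  define v1 where "v1 = u1 - c1"
  have v1: "v1 > 0" using pos by (simp add: v1_def)
  have lnv: "ln (u - c1) \<le> ln v1 + (u - u1) / v1"
  proof -
    have "ln ((u - c1) / v1) \<le> (u - c1) / v1 - 1" using v1 u by (intro ln_le_minus_one) (auto simp: v1_def)
    moreover have "ln ((u - c1) / v1) = ln (u - c1) - ln v1"
      using v1 u by (intro ln_divide_pos) (auto simp: v1_def)
    moreover have "(u - c1) / v1 - 1 = (u - u1) / v1"
    proof -
      have "u - c1 = v1 + (u - u1)" by (simp add: v1_def)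
      then have "(u - c1) / v1 = v1 / v1 + (u - u1) / v1" by (simp only: add_divide_distrib)
      then show ?thesis using v1 by simp
    qed
    ultimately show ?thesis by linarith
  qed
  have gC: "g * (1 + 1 / v1) \<le> C"
  proof -
    have "g * (v1 + 1) \<le> g * (u1 + ln v1)"
      using slope g by (intro mult_left_mono) (auto simp: v1_def)
    also have "\<dots> < C * v1" using main by (simp add: v1_def)
    finally show ?thesis using v1 by (simp add: field_simps)
  qed
  have "g * (u + ln (u - c1)) \<le> g * (u1 + ln v1) + g * (1 + 1 / v1) * (u - u1)"
    using mult_left_mono[OF lnv, of g] g by (simp add: algebra_simps)
  also have "\<dots> \<le> g * (u1 + ln v1) + C * (u - u1)"
    using gC u by (intro add_left_mono mult_right_mono) auto
  also have "\<dots> < C * (u - c1)" using main by (simp add: v1_def algebra_simps)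
  finally have key: "g * (u + ln (u - c1)) < C * (u - c1)" .
  have lnt: "ln t = u + ln (u - c1)"
    unfolding t u_def using x0 u pos by (intro ln_mult_pos) (auto simp: u_def)
  have lntpos: "ln t > 0"
  proof -
    have "ln v1 \<le> ln (u - c1)" using v1 u by (simp add: v1_def)
    then have "1 + v1 \<le> ln t" using lnt slope u by (simp add: v1_def)
    then show ?thesis using v1 by simp
  qed
  have xg: "x * g < C * t / ln t"
  proof -
    have "x * (g * ln t) < x * (C * (u - c1))" using key x0 unfolding lnt by simp
    then show ?thesis using lntpos by (simp add: t field_simps)
  qed
  have C0: "C > 0"
  proof -
    have "0 < g * (1 + 1 / v1)" using g v1 by (simp add: add_pos_pos)
    then show ?thesis using gC by linarith
  qed
  define r where "r = real m + C / ln t"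
  have r0: "r > 0" using m C0 lntpos by (simp add: r_def add_pos_pos)
  have ar: "a < r * t" using a_le xg by (simp add: r_def algebra_simps)
  have "H powr (- r) < \<bar>\<Sum>i=0..m. real_of_int (lam i) * exp 1 ^ i\<bar>"
    if lam: "\<exists>i\<in>{0..m}. lam i \<noteq> 0" "\<forall>i\<in>{1..m}. \<bar>real_of_int (lam i)\<bar> \<le> H" for lam
  proof -
    have "H powr (- r) = exp (- (r * t))" using H by (simp add: powr_def t_def)
    also have "\<dots> < exp (- a)" using ar by simp
    also have "\<dots> = real (common_factor m q) / (2 * (exp (real m) * fact L))"
      unfolding a_def by (simp add: exp_diff exp_add expD)
    also have "\<dots> \<le> \<bar>\<Sum>i=0..m. real_of_int (lam i) * exp 1 ^ i\<bar>"
      unfolding L_def by (rule linear_form_lower_bound[OF _ _ M B small]) (use lam in auto)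
    finally show ?thesis .
  qed
  then have "omega m H \<le> r"
    unfolding omega_def using r0 by (intro cInf_lower) (auto intro!: bdd_belowI[of _ 0])
  then show ?thesis by (simp add: r_def t_def)
qed

section \<open>Maxima of the node polynomials\<close>

lemma poly_node_poly_0_to_1:
  assumes "0 \<le> x" "x \<le> 1" "m \<ge> 1"
  shows "\<bar>poly (node_poly m) x\<bar> \<le> fact m / (exp 1 * harm m)"
proof -
  have h: "(harm m :: real) > 0" using assms by (intro harm_pos) auto
  then have h0: "(harm m :: real) \<noteq> 0" by (metis less_irrefl)
  have "\<bar>poly (node_poly m) x\<bar> = (\<Prod>i\<le>m. \<bar>x - real i\<bar>)"
    by (simp add: poly_node_poly abs_prod)
  also have "{..m} = insert 0 {1..m}" by auto
  also have "(\<Prod>i\<in>insert 0 {1..m}. \<bar>x - real i\<bar>) = x * (\<Prod>i=1..m. \<bar>x - real i\<bar>)"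
    using assms by (subst prod.insert) auto
  \<comment> \<open>Applying \<open>1 - z \<le> exp (- z)\<close> to each \<open>1 - x / i\<close>
    produces the harmonic number in the exponent; then \<open>z * exp (- z)\<close> with
    \<open>z = x * harm m\<close> is at most \<open>exp (- 1)\<close>.\<close>
  also have "(\<Prod>i=1..m. \<bar>x - real i\<bar>) \<le> (\<Prod>i=1..m. real i * exp (- x * inverse (real i)))"
  proof (rule prod_mono, intro conjI)
    fix i assume i: "i \<in> {1..m}"
    have "1 + (- x * inverse (real i)) \<le> exp (- x * inverse (real i))"
      by (rule exp_ge_add_one_self)
    from mult_left_mono[OF this, of "real i"] i assms
    show "\<bar>x - real i\<bar> \<le> real i * exp (- x * inverse (real i))"
      by (simp add: field_simps)
  qed simp
  also have "\<dots> = fact m * exp (- x * harm m)"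
    by (simp only: prod.distrib exp_sum[symmetric] finite_atLeastAtMost sum_distrib_left[symmetric])
       (simp add: fact_prod harm_def)
  finally have "\<bar>poly (node_poly m) x\<bar> \<le> x * (fact m * exp (- x * harm m))"
    using assms by (simp add: mult_left_mono)
  also have "\<dots> = fact m / harm m * ((x * harm m) * exp (- (x * harm m)))"
    using h0 by simp
  also have "\<dots> \<le> fact m / harm m * exp (- 1)"
  proof (rule mult_left_mono)
    have "x * harm m \<le> exp (x * harm m - 1)"
      using exp_ge_add_one_self[of "x * harm m - 1"] by simp
    then have "x * harm m * exp (- (x * harm m)) \<le> exp (x * harm m - 1) * exp (- (x * harm m))"
      by (intro mult_right_mono) auto
    then show "x * harm m * exp (- (x * harm m)) \<le> exp (- 1)"
      by (simp flip: exp_add)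
  qed (auto intro: divide_nonneg_nonneg harm_nonneg)
  finally show ?thesis by (simp add: exp_minus field_simps)
qed

lemma node_poly_shift: "poly (node_poly m) (x - 1) * x = poly (node_poly m) x * (x - real m - 1)"
proof -
  have "poly (node_poly m) (x - 1) = (\<Prod>i=0..m. x - real (Suc i))"
    unfolding poly_node_poly atMost_atLeast0 by (rule prod.cong) auto
  also have "\<dots> * x = (\<Prod>i=0..Suc m. x - real i)"
    by (subst prod.atLeast0_atMost_Suc_shift) (simp add: mult.commute)
  also have "\<dots> = poly (node_poly m) x * (x - real m - 1)"
    by (simp add: poly_node_poly atMost_atLeast0 algebra_simps)
  finally show ?thesis .
qed

lemma node_poly_reflect: "\<bar>poly (node_poly m) (real m - x)\<bar> = \<bar>poly (node_poly m) x\<bar>"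
proof -
  have "\<bar>poly (node_poly m) (real m - x)\<bar> = (\<Prod>i\<le>m. \<bar>real m - x - real i\<bar>)"
    by (simp add: poly_node_poly abs_prod)
  also have "\<dots> = (\<Prod>i\<le>m. \<bar>x - real i\<bar>)"
    by (rule prod.reindex_bij_witness[of _ "\<lambda>i. m - i" "\<lambda>i. m - i"]) (auto simp: of_nat_diff)
  finally show ?thesis by (simp add: poly_node_poly abs_prod)
qed

text \<open>The largest values occur in the two outermost unit intervals. Reflection about
  \<open>m / 2\<close> reduces to the left half, and unit shifts lead from there into the interval
  from \<open>0\<close> to \<open>1\<close>.\<close>

lemma node_poly_bound:
  assumes "m \<ge> 1" "0 \<le> x" "x \<le> real m"
  shows "\<bar>poly (node_poly m) x\<bar> \<le> fact m / (exp 1 * harm m)"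
proof -
  \<comment> \<open>\<open>n\<close> limits the number of unit shifts and carries the
    induction.\<close>
  have left: "\<bar>poly (node_poly m) x\<bar> \<le> fact m / (exp 1 * harm m)"
    if "0 \<le> x" "x \<le> real n" "x \<le> (real m + 1) / 2" for n x
    using that
  proof (induction n arbitrary: x)
    case 0
    then show ?case using poly_node_poly_0_to_1[of x m] assms(1) by simp
  next
    case (Suc n)
    show ?case
    proof (cases "x \<le> 1")
      case True
      then show ?thesis using poly_node_poly_0_to_1 Suc assms by simp
    next
      case False
      \<comment> \<open>The shift identity compares \<open>x\<close> with \<open>x - 1\<close>, where the product is larger on the left half.\<close>
      have "\<bar>poly (node_poly m) x\<bar> * (real m + 1 - x) = \<bar>poly (node_poly m) (x - 1)\<bar> * x"
      proof -
        have "\<bar>poly (node_poly m) x * (x - real m - 1)\<bar> = \<bar>poly (node_poly m) (x - 1) * x\<bar>"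
          using node_poly_shift[of m x] by simp
        moreover have "\<bar>x - real m - 1\<bar> = real m + 1 - x" "\<bar>x\<bar> = x"
          using False Suc.prems by auto
        ultimately show ?thesis by (simp only: abs_mult)
      qed
      also have "\<dots> \<le> \<bar>poly (node_poly m) (x - 1)\<bar> * (real m + 1 - x)"
        using Suc.prems by (intro mult_left_mono) auto
      finally have "\<bar>poly (node_poly m) x\<bar> \<le> \<bar>poly (node_poly m) (x - 1)\<bar>"
        using False Suc.prems by simp
      also have "\<dots> \<le> fact m / (exp 1 * harm m)"
        using False Suc.prems by (intro Suc.IH) auto
      finally show ?thesis .
    qed
  qed
  show ?thesis
  proof (cases "x \<le> real m / 2")
    case True
    then show ?thesis using left[of x m] assms by simp
  next
    case False
    then have "\<bar>poly (node_poly m) (real m - x)\<bar> \<le> fact m / (exp 1 * harm m)"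
      using left[of "real m - x" m] assms by simp
    then show ?thesis by (simp add: node_poly_reflect)
  qed
qed

lemma omit_poly_bound:
  assumes "k \<le> m" "0 \<le> x" "x \<le> real m"
  shows "\<bar>poly (omit_poly m k) x\<bar> \<le> real m ^ m"
proof -
  have "\<bar>poly (omit_poly m k) x\<bar> = (\<Prod>i\<in>{..m} - {k}. \<bar>x - real i\<bar>)"
    by (simp add: poly_omit_poly abs_prod)
  also have "\<dots> \<le> (\<Prod>i\<in>{..m} - {k}. real m)"
    using assms by (intro prod_mono) auto
  also have "\<dots> = real m ^ m" using assms by simp
  finally show ?thesis .
qed

text \<open>Crude: at most \<open>(m - 1) / 2\<close> primes, each contributing at most
  \<open>(m - 1) / 2\<close>. The result is later divided by at least \<open>m ^ 8\<close>.\<close>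

lemma gain_loss_le: "gain_loss m \<le> (real m - 1)\<^sup>2 / 4" if "m \<ge> 1"
proof -
  define n where "n = (m + 1) div 2"
  have sub: "extra_primes m \<subseteq> {2..n}"
  proof
    fix p assume "p \<in> extra_primes m"
    then have "prime p" "2 * p \<le> m + 1" by (auto simp: extra_primes_def)
    then show "p \<in> {2..n}" using prime_ge_2_nat by (auto simp: n_def)
  qed
  have n: "real n \<le> (real m + 1) / 2" 
  proof -
    have "2 * n \<le> m + 1" by (simp add: n_def)
    then have "real (2 * n) \<le> real (m + 1)" by (simp only: of_nat_le_iff)
    then show ?thesis by simp
  qed
  have "gain_loss m \<le> (\<Sum>p\<in>extra_primes m. (real m - 1) / 2)"
    unfolding gain_loss_def
  proof (rule sum_mono)
    fix p assume "p \<in> extra_primes m"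
    then have "2 \<le> p" using sub by auto
    then have "Suc m div p \<le> Suc m div 2" by (intro div_le_mono2) auto
    then have "Suc m div p - 1 \<le> Suc m div 2 - 1" by (rule diff_le_mono)
    moreover have "2 * (Suc m div 2 - 1) \<le> m - 1" using that by simp
    ultimately have "2 * (Suc m div p - 1) \<le> m - 1" by linarith
    then have "real (2 * (Suc m div p - 1)) \<le> real (m - 1)" by (simp only: of_nat_le_iff)
    then show "real (Suc m div p - 1) \<le> (real m - 1) / 2" using that by (simp add: of_nat_diff)
  qed
  also have "\<dots> = real (card (extra_primes m)) * ((real m - 1) / 2)" by simp
  also have "\<dots> \<le> ((real m - 1) / 2) * ((real m - 1) / 2)"
  proof (rule mult_right_mono)
    have "card (extra_primes m) \<le> card {2..n}" using sub by (intro card_mono) auto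
    then show "real (card (extra_primes m)) \<le> (real m - 1) / 2" using n that by simp
  qed (use that in simp)
  finally show ?thesis by (simp add: power2_eq_square)
qed

lemma ln_le_scaled: "x > 0 \<Longrightarrow> ln x \<le> x / exp 1" for x :: real
  using ln_le_minus_one[of "x / exp 1"] by (simp add: ln_divide_pos)

lemma ln_squared_le: "x \<ge> 1 \<Longrightarrow> (ln x)\<^sup>2 \<le> x" for x :: real
proof -
  assume x: "x \<ge> 1"
  have "ln (sqrt x) \<le> sqrt x / exp 1" using x by (intro ln_le_scaled) auto
  also have "\<dots> \<le> sqrt x / 2"
    using exp_ge_add_one_self[of 1] x by (intro divide_left_mono) auto
  finally have "ln x \<le> sqrt x" using x by (simp add: ln_sqrt)
  then have "(ln x)\<^sup>2 \<le> (sqrt x)\<^sup>2" using x by (intro power_mono) auto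
  then show ?thesis using x by simp
qed

lemma ln_5_ge: "ln (5::real) \<ge> 8/5"
proof -
  have "ln (5::real) = ln 4 + ln (5/4)" by (simp flip: ln_mult_pos)
  also have "ln (4::real) = 2 * ln 2" using ln_realpow[of 2 2] by simp
  finally show ?thesis using ln2_ge_two_thirds ln_ratio_bounds(1)[of "5/4::real"] ln_approx_bounds[of "2::real" 2]
    by (simp add: eval_nat_numeral)
qed

text \<open>\<open>omega_le_of_numeric\<close> at \<open>u1 = s\<close>. Since \<open>exp s\<close>
  is at least \<open>m ^ 8\<close>, whatever is divided by \<open>exp u1\<close> disappears in the
  constants \<open>1/1000\<close> and \<open>1/250\<close>. The parameter \<open>h\<close> stays
  free below \<open>ln (harm m)\<close> so that each range of \<open>m\<close> can use a value
  convenient for it.\<close>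

theorem omega_le_of_log_inequality:
  fixes m :: nat and H h C :: real
  defines "K \<equiv> gain_rate m" and "L \<equiv> ln (real m)" and "s \<equiv> real m * (ln (real m))\<^sup>2"
  defines "c1 \<equiv> (real m + 1/2) * L - real m + 1 - h - K + 1/1000"
  defines "g \<equiv> (real m + 1) * (L + 1 / real m) - real m - K + real m * c1 + 1/250"
  assumes m: "m \<ge> 5" and H: "H > 0" "s * exp s \<le> ln H"
    and h: "0 \<le> h" "h \<le> ln (harm m)"
    and K: "K \<le> real m"
    and c1: "1 \<le> c1" "c1 + 1 \<le> s"
    and main: "g * (s + ln s) < C * (s - c1)"
  shows "omega m H \<le> real m + C / ln (ln H)"
proof -
  define x where "x = real m"
  have x: "x \<ge> 5" using m by (simp add: x_def)
  \<comment> \<open>\<open>exp mu\<close> is Stirling's bound for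
    \<open>fact m / (exp 1 * harm m)\<close>, with \<open>h\<close> for \<open>ln (harm m)\<close>;
    \<open>S\<close> bounds \<open>m\<close> exponentials by \<open>exp m\<close> each, times the
    bound \<open>m ^ m\<close> for \<open>omit_poly\<close>.\<close>
  define mu where "mu = (x + 1/2) * L - x - h"
  define S where "S = x * exp x * x ^ m"
  define N where "N = gain_loss m"
  have hx: "harm m > (0::real)" using m by (intro harm_pos) auto
  have L: "L \<ge> 8/5"
  proof -
    have "ln 5 \<le> L" using m by (simp add: L_def)
    then show ?thesis using ln_5_ge by linarith
  qed
  have Lx: "L \<le> 2/5 * x"
  proof -
    have "L \<le> x / exp 1" unfolding L_def x_def using m by (intro ln_le_scaled) auto
    also have "\<dots> \<le> x / (5/2)"
    proof -
      have "exp (1::real) \<ge> 5/2" using exp_lower_Taylor_quadratic[of "1::real"] by simp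
      then show ?thesis using x by (intro divide_left_mono) auto
    qed
    finally show ?thesis by simp
  qed
  have sL: "s = x * L\<^sup>2" by (simp add: s_def L_def x_def)
  have s_le: "s \<le> x\<^sup>2"
    using ln_squared_le[of x] x unfolding sL L_def x_def[symmetric] by (simp add: power2_eq_square)
  have "8 * L \<le> x * L * L"
  proof -
    have "5 * (8/5) \<le> x * L" using x L by (intro mult_mono) auto
    then show ?thesis using L by (intro mult_right_mono) auto
  qed
  then have s8: "8 * L \<le> s" by (simp add: sL power2_eq_square mult.assoc)
  \<comment> \<open>The numerators of the error terms are of order \<open>x ^ 4\<close>, so
    \<open>exp s\<close> exceeds them by a factor of at least the order of
    \<open>5 ^ 4 = 625\<close>.\<close>
  have exps: "x ^ 8 \<le> exp s"
  proof -
    have "x ^ 8 = exp (8 * L)" using x exp_of_nat_mult[of 8 L] by (simp add: L_def x_def)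
    then show ?thesis using s8 by simp
  qed
  have N: "0 \<le> N" "N \<le> x\<^sup>2 / 4 - 1/2"
    using gain_loss_nonneg[of m] gain_loss_le[of m] m x
    by (auto simp: N_def x_def power2_eq_square algebra_simps)
  have lnS: "ln (2 * S) = ln 2 + L + x + x * L"
    using x by (simp add: S_def ln_mult_pos ln_realpow L_def x_def)
  have ln2: "(0::real) \<le> ln 2" "ln 2 \<le> (1::real)" using ln_2_less_1 by auto
  have hL: "h \<le> L"
  proof -
    have "harm m \<le> real m"
      unfolding harm_def by (rule order.trans[OF sum_mono[of _ _ "\<lambda>_. 1"]]) (auto simp: divide_simps)
    then have "ln (harm m) \<le> L" unfolding L_def using hx by simp
    then show ?thesis using h by simp
  qed
  have mu0: "mu \<ge> 0"
  proof -
    have "(x - 1/2) * (8/5) \<le> (x - 1/2) * L" using L x by (intro mult_left_mono) auto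
    then have "8/5 * x - 4/5 \<le> x * L - L / 2"
      by (simp add: left_diff_distrib)
    moreover have "mu = x * L + L / 2 - x - h"
      by (simp add: mu_def distrib_right)
    ultimately show ?thesis using hL x by linarith
  qed
  have K0: "K \<ge> 0" unfolding K_def by (rule gain_rate_nonneg)
  define Ec where "Ec = ln (2 * S) - 11/12 - mu + K"
  have x2: "5 * x \<le> x\<^sup>2" using x by (simp add: power2_eq_square)
  have "Ec = ln 2 + L / 2 + 2 * x + h + K - 11/12"
    unfolding Ec_def lnS mu_def by (simp add: distrib_right)
  then have Ec: "0 \<le> Ec" "Ec \<le> x\<^sup>2"
    using ln2 L h(1) hL K0 K x x2 Lx unfolding x_def[symmetric] by linarith+
  have x4: "25 * x\<^sup>2 \<le> x ^ 4"
    using mult_mono[OF x2 x2] x by (simp add: power2_eq_square power4_eq_xxxx)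
  have x8: "x ^ 8 = x ^ 4 * x ^ 4" by (simp flip: power_add)
  have x4': "x ^ 4 \<ge> 625" using power_mono[of 5 x 4] x by simp
  have x5: "x\<^sup>2 * 5 \<le> x ^ 3" using mult_left_mono[OF x, of "x\<^sup>2"] by (simp add: power2_eq_square power3_eq_cube)
  have x34: "x ^ 3 * 5 \<le> x ^ 4" using mult_left_mono[OF x, of "x ^ 3"] x by (simp add: power4_eq_xxxx power3_eq_cube)
  have x48: "625 * x ^ 4 \<le> x ^ 8" unfolding x8 using x4' by (intro mult_right_mono) auto
  show ?thesis
  proof (rule omega_le_of_numeric[where mu = mu and B = "x ^ m" and S = S and ?u1.0 = s and eps = "1/1000"
        and ?c1.0 = c1 and g = g])
    show "m \<ge> 1" using m by simp
    show "H > 0" by fact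
    show "\<bar>poly (node_poly m) y\<bar> \<le> exp mu" if "0 \<le> y" "y \<le> real m" for y
    proof -
      have "\<bar>poly (node_poly m) y\<bar> \<le> fact m / (exp 1 * harm m)"
        using m that by (intro node_poly_bound) auto
      also have "\<dots> = exp (ln (fact m) - 1 - ln (harm m))"
        using hx by (simp add: exp_diff)
      also have "\<dots> \<le> exp mu"
        using ln_fact_upper[of m] m h by (simp add: mu_def L_def x_def)
      finally show ?thesis .
    qed
    show "\<bar>poly (omit_poly m k) y\<bar> \<le> x ^ m" if "k \<le> m" "0 \<le> y" "y \<le> real m" for y k
      unfolding x_def by (rule omit_poly_bound) fact+
    show "S > 0" using x by (simp add: S_def)
    show "(\<Sum>j=1..m. exp (real j) - 1) * x ^ m \<le> S"
    proof -
      have "(\<Sum>j=1..m. exp (real j) - 1) \<le> (\<Sum>j=1..m. exp x)"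
      proof (rule sum_mono)
        fix j assume "j \<in> {1..m}"
        then have "exp (real j) \<le> exp x" by (simp add: x_def)
        then show "exp (real j) - 1 \<le> exp x" by linarith
      qed
      then show ?thesis unfolding S_def using x by (intro mult_right_mono) (auto simp: x_def)
    qed
    show "gain_rate m \<le> (real m + 1) * ln (real m + 1)"
    proof -
      have "L \<le> ln (real m + 1)" using m by (simp add: L_def)
      then have "(real m + 1) * 1 \<le> (real m + 1) * ln (real m + 1)"
        using L by (intro mult_left_mono) auto
      moreover have "gain_rate m \<le> (real m + 1) * 1" using K by (simp add: K_def)
      ultimately show ?thesis by (rule order.trans[rotated])
    qed
    show "1 \<le> s" using c1 by simp
    show "0 \<le> ln (2 * S) - 11 / 12 - mu + gain_rate m"
      using Ec by (simp add: Ec_def K_def)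
    have "(gain_loss m + 1/2) * s + Ec \<le> x ^ 4 / 4 + x\<^sup>2"
    proof -
      have "(N + 1/2) * s \<le> (x\<^sup>2 / 4) * x\<^sup>2" using N s_le c1 by (intro mult_mono) auto
      also have "\<dots> = x ^ 4 / 4" by (simp flip: power_add)
      finally show ?thesis using Ec by (simp add: N_def)
    qed
    also have "\<dots> \<le> x ^ 4 * (3/10)" using x4 zero_le_power2[of x] by linarith
    also have "\<dots> \<le> 1/1000 * x ^ 8" using x48 x4' by linarith
    also have "\<dots> \<le> 1/1000 * exp s" using exps by simp
    finally show "((gain_loss m + 1/2) * s + (ln (2 * S) - 11 / 12 - mu + gain_rate m)) / exp s \<le> 1/1000"
      unfolding Ec_def K_def by (simp add: divide_simps)
    show "c1 = 1 + mu - gain_rate m + 1/1000"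
      by (simp add: c1_def mu_def x_def K_def)
    have lnm1: "ln (real m + 1) \<le> L + 1 / real m"
    proof -
      have "ln (real m + 1) = L + ln (1 + 1 / real m)"
        unfolding L_def using m by (subst ln_mult_pos[symmetric]) (auto simp: field_simps add_pos_pos)
      also have "ln (1 + 1 / real m) \<le> 1 / real m" by (intro ln_add_one_self_le_self) auto
      finally show ?thesis by simp
    qed
    define E2 where "E2 = (x + N) / exp s + ln 2 + x + 1/12 + (x + 1/2) * ln (x + 1)"
    have E2: "E2 \<le> x ^ 3"
    proof -
      have "x + N \<le> x ^ 8"
      proof -
        have "x + N \<le> x ^ 4" using N x2 x4 x by linarith
        also have "\<dots> \<le> x ^ 8" using x by (intro power_increasing) auto
        finally show ?thesis .
      qed
      then have "(x + N) / exp s \<le> 1" using exps by (simp add: divide_simps)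
      moreover have "(x + 1/2) * ln (x + 1) \<le> (x + 1/2) * x"
        using ln_le_minus_one[of "x + 1"] x by (intro mult_left_mono) auto
      moreover have "(x + 1/2) * x = x\<^sup>2 + x / 2" by (simp add: power2_eq_square algebra_simps)
      ultimately show ?thesis using ln2 x2 x5 x unfolding E2_def by linarith
    qed
    have "(x + N) * s + E2 \<le> x ^ 4 * (13/20)"
    proof -
      have "(x + N) * s \<le> (x + x\<^sup>2 / 4) * x\<^sup>2" using N s_le c1 x by (intro mult_mono) auto
      also have "\<dots> = x ^ 3 + x ^ 4 / 4" by (simp add: power2_eq_square power3_eq_cube power4_eq_xxxx algebra_simps)
      finally show ?thesis using E2 x34 by linarith
    qed
    also have "\<dots> \<le> 1/250 * x ^ 8" using x48 x4' by linarith
    also have "\<dots> \<le> 1/250 * exp s" using exps by simp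
    finally have tail: "((x + N) * s + E2) / exp s \<le> 1/250" by (simp add: divide_simps)
    have "(x + 1) * ln (x + 1) \<le> (x + 1) * (L + 1 / x)"
      using lnm1 x by (intro mult_left_mono) (auto simp: x_def)
    then show "(real m + 1) * ln (real m + 1) - real m - gain_rate m + real m * c1
        + ((real m + gain_loss m) * s + ((real m + gain_loss m) / exp s + ln 2 + real m + 1/12
          + (real m + 1/2) * ln (real m + 1))) / exp s \<le> g"
      using tail unfolding g_def E2_def x_def N_def K_def by linarith
    show "g > 0"
    proof -
      define A where "A = x * c1"
      define A' where "A' = (x + 1) * (L + 1 / x)"
      have "x * 1 \<le> A" unfolding A_def using c1 x by (intro mult_left_mono) auto
      moreover have "(x + 1) * 1 \<le> A'"
        unfolding A'_def using L x by (intro mult_left_mono) (auto intro: add_increasing2)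
      moreover have "g = A' - x - K + A + 1/250" by (simp add: g_def A_def A'_def x_def)
      ultimately show ?thesis using K unfolding x_def mult_1_right by linarith
    qed
    show "s > c1" using c1 by simp
    show "exp s * (s - c1) \<le> ln H"
    proof -
      have "exp s * (s - c1) \<le> exp s * s" using c1 by (intro mult_left_mono) auto
      also have "\<dots> \<le> ln H" using H by (simp only: mult.commute)
      finally show ?thesis .
    qed
    show "g * (s + ln (s - c1)) < C * (s - c1)"
    proof -
      have "ln (s - c1) \<le> ln s" using c1 by simp
      then have "g * (s + ln (s - c1)) \<le> g * (s + ln s)"
        using \<open>g > 0\<close> by (intro mult_left_mono) auto
      then show ?thesis using main by linarith
    qed
    show "1 \<le> c1 + ln (s - c1)" using c1 by (simp add: add_increasing2)
  qed
qed

section \<open>Small degrees\<close>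

lemma ln_artanh_bounds:
  fixes x :: real
  assumes "x > 1"
  shows "(\<Sum>k<n. 2 * ((x-1)/(x+1)) ^ (2*k+1) / real (2*k+1)) \<le> ln x"
    and "ln x \<le> (\<Sum>k<n. 2 * ((x-1)/(x+1)) ^ (2*k+1) / real (2*k+1))
      + 2 * (((x-1)/(x+1)) ^ (2*n+1) / (1 - ((x-1)/(x+1))^2) / real (2*n+1))"
  using ln_approx_bounds[OF assms, of n] by auto

lemma ln_2_bounds: "0.693147180559945309 \<le> ln (2::real)" "ln (2::real) \<le> 0.693147180559945310"
  using ln_artanh_bounds[of 2 18] by (simp_all add: numeral_eq_Suc)

lemma ln_3_bounds: "1.098612288668109690 \<le> ln (3::real)" "ln (3::real) \<le> 1.098612288668109692"
proof -
  have "ln (3::real) = ln 2 + ln (3/2)"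
    using ln_divide_pos[of 3 2] by simp
  then show "1.098612288668109690 \<le> ln (3::real)" "ln (3::real) \<le> 1.098612288668109692"
    using ln_artanh_bounds[of "3/2" 12] ln_2_bounds by (simp_all add: numeral_eq_Suc)
qed

lemma ln_5_bounds: "1.609437912434100373 \<le> ln (5::real)" "ln (5::real) \<le> 1.609437912434100376"
proof -
  have "ln (5::real) = 2 * ln 2 + ln (5/4)"
    using ln_mult_pos[of 2 2] ln_divide_pos[of 5 4] by simp
  then show "1.609437912434100373 \<le> ln (5::real)" "ln (5::real) \<le> 1.609437912434100376"
    using ln_artanh_bounds[of "5/4" 9] ln_2_bounds by (simp_all add: numeral_eq_Suc)
qed

text \<open>From here on \<open>2 * ln p = ln (p^2 - 1) + ln (p^2 / (p^2 - 1))\<close>: the first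
  number factors into smaller primes, and the artanh series for the second has argument
  \<open>1 / (2 * p^2 - 1)\<close>, so very few terms give 17 decimals.\<close>

lemma ln_7_bounds: "1.945910149055313303 \<le> ln (7::real)" "ln (7::real) \<le> 1.945910149055313307"
proof -
  have "2 * ln (7::real) = 4 * ln 2 + ln 3 + ln (49/48)"
    using ln_mult_pos[of 7 7] ln_mult_pos[of 2 24] ln_mult_pos[of 2 12] ln_mult_pos[of 2 6] ln_mult_pos[of 2 3] ln_divide_pos[of 49 48] by simp
  then show "1.945910149055313303 \<le> ln (7::real)" "ln (7::real) \<le> 1.945910149055313307"
    using ln_artanh_bounds[of "49/48" 5] ln_2_bounds ln_3_bounds by (simp_all add: numeral_eq_Suc)
qed

lemma ln_11_bounds: "2.397895272798370541 \<le> ln (11::real)" "ln (11::real) \<le> 2.397895272798370546"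
proof -
  have "2 * ln (11::real) = 3 * ln 2 + ln 3 + ln 5 + ln (121/120)"
    using ln_mult_pos[of 11 11] ln_mult_pos[of 2 60] ln_mult_pos[of 2 30] ln_mult_pos[of 2 15] ln_mult_pos[of 3 5] ln_divide_pos[of 121 120] by simp
  then show "2.397895272798370541 \<le> ln (11::real)" "ln (11::real) \<le> 2.397895272798370546"
    using ln_artanh_bounds[of "121/120" 4] ln_2_bounds ln_3_bounds ln_5_bounds by (simp_all add: numeral_eq_Suc)
qed

lemma ln_13_bounds: "2.564949357461536733 \<le> ln (13::real)" "ln (13::real) \<le> 2.564949357461536739"
proof -
  have "2 * ln (13::real) = 3 * ln 2 + ln 3 + ln 7 + ln (169/168)"
    using ln_mult_pos[of 13 13] ln_mult_pos[of 2 84] ln_mult_pos[of 2 42] ln_mult_pos[of 2 21] ln_mult_pos[of 3 7] ln_divide_pos[of 169 168] by simp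
  then show "2.564949357461536733 \<le> ln (13::real)" "ln (13::real) \<le> 2.564949357461536739"
    using ln_artanh_bounds[of "169/168" 4] ln_2_bounds ln_3_bounds ln_7_bounds by (simp_all add: numeral_eq_Suc)
qed

lemma ln_17_bounds: "2.833213344056216077 \<le> ln (17::real)" "ln (17::real) \<le> 2.833213344056216083"
proof -
  have "2 * ln (17::real) = 5 * ln 2 + 2 * ln 3 + ln (289/288)"
    using ln_mult_pos[of 17 17] ln_mult_pos[of 2 144] ln_mult_pos[of 2 72] ln_mult_pos[of 2 36] ln_mult_pos[of 2 18] ln_mult_pos[of 2 9] ln_mult_pos[of 3 3] ln_divide_pos[of 289 288] by simp
  then show "2.833213344056216077 \<le> ln (17::real)" "ln (17::real) \<le> 2.833213344056216083"
    using ln_artanh_bounds[of "289/288" 4] ln_2_bounds ln_3_bounds by (simp_all add: numeral_eq_Suc)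
qed

lemma ln_19_bounds: "2.944438979166440457 \<le> ln (19::real)" "ln (19::real) \<le> 2.944438979166440463"
proof -
  have "2 * ln (19::real) = 3 * ln 2 + 2 * ln 3 + ln 5 + ln (361/360)"
    using ln_mult_pos[of 19 19] ln_mult_pos[of 2 180] ln_mult_pos[of 2 90] ln_mult_pos[of 2 45] ln_mult_pos[of 3 15] ln_mult_pos[of 3 5] ln_divide_pos[of 361 360] by simp
  then show "2.944438979166440457 \<le> ln (19::real)" "ln (19::real) \<le> 2.944438979166440463"
    using ln_artanh_bounds[of "361/360" 4] ln_2_bounds ln_3_bounds ln_5_bounds by (simp_all add: numeral_eq_Suc)
qed

lemma ln_23_bounds: "3.135494215929149687 \<le> ln (23::real)" "ln (23::real) \<le> 3.135494215929149694"
proof -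
  have "2 * ln (23::real) = 4 * ln 2 + ln 3 + ln 11 + ln (529/528)"
    using ln_mult_pos[of 23 23] ln_mult_pos[of 2 264] ln_mult_pos[of 2 132] ln_mult_pos[of 2 66] ln_mult_pos[of 2 33] ln_mult_pos[of 3 11] ln_divide_pos[of 529 528] by simp
  then show "3.135494215929149687 \<le> ln (23::real)" "ln (23::real) \<le> 3.135494215929149694"
    using ln_artanh_bounds[of "529/528" 3] ln_2_bounds ln_3_bounds ln_11_bounds by (simp_all add: numeral_eq_Suc)
qed

lemma ln_29_bounds: "3.367295829986474024 \<le> ln (29::real)" "ln (29::real) \<le> 3.367295829986474031"
proof -
  have "2 * ln (29::real) = 3 * ln 2 + ln 3 + ln 5 + ln 7 + ln (841/840)"
    using ln_mult_pos[of 29 29] ln_mult_pos[of 2 420] ln_mult_pos[of 2 210] ln_mult_pos[of 2 105] ln_mult_pos[of 3 35] ln_mult_pos[of 5 7] ln_divide_pos[of 841 840] by simp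
  then show "3.367295829986474024 \<le> ln (29::real)" "ln (29::real) \<le> 3.367295829986474031"
    using ln_artanh_bounds[of "841/840" 3] ln_2_bounds ln_3_bounds ln_5_bounds ln_7_bounds by (simp_all add: numeral_eq_Suc)
qed

lemma ln_31_bounds: "3.433987204485146243 \<le> ln (31::real)" "ln (31::real) \<le> 3.433987204485146249"
proof -
  have "2 * ln (31::real) = 6 * ln 2 + ln 3 + ln 5 + ln (961/960)"
    using ln_mult_pos[of 31 31] ln_mult_pos[of 2 480] ln_mult_pos[of 2 240] ln_mult_pos[of 2 120] ln_mult_pos[of 2 60] ln_mult_pos[of 2 30] ln_mult_pos[of 2 15] ln_mult_pos[of 3 5] ln_divide_pos[of 961 960] by simp
  then show "3.433987204485146243 \<le> ln (31::real)" "ln (31::real) \<le> 3.433987204485146249"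
    using ln_artanh_bounds[of "961/960" 3] ln_2_bounds ln_3_bounds ln_5_bounds by (simp_all add: numeral_eq_Suc)
qed

lemma ln_37_bounds: "3.610917912644224440 \<le> ln (37::real)" "ln (37::real) \<le> 3.610917912644224448"
proof -
  have "2 * ln (37::real) = 3 * ln 2 + 2 * ln 3 + ln 19 + ln (1369/1368)"
    using ln_mult_pos[of 37 37] ln_mult_pos[of 2 684] ln_mult_pos[of 2 342] ln_mult_pos[of 2 171] ln_mult_pos[of 3 57] ln_mult_pos[of 3 19] ln_divide_pos[of 1369 1368] by simp
  then show "3.610917912644224440 \<le> ln (37::real)" "ln (37::real) \<le> 3.610917912644224448"
    using ln_artanh_bounds[of "1369/1368" 3] ln_2_bounds ln_3_bounds ln_19_bounds by (simp_all add: numeral_eq_Suc)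
qed

lemma ln_41_bounds: "3.713572066704307800 \<le> ln (41::real)" "ln (41::real) \<le> 3.713572066704307807"
proof -
  have "2 * ln (41::real) = 4 * ln 2 + ln 3 + ln 5 + ln 7 + ln (1681/1680)"
    using ln_mult_pos[of 41 41] ln_mult_pos[of 2 840] ln_mult_pos[of 2 420] ln_mult_pos[of 2 210] ln_mult_pos[of 2 105] ln_mult_pos[of 3 35] ln_mult_pos[of 5 7] ln_divide_pos[of 1681 1680] by simp
  then show "3.713572066704307800 \<le> ln (41::real)" "ln (41::real) \<le> 3.713572066704307807"
    using ln_artanh_bounds[of "1681/1680" 3] ln_2_bounds ln_3_bounds ln_5_bounds ln_7_bounds by (simp_all add: numeral_eq_Suc)
qed

lemma ln_two_term_bounds:
  fixes x :: real
  assumes "x > 1"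
  shows "2 * ((x - 1) / (x + 1)) + 2/3 * ((x - 1) / (x + 1)) ^ 3 \<le> ln x"
    and "ln x \<le> 2 * ((x - 1) / (x + 1)) + 2/3 * ((x - 1) / (x + 1)) ^ 3
      + 2/5 * ((x - 1) / (x + 1)) ^ 5 / (1 - ((x - 1) / (x + 1))\<^sup>2)"
proof -
  define z where "z = (x - 1) / (x + 1)"
  have "(\<Sum>k<2. 2 * z ^ (2 * k + 1) / real (2 * k + 1)) = 2 * z + 2/3 * z ^ 3"
    by (simp add: numeral_eq_Suc)
  then show "2 * ((x - 1) / (x + 1)) + 2/3 * ((x - 1) / (x + 1)) ^ 3 \<le> ln x"
    "ln x \<le> 2 * ((x - 1) / (x + 1)) + 2/3 * ((x - 1) / (x + 1)) ^ 3
      + 2/5 * ((x - 1) / (x + 1)) ^ 5 / (1 - ((x - 1) / (x + 1))\<^sup>2)"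
    using ln_artanh_bounds[OF assms, of 2] unfolding z_def[symmetric] by (simp_all add: mult.commute)
qed

section \<open>The gains for \<open>m \<le> 24\<close>, and \<open>kappa_m\<close> from
  above\<close>

lemma primes_le_12: "{p::nat. prime p \<and> p \<le> 12} = {2, 3, 5, 7, 11}"
proof
  show "{p::nat. prime p \<and> p \<le> 12} \<subseteq> {2, 3, 5, 7, 11}"
  proof
    fix p :: nat assume p: "p \<in> {p. prime p \<and> p \<le> 12}"
    have "p \<le> 12" using p by simp
    then have "p = 0 \<or> p = 1 \<or> p = 2 \<or> p = 3 \<or> p = 4 \<or> p = 5 \<or> p = 6 \<or> p = 7 \<or> p = 8 \<or> p = 9
        \<or> p = 10 \<or> p = 11 \<or> p = 12"
      by presburger
    then show "p \<in> {2, 3, 5, 7, 11}" using p by (elim disjE) simp_all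
  qed
qed simp_all

text \<open>Truncated subtraction makes the term of \<open>p\<close> zero as soon as
  \<open>Suc m div p < 2\<close>, so one fixed set of primes serves all these
  \<open>m\<close>.\<close>

lemma sum_extra_primes_small:
  fixes f :: "nat \<Rightarrow> real"
  assumes "m \<le> 24"
  shows "(\<Sum>p\<in>extra_primes m. real (Suc m div p - 1) * f p)
    = real (Suc m div 2 - 1) * f 2 + real (Suc m div 3 - 1) * f 3 + real (Suc m div 5 - 1) * f 5
      + real (Suc m div 7 - 1) * f 7 + real (Suc m div 11 - 1) * f 11"
proof -
  have "(\<Sum>p\<in>extra_primes m. real (Suc m div p - 1) * f p)
      = (\<Sum>p\<in>{2, 3, 5, 7, 11}. real (Suc m div p - 1) * f p)"
  proof (rule sum.mono_neutral_left)
    show "extra_primes m \<subseteq> {2, 3, 5, 7, 11}"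
      unfolding primes_le_12[symmetric] using assms by (auto simp: extra_primes_def)
    show "\<forall>p\<in>{2, 3, 5, 7, 11} - extra_primes m. real (Suc m div p - 1) * f p = 0"
    proof
      fix p :: nat assume p: "p \<in> {2, 3, 5, 7, 11} - extra_primes m"
      then have "prime p" "\<not> real p \<le> (real m + 1) / 2" by (auto simp: extra_primes_def)
      then have "Suc m < 2 * p" by (simp add: field_simps)
      then have "Suc m div p < 2" by (simp add: less_mult_imp_div_less)
      then show "real (Suc m div p - 1) * f p = 0" by simp
    qed
  qed simp
  then show ?thesis by simp
qed

lemma gain_rate_small:
  assumes "m \<le> 24"
  shows "gain_rate m = real (Suc m div 2 - 1) * ln 2 + real (Suc m div 3 - 1) * (ln 3 / 2)
    + real (Suc m div 5 - 1) * (ln 5 / 4) + real (Suc m div 7 - 1) * (ln 7 / 6)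
    + real (Suc m div 11 - 1) * (ln 11 / 10)"
  using sum_extra_primes_small[OF assms, of "\<lambda>p. ln (real p) / (real p - 1)"]
  by (simp add: gain_rate_def)

lemma gain_loss_small:
  assumes "m \<le> 24"
  shows "gain_loss m = real (Suc m div 2 - 1) + real (Suc m div 3 - 1)
    + real (Suc m div 5 - 1) + real (Suc m div 7 - 1) + real (Suc m div 11 - 1)"
  using sum_extra_primes_small[OF assms, of "\<lambda>_. 1"] by (simp add: gain_loss_def)

text \<open>The witness \<open>j = p - 1\<close> wastes a full remainder: its own quotient is
  \<open>0\<close>. The measure needs only this direction; the converse is
  \<open>Min_floor_sum\<close>, for the limit.\<close>

lemma Min_floor_sum_le:
  assumes "p \<ge> 1" "p \<le> Suc m"
  shows "Min ((\<lambda>j. j div p + (m - j) div p) ` {0..m}) \<le> Suc m div p - 1"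
proof -
  have "Min ((\<lambda>j. j div p + (m - j) div p) ` {0..m}) \<le> (p - 1) div p + (m - (p - 1)) div p"
    using assms by (intro Min_le image_eqI[of _ _ "p - 1"]) auto
  also have "\<dots> = (Suc m - p) div p" using assms by (simp add: Suc_diff_le)
  also have "\<dots> = Suc m div p - 1"
    using le_div_geq[of p "Suc m"] assms by simp
  finally show ?thesis .
qed

lemma w_fun_le_1:
  assumes "y > 1" "x \<ge> 1"
  shows "w_fun y x \<le> 1"
proof -
  have "0 \<le> y / x" "0 \<le> (y - 1) / ln y * (ln x / x)" using assms by auto
  then show ?thesis by (simp add: w_fun_def)
qed

lemma kappa_m_le:
  assumes "m \<ge> 1" "s_fun m \<ge> 1"
  shows "kappa_m m \<le> gain_rate m / real m"
proof -
  let ?x = "s_fun m * exp (s_fun m)"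
  have "1 * 1 \<le> ?x" using assms by (intro mult_mono) auto
  then have x: "1 \<le> ?x" by simp
  have "(\<Sum>p\<in>extra_primes m. real (Min ((\<lambda>j. j div p + (m - j) div p) ` {0..m}))
        * (ln (real p) / (real p - 1)) * w_fun (real p) ?x) \<le> gain_rate m"
    unfolding gain_rate_def
  proof (rule sum_mono)
    fix p assume "p \<in> extra_primes m"
    then have p: "p \<ge> 2" "real p \<le> (real m + 1) / 2" by (auto simp: extra_primes_def prime_ge_2_nat)
    then have "real p \<le> real (Suc m)" by simp
    then have "p \<le> Suc m" by (simp only: of_nat_le_iff)
    then have "Min ((\<lambda>j. j div p + (m - j) div p) ` {0..m}) \<le> Suc m div p - 1"
      using p by (intro Min_floor_sum_le) auto
    then have "real (Min ((\<lambda>j. j div p + (m - j) div p) ` {0..m})) * (ln (real p) / (real p - 1))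
        \<le> real (Suc m div p - 1) * (ln (real p) / (real p - 1))"
      using p by (intro mult_right_mono) auto
    moreover have "real (Min ((\<lambda>j. j div p + (m - j) div p) ` {0..m})) * (ln (real p) / (real p - 1))
        * w_fun (real p) ?x \<le> real (Min ((\<lambda>j. j div p + (m - j) div p) ` {0..m})) * (ln (real p) / (real p - 1)) * 1"
      using p x by (intro mult_left_mono w_fun_le_1) auto
    ultimately show "real (Min ((\<lambda>j. j div p + (m - j) div p) ` {0..m})) * (ln (real p) / (real p - 1))
        * w_fun (real p) ?x \<le> real (Suc m div p - 1) * (ln (real p) / (real p - 1))"
      by linarith
  qed
  then show ?thesis
    using assms unfolding kappa_m_def extra_primes_def by (simp add: divide_right_mono)
qed

text \<open>Each of the three factors increases with \<open>L\<close> and the first two decrease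
  with \<open>k\<close>; nonnegativity lets them be multiplied. The pairs
  \<open>(a, b) = (0, 2)\<close> and \<open>(1, 1)\<close> cover the two ranges of
  \<open>m\<close>.\<close>

lemma bound_coefficient_mono:
  fixes a b k kb L La M :: real
  assumes "k \<le> kb" "0 < La" "La \<le> L" "0 \<le> b" "kb \<le> La" "a + b * kb \<le> La\<^sup>2" "0 \<le> M"
    "0 \<le> kb" "0 \<le> a"
  shows "(1 - (a + b * kb) / La\<^sup>2) * (1 - kb / La) * (M * La) \<le> (1 - (a + b * k) / L\<^sup>2) * (1 - k / L) * (M * L)"
proof -
  have L2: "La\<^sup>2 \<le> L\<^sup>2" using assms by (intro power_mono) auto
  have "(a + b * k) / L\<^sup>2 \<le> (a + b * kb) / L\<^sup>2"
    using assms by (intro divide_right_mono add_left_mono mult_left_mono) auto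
  also have "\<dots> \<le> (a + b * kb) / La\<^sup>2"
    using assms L2 by (intro divide_left_mono) auto
  finally have 1: "1 - (a + b * kb) / La\<^sup>2 \<le> 1 - (a + b * k) / L\<^sup>2" by simp
  have "k / L \<le> kb / L" using assms by (intro divide_right_mono) auto
  also have "\<dots> \<le> kb / La" using assms by (intro divide_left_mono) auto
  finally have 2: "1 - kb / La \<le> 1 - k / L" by simp
  have 3: "0 \<le> 1 - (a + b * kb) / La\<^sup>2" "0 \<le> 1 - kb / La" using assms by auto
  show ?thesis
    using assms 1 2 3 order.trans[OF 3(1) 1] order.trans[OF 3(2) 2]
    by (intro mult_mono mult_nonneg_nonneg) auto
qed

lemma omega_bound_large:
  assumes "m \<ge> 5"
  shows "omega_bound m H = real m + (1 - ((if m \<le> 14 then 0 else 1) + (if m \<le> 14 then 2 else 1) * kappa_m m) / (ln (real m))\<^sup>2)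
    * (1 - kappa_m m / ln (real m)) * ((real m)\<^sup>2 * ln (real m)) / ln (ln H)"
  using assms by (auto simp: omega_bound_def)

text \<open>\<open>harm m - ln m\<close> decreases to Euler's constant, which exceeds
  \<open>19/33\<close>.\<close>

lemma harm_ge:
  assumes "m \<ge> 1"
  shows "ln (real m) + 19/33 \<le> harm m"
proof -
  obtain n where n: "m = Suc n" using assms by (cases m) auto
  have "decseq (\<lambda>n. harm (Suc n) - ln (real (Suc n)))"
    unfolding decseq_def by (intro allI impI euler_mascheroni_sequence_decreasing) auto
  moreover have "(\<lambda>n. harm (Suc n) - ln (real (Suc n))) \<longlonglongrightarrow> euler_mascheroni"
    using LIMSEQ_Suc[OF euler_mascheroni_LIMSEQ] by simp
  ultimately have "euler_mascheroni \<le> harm (Suc n) - ln (real (Suc n))"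
    by (rule decseq_ge)
  then show ?thesis using euler_mascheroni_gt_19_over_33 unfolding n by linarith
qed

lemma ln_ln_pos:
  fixes s H :: real
  assumes "s \<ge> 1" "s * exp s \<le> ln H"
  shows "ln (ln H) > 0"
proof -
  have "1 + s \<le> exp s" by (rule exp_ge_add_one_self)
  moreover have "1 * exp s \<le> s * exp s" using assms by (intro mult_right_mono) auto
  ultimately have "1 < ln H" using assms by linarith
  then show ?thesis by simp
qed

text \<open>An interval version, with rational inequalities for each concrete \<open>m\<close>. The
  bound on \<open>h\<close> is a truncated artanh series for \<open>ln (La + 19/33)\<close>, below
  \<open>ln (harm m)\<close>; \<open>ls\<close> is above \<open>ln s = L + 2 * ln L\<close>. The
  decisive inequality is checked at \<open>m * La^2\<close>, a lower bound of
  \<open>s\<close>.\<close>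

theorem omega_le_omega_bound_numeric:
  fixes m :: nat and H La Lb Ka Kb h ls c g C a b :: real
  assumes H: "s_fun m * exp (s_fun m) \<le> ln H" "H > 0"
    and m: "m \<ge> 5"
    and ab: "a = (if m \<le> 14 then 0 else 1)" "b = (if m \<le> 14 then 2 else 1)"
    and L: "La \<le> ln (real m)" "ln (real m) \<le> Lb" "8/5 \<le> La"
    and K: "Ka \<le> gain_rate m" "gain_rate m \<le> Kb" "Kb \<le> real m"
    and h: "0 \<le> h" "h \<le> 2 * ((La - 14/33) / (La + 52/33)) + 2/3 * ((La - 14/33) / (La + 52/33)) ^ 3"
    and ls: "Lb + 2 * (2 * ((Lb - 1) / (Lb + 1)) + 2/3 * ((Lb - 1) / (Lb + 1)) ^ 3
      + 2/5 * ((Lb - 1) / (Lb + 1)) ^ 5 / (1 - ((Lb - 1) / (Lb + 1))\<^sup>2)) \<le> ls"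
    and c: "(real m + 1/2) * Lb - real m + 1 - h - Ka + 1/1000 \<le> c" "c + 1 \<le> real m * La\<^sup>2"
    and c_low: "1 \<le> (real m + 1/2) * La - real m + 1 - h - Kb + 1/1000"
    and g: "(real m + 1) * (Lb + 1 / real m) - real m - Ka + real m * c + 1/250 \<le> g"
    and C: "C \<le> (1 - (a + b * (Kb / real m)) / La\<^sup>2) * (1 - Kb / real m / La) * ((real m)\<^sup>2 * La)" "0 \<le> C"
    and Kb: "Kb / real m \<le> La" "a + b * (Kb / real m) \<le> La\<^sup>2"
    and main: "g * (real m * La\<^sup>2 + ls) < C * (real m * La\<^sup>2 - c)"
  shows "omega m H \<le> omega_bound m H"
proof -
  define K where "K = gain_rate m"
  define L where "L = ln (real m)"
  define s where "s = real m * L\<^sup>2"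
  define c1 where "c1 = (real m + 1/2) * L - real m + 1 - h - K + 1/1000"
  define g1 where "g1 = (real m + 1) * (L + 1 / real m) - real m - K + real m * c1 + 1/250"
  have sfun: "s_fun m = s" using m by (simp add: s_fun_def s_def L_def)
  have La_pos: "La > 0" using L by simp
  have s_ge: "real m * La\<^sup>2 \<le> s"
    unfolding s_def L_def using L by (intro mult_left_mono power_mono) auto
  have "(real m + 1/2) * L \<le> (real m + 1/2) * Lb" "(real m + 1/2) * La \<le> (real m + 1/2) * L"
    using L by (intro mult_left_mono; simp add: L_def)+
  then have c1: "c1 \<le> c" "1 \<le> c1"
    using c c_low K unfolding c1_def K_def by linarith+
  have g1: "g1 \<le> g"
  proof -
    have "(real m + 1) * (L + 1 / real m) \<le> (real m + 1) * (Lb + 1 / real m)"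
      using L by (intro mult_left_mono) (auto simp: L_def)
    moreover have "real m * c1 \<le> real m * c" using c1 by (intro mult_left_mono) auto
    ultimately show ?thesis using g K unfolding g1_def K_def by linarith
  qed
  have g1_pos: "g1 > 0"
  proof -
    define X where "X = (real m + 1) * (L + 1 / real m)"
    have "(real m + 1) * 1 \<le> X"
      unfolding X_def using L by (intro mult_left_mono) (auto simp: L_def intro: add_increasing2)
    moreover have "real m * 1 \<le> real m * c1" using c1 by (intro mult_left_mono) auto
    ultimately show ?thesis using K unfolding g1_def K_def X_def[symmetric] mult_1_right by linarith
  qed
  have lns: "ln s \<le> ls"
  proof -
    have "ln s = L + 2 * ln L"
      using L La_pos m by (simp add: s_def L_def ln_mult_pos ln_realpow)
    also have "ln L \<le> ln Lb" using L La_pos by (simp add: L_def)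
    also have "ln Lb \<le> 2 * ((Lb - 1) / (Lb + 1)) + 2/3 * ((Lb - 1) / (Lb + 1)) ^ 3
      + 2/5 * ((Lb - 1) / (Lb + 1)) ^ 5 / (1 - ((Lb - 1) / (Lb + 1))\<^sup>2)"
      using L by (intro ln_two_term_bounds(2)) auto
    finally show ?thesis using ls L by (simp add: L_def)
  qed
  have ls0: "0 \<le> ls"
  proof -
    have "1 \<le> s" using c1 c s_ge by linarith
    then show ?thesis using lns by (meson ln_ge_zero order.trans)
  qed
  \<comment> \<open>Needed to pass from \<open>m * La^2\<close> to \<open>s\<close>: the increase of
    \<open>s\<close> then adds no more on the left of \<open>main\<close> than on the right.\<close>
  have gC: "g \<le> C"
  proof (rule ccontr)
    assume "\<not> g \<le> C"
    then have "C * (real m * La\<^sup>2 - c) \<le> g * (real m * La\<^sup>2 + ls)"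
      using c c1 ls0 C by (intro mult_mono) auto
    then show False using main by simp
  qed
  have "g1 * (s + ln s) \<le> g * (s + ls)"
    using g1 g1_pos lns c1 c s_ge by (intro mult_mono) auto
  also have "\<dots> = g * (real m * La\<^sup>2 + ls) + g * (s - real m * La\<^sup>2)" by (simp add: algebra_simps)
  also have "\<dots> < C * (real m * La\<^sup>2 - c) + C * (s - real m * La\<^sup>2)"
    using main gC s_ge by (intro add_less_le_mono mult_right_mono) auto
  also have "\<dots> = C * (s - c)" by (simp add: algebra_simps)
  also have "\<dots> \<le> C * (s - c1)" using c1 C by (intro mult_left_mono) auto
  finally have key: "g1 * (s + ln s) < C * (s - c1)" .
  have "omega m H \<le> real m + C / ln (ln H)"
  proof (rule omega_le_of_log_inequality[where h = h and m = m and C = C, folded L_def, folded K_def s_def,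
        folded c1_def, folded g1_def])
    show "h \<le> ln (harm m)"
    proof -
      have eq: "(La + 19/33 - 1) / (La + 19/33 + 1) = (La - 14/33) / (La + 52/33)" by simp
      have "h \<le> ln (La + 19/33)"
        using ln_two_term_bounds(1)[of "La + 19/33", unfolded eq] h L by simp
      also have "\<dots> \<le> ln (harm m)"
        using harm_ge[of m] m L La_pos by (intro ln_mono) auto
      finally show ?thesis .
    qed
    show "s * exp s \<le> ln H" using H by (simp add: sfun)
    show "K \<le> real m" using K by (simp add: K_def)
    show "c1 + 1 \<le> s" using c1 c s_ge by linarith
  qed fact+
  also have "\<dots> \<le> omega_bound m H"
  proof -
    have s1: "s \<ge> 1" using c1 c s_ge by linarith
    have "kappa_m m \<le> Kb / real m"
    proof -
      have "kappa_m m \<le> gain_rate m / real m" using m s1 sfun by (intro kappa_m_le) auto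
      also have "\<dots> \<le> Kb / real m" using K by (intro divide_right_mono) auto
      finally show ?thesis .
    qed
    then have "C \<le> (1 - (a + b * kappa_m m) / L\<^sup>2) * (1 - kappa_m m / L) * ((real m)\<^sup>2 * L)"
      using gain_rate_nonneg[of m] K L La_pos Kb ab
      by (intro order.trans[OF C(1)] bound_coefficient_mono) (auto simp: L_def)
    then show ?thesis
      unfolding omega_bound_large[OF m] ab[symmetric] L_def
      using ln_ln_pos[of s H] s1 H sfun by (intro add_left_mono divide_right_mono) auto
  qed
  finally show ?thesis .
qed

text \<open>\<open>La\<close>, \<open>Lb\<close> and \<open>Ka\<close>, \<open>Kb\<close> enclose \<open>ln m\<close> and \<open>gain_rate m\<close> to five digits; the other constants are the
  bounds that result from them, rounded outward.\<close>

lemma omega_bound_5: "s_fun 5 * exp (s_fun 5) \<le> ln H \<Longrightarrow> H > 0 \<Longrightarrow> omega 5 H \<le> omega_bound 5 H"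
  by (rule omega_le_omega_bound_numeric[where La = "1.60943" and Lb = "1.60944" and Ka = "1.93560" and Kb = "1.93561"
      and h = "0.77853" and ls = "2.56123" and c = "2.13879" and g = "14.61899" and C = "21.42384" and a = 0 and b = 2])
    (insert ln_2_bounds ln_3_bounds ln_5_bounds , simp_all add: gain_rate_small power_divide)

lemma omega_bound_6: "s_fun 6 * exp (s_fun 6) \<le> ln H \<Longrightarrow> H > 0 \<Longrightarrow> omega 6 H \<le> omega_bound 6 H"
  by (rule omega_le_omega_bound_numeric[where La = "1.79175" and Lb = "1.79176" and Ka = "1.93560" and Kb = "1.93561"
      and h = "0.85682" and ls = "2.95820" and c = "3.85502" and g = "28.90751" and C = "42.25991" and a = 0 and b = 2])
    (insert ln_2_bounds ln_3_bounds ln_mult_pos[of 2 3], simp_all add: gain_rate_small power_divide)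

lemma omega_bound_7: "s_fun 7 * exp (s_fun 7) \<le> ln H \<Longrightarrow> H > 0 \<Longrightarrow> omega 7 H \<le> omega_bound 7 H"
  by (rule omega_le_omega_bound_numeric[where La = "1.94591" and Lb = "1.94592" and Ka = "2.62874" and Kb = "2.62875"
      and h = "0.91795" and ls = "3.27749" and c = "5.04871" and g = "42.42645" and C = "61.68551" and a = 0 and b = 2])
    (insert ln_2_bounds ln_3_bounds ln_7_bounds , simp_all add: gain_rate_small power_divide)

lemma omega_bound_8: "s_fun 8 * exp (s_fun 8) \<le> ln H \<Longrightarrow> H > 0 \<Longrightarrow> omega 8 H \<le> omega_bound 8 H"
  by (rule omega_le_omega_bound_numeric[where La = "2.07944" and Lb = "2.07945" and Ka = "3.17805" and Kb = "3.17806"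
      and h = "0.96757" and ls = "3.54384" and c = "6.53071" and g = "60.91168" and C = "87.87803" and a = 0 and b = 2])
    (insert ln_2_bounds ln_3_bounds ln_mult_pos[of 2 4] ln_mult_pos[of 2 2], simp_all add: gain_rate_small power_divide)

lemma omega_bound_9: "s_fun 9 * exp (s_fun 9) \<le> ln H \<Longrightarrow> H > 0 \<Longrightarrow> omega 9 H \<le> omega_bound 9 H"
  by (rule omega_le_omega_bound_numeric[where La = "2.19722" and Lb = "2.19723" and Ka = "4.27356" and Kb = "4.27357"
      and h = "1.00900" and ls = "3.77193" and c = "7.59213" and g = "78.14303" and C = "112.06884" and a = 0 and b = 2])
    (insert ln_2_bounds ln_3_bounds ln_5_bounds ln_mult_pos[of 3 3], simp_all add: gain_rate_small power_divide)

lemma omega_bound_10: "s_fun 10 * exp (s_fun 10) \<le> ln H \<Longrightarrow> H > 0 \<Longrightarrow> omega 10 H \<le> omega_bound 10 H"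
  by (rule omega_le_omega_bound_numeric[where La = "2.30258" and Lb = "2.30259" and Ka = "4.27356" and Kb = "4.27357"
      and h = "1.04436" and ls = "3.97110" and c = "9.86028" and g = "110.76173" and C = "157.29187" and a = 0 and b = 2])
    (insert ln_2_bounds ln_3_bounds ln_5_bounds ln_mult_pos[of 2 5], simp_all add: gain_rate_small power_divide)

lemma omega_bound_11: "s_fun 11 * exp (s_fun 11) \<le> ln H \<Longrightarrow> H > 0 \<Longrightarrow> omega 11 H \<le> omega_bound 11 H"
  by (rule omega_le_omega_bound_numeric[where La = "2.39789" and Lb = "2.39790" and Ka = "5.51601" and Kb = "5.51602"
      and h = "1.07505" and ls = "4.14770" and c = "10.98579" and g = "134.19739" and C = "189.44381" and a = 0 and b = 2])
    (insert ln_2_bounds ln_3_bounds ln_5_bounds ln_11_bounds , simp_all add: gain_rate_small power_divide)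

lemma omega_bound_12: "s_fun 12 * exp (s_fun 12) \<le> ln H \<Longrightarrow> H > 0 \<Longrightarrow> omega 12 H \<le> omega_bound 12 H"
  by (rule omega_le_omega_bound_numeric[where La = "2.48490" and Lb = "2.48491" and Ka = "5.51601" and Kb = "5.51602"
      and h = "1.10206" and ls = "4.30618" and c = "13.44431" and g = "177.20688" and C = "248.21294" and a = 0 and b = 2])
    (insert ln_2_bounds ln_3_bounds ln_5_bounds ln_mult_pos[of 2 6] ln_mult_pos[of 2 3], simp_all add: gain_rate_small power_divide)

lemma omega_bound_13: "s_fun 13 * exp (s_fun 13) \<le> ln H \<Longrightarrow> H > 0 \<Longrightarrow> omega 13 H \<le> omega_bound 13 H"
  by (rule omega_le_omega_bound_numeric[where La = "2.56494" and Lb = "2.56495" and Ka = "6.53347" and Kb = "6.53348"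
      and h = "1.12609" and ls = "4.44983" and c = "14.96827" and g = "212.04427" and C = "295.28847" and a = 0 and b = 2])
    (insert ln_2_bounds ln_3_bounds ln_5_bounds ln_7_bounds ln_13_bounds , simp_all add: gain_rate_small power_divide)

lemma omega_bound_14: "s_fun 14 * exp (s_fun 14) \<le> ln H \<Longrightarrow> H > 0 \<Longrightarrow> omega 14 H \<le> omega_bound 14 H"
  by (rule omega_le_omega_bound_numeric[where La = "2.63905" and Lb = "2.63906" and Ka = "7.48514" and Kb = "7.48515"
      and h = "1.14769" and ls = "4.58113" and c = "16.63454" and g = "252.05975" and C = "349.13441" and a = 0 and b = 2])
    (insert ln_2_bounds ln_3_bounds ln_5_bounds ln_7_bounds ln_mult_pos[of 2 7], simp_all add: gain_rate_small power_divide)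

lemma omega_bound_15: "s_fun 15 * exp (s_fun 15) \<le> ln H \<Longrightarrow> H > 0 \<Longrightarrow> omega 15 H \<le> omega_bound 15 H"
  by (rule omega_le_omega_bound_numeric[where La = "2.70805" and Lb = "2.70806" and Ka = "8.17829" and Kb = "8.17830"
      and h = "1.16726" and ls = "4.70198" and c = "18.63038" and g = "300.67704" and C = "384.09945" and a = 1 and b = 1])
    (insert ln_2_bounds ln_3_bounds ln_5_bounds ln_7_bounds ln_mult_pos[of 3 5], simp_all add: gain_rate_small power_divide)

lemma omega_bound_16: "s_fun 16 * exp (s_fun 16) \<le> ln H \<Longrightarrow> H > 0 \<Longrightarrow> omega 16 H \<le> omega_bound 16 H"
  by (rule omega_le_omega_bound_numeric[where La = "2.77258" and Lb = "2.77259" and Ka = "8.17829" and Kb = "8.17830"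
      and h = "1.18511" and ls = "4.81385" and c = "21.38534" and g = "366.18768" and C = "465.12252" and a = 1 and b = 1])
    (insert ln_2_bounds ln_3_bounds ln_5_bounds ln_7_bounds ln_mult_pos[of 2 8] ln_mult_pos[of 2 4] ln_mult_pos[of 2 2], simp_all add: gain_rate_small power_divide)

lemma omega_bound_17: "s_fun 17 * exp (s_fun 17) \<le> ln H \<Longrightarrow> H > 0 \<Longrightarrow> omega 17 H \<le> omega_bound 17 H"
  by (rule omega_le_omega_bound_numeric[where La = "2.83321" and Lb = "2.83322" and Ka = "9.42074" and Kb = "9.42075"
      and h = "1.20149" and ls = "4.91800" and c = "22.96012" and g = "415.96209" and C = "531.12149" and a = 1 and b = 1])
    (insert ln_2_bounds ln_3_bounds ln_5_bounds ln_7_bounds ln_17_bounds , simp_all add: gain_rate_small power_divide)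

lemma omega_bound_18: "s_fun 18 * exp (s_fun 18) \<le> ln H \<Longrightarrow> H > 0 \<Longrightarrow> omega 18 H \<le> omega_bound 18 H"
  by (rule omega_le_omega_bound_numeric[where La = "2.89037" and Lb = "2.89038" and Ka = "9.42074" and Kb = "9.42075"
      and h = "1.21661" and ls = "5.01537" and c = "25.83568" and g = "493.59828" and C = "627.06287" and a = 1 and b = 1])
    (insert ln_2_bounds ln_3_bounds ln_5_bounds ln_7_bounds ln_mult_pos[of 2 9] ln_mult_pos[of 3 3], simp_all add: gain_rate_small power_divide)

lemma omega_bound_19: "s_fun 19 * exp (s_fun 19) \<le> ln H \<Longrightarrow> H > 0 \<Longrightarrow> omega 19 H \<le> omega_bound 19 H"
  by (rule omega_le_omega_bound_numeric[where La = "2.94443" and Lb = "2.94444" and Ka = "10.51625" and Kb = "10.51626"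
      and h = "1.23062" and ls = "5.10676" and c = "27.67071" and g = "556.17268" and C = "708.46900" and a = 1 and b = 1])
    (insert ln_2_bounds ln_3_bounds ln_5_bounds ln_7_bounds ln_19_bounds , simp_all add: gain_rate_small power_divide)

lemma omega_bound_20: "s_fun 20 * exp (s_fun 20) \<le> ln H \<Longrightarrow> H > 0 \<Longrightarrow> omega 20 H \<le> omega_bound 20 H"
  by (rule omega_le_omega_bound_numeric[where La = "2.99573" and Lb = "2.99574" and Ka = "11.38987" and Kb = "11.38988"
      and h = "1.24366" and ls = "5.19288" and c = "29.78014" and g = "628.17747" and C = "800.76879" and a = 1 and b = 1])
    (insert ln_2_bounds ln_3_bounds ln_5_bounds ln_7_bounds ln_mult_pos[of 2 10] ln_mult_pos[of 2 5], simp_all add: gain_rate_small power_divide)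

lemma omega_bound_21: "s_fun 21 * exp (s_fun 21) \<le> ln H \<Longrightarrow> H > 0 \<Longrightarrow> omega 21 H \<le> omega_bound 21 H"
  by (rule omega_le_omega_bound_numeric[where La = "3.04452" and Lb = "3.04453" and Ka = "12.32281" and Kb = "12.32282"
      and h = "1.25585" and ls = "5.27426" and c = "31.87974" and g = "704.18301" and C = "898.30638" and a = 1 and b = 1])
    (insert ln_2_bounds ln_3_bounds ln_5_bounds ln_7_bounds ln_11_bounds ln_mult_pos[of 3 7], simp_all add: gain_rate_small power_divide)

lemma omega_bound_22: "s_fun 22 * exp (s_fun 22) \<le> ln H \<Longrightarrow> H > 0 \<Longrightarrow> omega 22 H \<le> omega_bound 22 H"
  by (rule omega_le_omega_bound_numeric[where La = "3.09104" and Lb = "3.09105" and Ka = "12.32281" and Kb = "12.32282"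
      and h = "1.26728" and ls = "5.35139" and c = "34.95954" and g = "806.93068" and C = "1024.94132" and a = 1 and b = 1])
    (insert ln_2_bounds ln_3_bounds ln_5_bounds ln_7_bounds ln_11_bounds ln_mult_pos[of 2 11], simp_all add: gain_rate_small power_divide)

lemma omega_bound_23: "s_fun 23 * exp (s_fun 23) \<le> ln H \<Longrightarrow> H > 0 \<Longrightarrow> omega 23 H \<le> omega_bound 23 H"
  by (rule omega_le_omega_bound_numeric[where La = "3.13549" and Lb = "3.13550" and Ka = "13.56526" and Kb = "13.56527"
      and h = "1.27802" and ls = "5.42468" and c = "36.84197" and g = "887.09953" and C = "1128.90590" and a = 1 and b = 1])
    (insert ln_2_bounds ln_3_bounds ln_5_bounds ln_7_bounds ln_11_bounds ln_23_bounds , simp_all add: gain_rate_small power_divide)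

lemma omega_bound_24: "s_fun 24 * exp (s_fun 24) \<le> ln H \<Longrightarrow> H > 0 \<Longrightarrow> omega 24 H \<le> omega_bound 24 H"
  by (rule omega_le_omega_bound_numeric[where La = "3.17805" and Lb = "3.17806" and Ka = "13.96762" and Kb = "13.96763"
      and h = "1.28816" and ls = "5.49449" and c = "39.60769" and g = "993.11411" and C = "1261.11641" and a = 1 and b = 1])
    (insert ln_2_bounds ln_3_bounds ln_5_bounds ln_7_bounds ln_11_bounds ln_mult_pos[of 2 12] ln_mult_pos[of 2 6] ln_mult_pos[of 2 3], simp_all add: gain_rate_small power_divide)

section \<open>Degrees 2, 3 and 4\<close>

lemma sum_exp_bounds:
  "(\<Sum>j=1..2. exp (real j) - 1) \<le> 8.12"
  "(\<Sum>j=1..3. exp (real j) - 1) \<le> 27.25"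
  "(\<Sum>j=1..4. exp (real j) - 1) \<le> 81"
proof -
  have e: "exp (real j) \<le> 2.72 ^ j" for j
  proof -
    have "exp (real j) = exp 1 ^ j" using exp_of_nat_mult[of j "1::real"] by simp
    also have "\<dots> \<le> 2.72 ^ j" using e_less_272 by (intro power_mono) auto
    finally show ?thesis .
  qed
  have e1: "exp (1::real) \<le> 2.72" "exp (2::real) \<le> 7.3984" "exp (3::real) \<le> 20.124" "exp (4::real) \<le> 54.74"
    using e[of 1] e[of 2] e[of 3] e[of 4] by (simp_all add: power_divide)
  show "(\<Sum>j=1..2. exp (real j) - 1) \<le> 8.12"
    "(\<Sum>j=1..3. exp (real j) - 1) \<le> 27.25"
    "(\<Sum>j=1..4. exp (real j) - 1) \<le> 81"
    using e1 by (simp_all add: numeral_eq_Suc)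
qed

lemma poly_node_poly_2: "poly (node_poly 2) x = x * (x - 1) * (x - 2)"
  by (simp add: poly_node_poly numeral_eq_Suc)

lemma poly_node_poly_3: "poly (node_poly 3) x = x * (x - 1) * (x - 2) * (x - 3)"
  by (simp add: poly_node_poly numeral_eq_Suc)

lemma poly_node_poly_4: "poly (node_poly 4) x = x * (x - 1) * (x - 2) * (x - 3) * (x - 4)"
  by (simp add: poly_node_poly numeral_eq_Suc)

text \<open>The exact maximum \<open>2 / (3 * sqrt 3)\<close>. The square is a cubic in
  \<open>w = (x - 1)^2\<close> whose distance to \<open>4/27\<close> has a double zero at the
  maximiser \<open>w = 1/3\<close>.\<close>

lemma node_poly_2_bound:
  assumes "0 \<le> x" "x \<le> 2"
  shows "\<bar>poly (node_poly 2) x\<bar> \<le> exp (ln 2 - 3/2 * ln 3)"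
proof -
  define w where "w = (x - 1)\<^sup>2"
  have w: "w \<le> 1" using assms by (auto simp: w_def power2_eq_square intro: mult_le_one abs_le_square_iff[THEN iffD1])
      (smt (verit) assms mult_le_one mult_nonneg_nonneg minus_mult_minus)
  have "(poly (node_poly 2) x)\<^sup>2 = w * (1 - w)\<^sup>2"
    by (simp add: poly_node_poly_2 w_def power2_eq_square algebra_simps)
  also have "\<dots> = 4/27 - (w - 1/3)\<^sup>2 * (4/3 - w)"
    by (simp add: power2_eq_square algebra_simps)
  also have "\<dots> \<le> 4/27" using w by simp
  also have "\<dots> = (exp (ln 2 - 3/2 * ln 3))\<^sup>2"
  proof -
    have "(exp (ln 2 - 3/2 * ln 3 :: real))\<^sup>2 = exp (2 * ln 2 - 3 * ln 3)"
      by (simp add: power2_eq_square flip: exp_add)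
    also have "2 * ln 2 - 3 * ln 3 = ln (4/27 :: real)"
      using ln_realpow[of 2 2] ln_realpow[of 3 3] by (simp add: ln_divide_pos)
    finally show ?thesis by simp
  qed
  finally have "\<bar>poly (node_poly 2) x\<bar>\<^sup>2 \<le> (exp (ln 2 - 3/2 * ln 3))\<^sup>2" by simp
  then show ?thesis by (rule power2_le_imp_le) simp
qed

text \<open>Symmetry under \<open>x -> 3 - x\<close> leaves a quadratic in \<open>z\<close>, with
  minimum \<open>-1\<close> at \<open>z = 1\<close>. The bound \<open>1\<close> gives
  \<open>mu = 0\<close> for this degree.\<close>

lemma node_poly_3_bound:
  assumes "0 \<le> x" "x \<le> 3"
  shows "\<bar>poly (node_poly 3) x\<bar> \<le> 1"
proof -
  define z where "z = x * (3 - x)"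
  have z: "0 \<le> z" using assms by (simp add: z_def)
  have "z = 9/4 - (x - 3/2)\<^sup>2" by (simp add: z_def power2_eq_square algebra_simps)
  then have z': "z \<le> 9/4" by simp
  have eq: "poly (node_poly 3) x = (z - 1)\<^sup>2 - 1"
    by (simp add: poly_node_poly_3 z_def power2_eq_square algebra_simps)
  have "z * (z - 2) \<le> 9/4 * (1/4)"
  proof (cases "z \<le> 2")
    case True
    then have "z * (z - 2) \<le> 0" using z by (simp add: mult_nonneg_nonpos)
    then show ?thesis by simp
  next
    case False
    then show ?thesis using z' by (intro mult_mono) auto
  qed
  moreover have "(z - 1)\<^sup>2 - 1 = z * (z - 2)" by (simp add: power2_eq_square algebra_simps)
  moreover have "(z - 1)\<^sup>2 \<ge> 0" by simp
  ultimately show ?thesis unfolding eq by linarith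
qed

text \<open>Replaces the \<open>27\<close> of \<open>omit_poly_bound\<close>; the value
  \<open>6\<close> is attained for \<open>k = 0\<close> at \<open>x = 0\<close>. The factors are
  paired symmetrically about \<open>3/2\<close>.\<close>

lemma omit_poly_3_bound:
  assumes "k \<le> 3" "0 \<le> x" "x \<le> 3"
  shows "\<bar>poly (omit_poly 3 k) x\<bar> \<le> 6"
proof -
  have k: "k = 0 \<or> k = 1 \<or> k = 2 \<or> k = 3" using assms(1) by presburger
  have q: "\<bar>(x - 1) * (x - 2)\<bar> \<le> 2"
  proof -
    have "(x - 1) * (x - 2) = (x - 3/2)\<^sup>2 - 1/4" by (simp add: power2_eq_square algebra_simps)
    moreover have "(x - 1) * (x - 2) = 2 - x * (3 - x)" by (simp add: algebra_simps)
    moreover have "0 \<le> x * (3 - x)" using assms by simp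
    moreover have "0 \<le> (x - 3/2)\<^sup>2" by simp
    ultimately show ?thesis by linarith
  qed
  have p: "\<bar>x * (x - 3)\<bar> \<le> 9/4"
  proof -
    have "x * (x - 3) = (x - 3/2)\<^sup>2 - 9/4" by (simp add: power2_eq_square algebra_simps)
    moreover have "x * (x - 3) = - (x * (3 - x))" by (simp add: algebra_simps)
    moreover have "0 \<le> x * (3 - x)" using assms by simp
    moreover have "0 \<le> (x - 3/2)\<^sup>2" by simp
    ultimately show ?thesis by linarith
  qed
  have set: "{..3} - {0} = {1,2,3::nat}" "{..3} - {1} = {0,2,3::nat}" "{..3} - {2} = {0,1,3::nat}" "{..3} - {3} = {0,1,2::nat}"
    by auto
  have "\<bar>x - 3\<bar> * \<bar>(x - 1) * (x - 2)\<bar> \<le> 3 * 2" using q assms by (intro mult_mono) auto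
  moreover have "\<bar>x\<bar> * \<bar>(x - 1) * (x - 2)\<bar> \<le> 3 * 2" using q assms by (intro mult_mono) auto
  moreover have "\<bar>x - 2\<bar> * \<bar>x * (x - 3)\<bar> \<le> 2 * (9/4)" using p assms by (intro mult_mono) auto
  moreover have "\<bar>x - 1\<bar> * \<bar>x * (x - 3)\<bar> \<le> 2 * (9/4)" using p assms by (intro mult_mono) auto
  ultimately show ?thesis
    using k by (elim disjE) (simp_all add: poly_omit_poly set[simplified] set abs_mult mult_ac)
qed

lemma node_poly_4_bound:
  assumes "0 \<le> x" "x \<le> 4"
  shows "\<bar>poly (node_poly 4) x\<bar> \<le> 3.7"
proof -
  define y where "y = \<bar>x - 2\<bar>"
  define w where "w = y\<^sup>2"
  have y: "0 \<le> y" "y \<le> 2" using assms by (auto simp: y_def)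
  have w0: "0 \<le> w" "w \<le> 4" using y power_mono[of y 2 2] by (auto simp: w_def)
  have w: "w = (x - 2)\<^sup>2" by (simp add: w_def y_def)
  have "poly (node_poly 4) x = (x - 2) * ((w - 1) * (w - 4))"
    by (simp add: poly_node_poly_4 w power2_eq_square algebra_simps)
  then have eq: "\<bar>poly (node_poly 4) x\<bar> = y * (\<bar>w - 1\<bar> * (4 - w))"
    using w0 by (simp add: abs_mult y_def)
  show ?thesis
  proof (cases "w \<le> 1")
    case True
    have "y \<le> 1" using True power2_le_imp_le[of y 1] by (simp add: w_def)
    have "y * (1 - w) \<le> 1/2"
    proof -
      have "y * (1 - w) = (y * (1 - y)) * (1 + y)" by (simp add: w_def power2_eq_square algebra_simps)
      also have "\<dots> \<le> 1/4 * 2"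
      proof (intro mult_mono)
        have "y * (1 - y) = 1/4 - (y - 1/2)\<^sup>2" by (simp add: power2_eq_square algebra_simps)
        then show "y * (1 - y) \<le> 1/4" by simp
      qed (use y \<open>y \<le> 1\<close> in auto)
      finally show ?thesis by simp
    qed
    then have "(y * (1 - w)) * (4 - w) \<le> 1/2 * 4" using w0 by (intro mult_mono) auto
    moreover have "y * (\<bar>w - 1\<bar> * (4 - w)) = (y * (1 - w)) * (4 - w)" using True by simp
    ultimately show ?thesis unfolding eq by linarith
  next
    case False
    \<comment> \<open>\<open>1.64\<close> is close to the maximiser, so AM-GM loses little and leaves a cubic in \<open>w\<close>.\<close>
    have "y \<le> (w + 2.6896) / 3.28"
    proof -
      have "0 \<le> (y - 1.64)\<^sup>2" by simp
      also have "(y - 1.64)\<^sup>2 = w - 3.28 * y + 2.6896" by (simp add: w_def power2_eq_square algebra_simps)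
      finally show ?thesis by simp
    qed
    then have "y * ((w - 1) * (4 - w)) \<le> (w + 2.6896) / 3.28 * ((w - 1) * (4 - w))"
      using False w0 by (intro mult_right_mono) auto
    also have "\<dots> \<le> 3.7"
    proof -
      \<comment> \<open>The cubic \<open>X\<close> has its maximum near \<open>w = 2.7\<close>, and
        \<open>12.136 = 3.28 * 3.7\<close>. The gap is a square times a positive factor plus a
        linear remainder that is positive up to \<open>w = 4\<close>.\<close>
      define X where "X = (w + 2.6896) * ((w - 1) * (4 - w))"
      define Y where "Y = (w - 2.7)\<^sup>2 * (w + 3.0896)"
      have "12.136 - X = Y + (0.371216 - 0.05416 * w)"
        unfolding X_def Y_def by (simp add: power2_eq_square field_simps)
      moreover have "Y \<ge> 0" unfolding Y_def using w0 by simp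
      ultimately have "X \<le> 12.136" using w0 by simp
      then have "X / 3.28 \<le> 3.7" by simp
      then show ?thesis unfolding X_def by (simp only: times_divide_eq_left)
    qed
    finally show ?thesis unfolding eq using False by simp
  qed
qed

lemma le_exp_of_ln_le: "0 < a \<Longrightarrow> ln a \<le> x \<Longrightarrow> a \<le> exp x" for a x :: real
  using ln_le_cancel_iff[of a "exp x"] by simp

lemma omega_bound_2:
  assumes "s_fun 2 * exp (s_fun 2) \<le> ln H" "H > 0"
  shows "omega 2 H \<le> omega_bound 2 H"
proof -
  note b = ln_2_bounds ln_3_bounds ln_11_bounds
  have ln66: "ln (66::real) = ln 2 + ln 3 + ln 11" using ln_mult_pos[of 2 33] ln_mult_pos[of 3 11] by simp
  have x1: "14.8 \<le> exp (2.7::real)"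
    using ln_2_bounds ln_37_bounds ln_5_bounds ln_divide_pos[of 74 5] ln_mult_pos[of 2 37]
    by (intro le_exp_of_ln_le) auto
  have e: "2.7 \<le> exp (1::real)"
    using ln_2_bounds ln_3_bounds ln_5_bounds ln_divide_pos[of 27 10] ln_mult_pos[of 2 5] ln_mult_pos[of 3 9] ln_mult_pos[of 3 3]
    by (intro le_exp_of_ln_le) auto
  have gr: "gain_rate 2 = 0" "gain_loss 2 = 0" by (simp_all add: gain_rate_small gain_loss_small)
  \<comment> \<open>\<open>2.2777\<close> is \<open>u1 - c1\<close> for the constants used
    next.\<close>
  have lnv: "ln (2.2777::real) \<le> 0.8234" "0.819 \<le> ln (2.2777::real)"
    using ln_two_term_bounds[of "2.2777"] by (simp_all add: power_divide)
  have "omega 2 H \<le> real 2 + 4.93 / ln (ln H)"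
  \<comment> \<open>\<open>u1\<close> is a decimal just below \<open>s_fun 2 = exp 1\<close>, and
    \<open>eps\<close> is chosen so that \<open>c1\<close> becomes the decimal
    \<open>0.4223\<close>.\<close>
  proof (rule omega_le_of_numeric[where mu = "ln 2 - 3/2 * ln 3" and B = 4 and S = 33 and ?u1.0 = "2.7"
        and eps = "0.4223 - 1 - ln 2 + 3/2 * ln 3" and ?c1.0 = "0.4223" and g = "2.888"])
    show "\<bar>poly (omit_poly 2 k) x\<bar> \<le> 4" if "k \<le> 2" "0 \<le> x" "x \<le> real 2" for x k
      using omit_poly_bound[of k 2 x] that by simp
    show "\<bar>poly (node_poly 2) x\<bar> \<le> exp (ln 2 - 3/2 * ln 3)" if "0 \<le> x" "x \<le> real 2" for x
      using node_poly_2_bound[of x] that by simp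
    show "(\<Sum>j = 1..2. exp (real j) - 1) * 4 \<le> (33::real)" using sum_exp_bounds(1) by simp
    have "((0 + 1/2) * 2.7 + (ln (66::real) - 11/12 - (ln 2 - 3/2 * ln 3))) \<le> (0.4223 - 1 - ln 2 + 3/2 * ln 3) * 14.8"
      using b by (simp add: ln66)
    also have "\<dots> \<le> (0.4223 - 1 - ln 2 + 3/2 * ln 3) * exp 2.7"
      using x1 b by (intro mult_left_mono) auto
    finally show "((gain_loss 2 + 1/2) * 2.7 + (ln (2 * 33) - 11/12 - (ln 2 - 3/2 * ln 3) + gain_rate 2)) / exp 2.7
        \<le> 0.4223 - 1 - ln 2 + 3/2 * ln 3"
      by (simp add: gr divide_le_eq)
    have *: "(2 + 0) / exp (2.7::real) \<le> 2 / 14.8" using x1 by (intro frac_le) auto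
    define T where "T = ((2 + 0) * 2.7 + ((2 + 0) / exp 2.7 + ln 2 + 2 + 1/12 + (2 + 1/2) * ln (2 + 1))) / exp (2.7::real)"
    from * have "((2 + 0) * 2.7 + ((2 + 0) / exp 2.7 + ln 2 + 2 + 1/12 + (2 + 1/2) * ln (2 + 1))) / exp (2.7::real)
        \<le> 11.06 / 14.8"
      using x1 b by (intro frac_le) auto
    then have "T \<le> 11.06 / 14.8" by (simp only: T_def)
    moreover have eqT: "(real 2 + 1) * ln (real 2 + 1) - real 2 - gain_rate 2 + real 2 * 0.4223
        + ((real 2 + gain_loss 2) * 2.7 + ((real 2 + gain_loss 2) / exp 2.7 + ln 2 + real 2 + 1/12
          + (real 2 + 1/2) * ln (real 2 + 1))) / exp 2.7 = 3 * ln 3 - 2 - 0 + 2 * 0.4223 + T"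
      by (simp add: T_def gr)
    ultimately show "(real 2 + 1) * ln (real 2 + 1) - real 2 - gain_rate 2 + real 2 * 0.4223
        + ((real 2 + gain_loss 2) * 2.7 + ((real 2 + gain_loss 2) / exp 2.7 + ln 2 + real 2 + 1/12
          + (real 2 + 1/2) * ln (real 2 + 1))) / exp 2.7 \<le> 2.888"
      unfolding eqT using b by simp
    show "exp 2.7 * (2.7 - 0.4223) \<le> ln H"
    proof -
      have "exp 2.7 * (2.7 - 0.4223) \<le> exp (exp 1) * (exp 1 :: real)" using e by (intro mult_mono) auto
      then show ?thesis using assms by (simp add: s_fun_def mult.commute)
    qed
  qed (use assms b lnv in \<open>simp_all add: gr ln66\<close>)
  then show ?thesis by (simp add: omega_bound_def)
qed

lemma omega_bound_3:
  assumes "s_fun 3 * exp (s_fun 3) \<le> ln H" "H > 0"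
  shows "omega 3 H \<le> omega_bound 3 H"
proof -
  note b = ln_2_bounds ln_3_bounds ln_7_bounds ln_41_bounds
  have ln328: "ln (328::real) = 3 * ln 2 + ln 41"
    using ln_mult_pos[of 2 164] ln_mult_pos[of 2 82] ln_mult_pos[of 2 41] by simp
  have ln42: "ln (42::real) = ln 2 + ln 3 + ln 7" using ln_mult_pos[of 2 21] ln_mult_pos[of 3 7] by simp
  have l42: "3.7376 \<le> ln (42::real)" "ln (42::real) \<le> 3.7377" unfolding ln42 using b by simp_all
  have ln4: "ln (4::real) = 2 * ln 2" using ln_mult_pos[of 2 2] by simp
  have gr: "gain_rate 3 = ln 2" "gain_loss 3 = 1" by (simp_all add: gain_rate_small gain_loss_small)
  have lnv: "ln (ln 42 - 0.573 :: real) \<le> 1.153" "1 \<le> ln (ln 42 - 0.573 :: real)"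
  proof -
    have "ln (ln 42 - 0.573 :: real) \<le> ln 3.165" "ln (3.16::real) \<le> ln (ln 42 - 0.573)"
      using b by (subst ln_le_cancel_iff; simp add: ln42)+
    then show "ln (ln 42 - 0.573 :: real) \<le> 1.153" "1 \<le> ln (ln 42 - 0.573 :: real)"
      using ln_artanh_bounds(2)[of "3.165" 3] ln_two_term_bounds(1)[of "3.16"] by (simp_all add: power_divide numeral_eq_Suc)
  qed
  have "omega 3 H \<le> real 3 + 6.49 / ln (ln H)"
  \<comment> \<open>\<open>ln 42\<close> lies slightly above \<open>s_fun 3\<close>. The condition
    \<open>start\<close> still holds because \<open>c1\<close> is subtracted there, and
    \<open>exp u1\<close> becomes an integer.\<close>
  proof (rule omega_le_of_numeric[where mu = 0 and B = 6 and S = 164 and ?u1.0 = "ln 42"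
        and eps = "0.573 - 1 + ln 2" and ?c1.0 = "0.573" and g = "4.135"])
    show "\<bar>poly (omit_poly 3 k) x\<bar> \<le> 6" if "k \<le> 3" "0 \<le> x" "x \<le> real 3" for x k
      using omit_poly_3_bound[of k x] that by simp
    show "\<bar>poly (node_poly 3) x\<bar> \<le> exp 0" if "0 \<le> x" "x \<le> real 3" for x
      using node_poly_3_bound[of x] that by simp
    show "(\<Sum>j = 1..3. exp (real j) - 1) * 6 \<le> (164::real)" using sum_exp_bounds(2) by simp
    show "exp (ln 42) * (ln 42 - 0.573) \<le> ln H"
    proof -
      have "3.6208 \<le> s_fun 3"
      proof -
        have "(3.6208::real) \<le> 3 * 1.09861\<^sup>2" by (simp add: power2_eq_square)
        also have "\<dots> \<le> 3 * (ln (3::real))\<^sup>2" using b by (intro mult_left_mono power_mono) auto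
        finally show ?thesis by (simp add: s_fun_def)
      qed
      moreover have "37 \<le> exp (3.6208::real)" using ln_37_bounds by (intro le_exp_of_ln_le) auto
      ultimately have "3.6208 * 37 \<le> s_fun 3 * exp (s_fun 3)"
        by (intro mult_mono) (auto intro: order.trans[OF _ exp_le_cancel_iff[THEN iffD2]])
      moreover have "42 * (ln 42 - 0.573) \<le> (3.6208 * 37 :: real)" unfolding ln42 using b by simp
      ultimately have "42 * (ln 42 - 0.573) \<le> ln H" using assms by linarith
      then show ?thesis by simp
    qed
    show "(4.135::real) * (ln 42 + ln (ln 42 - 0.573)) < 6.49 * (ln 42 - 0.573)"
    proof -
      define V where "V = ln (ln 42 - 0.573 :: real)"
      have "V \<le> 1.153" using lnv(1) by (simp add: V_def)
      then show ?thesis using l42 unfolding V_def[symmetric] by simp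
    qed
  qed (use assms b lnv l42 in \<open>simp_all add: gr ln328 ln4 add_divide_distrib diff_divide_distrib\<close>)
  then show ?thesis by (simp add: omega_bound_def)
qed

lemma omega_bound_4:
  assumes "s_fun 4 * exp (s_fun 4) \<le> ln H" "H > 0"
  shows "omega 4 H \<le> omega_bound 4 H"
proof -
  note b = ln_2_bounds ln_3_bounds ln_5_bounds ln_7_bounds ln_37_bounds
  have ln42000: "ln (42000::real) = 4 * ln 2 + ln 3 + 3 * ln 5 + ln 7"
    using ln_mult_pos[of 2 21000] ln_mult_pos[of 2 10500] ln_mult_pos[of 2 5250] ln_mult_pos[of 2 2625]
      ln_mult_pos[of 3 875] ln_mult_pos[of 5 175] ln_mult_pos[of 5 35] ln_mult_pos[of 5 7] by simp
  have mu: "ln (3.7::real) = ln 37 - ln 2 - ln 5" using ln_divide_pos[of 37 10] ln_mult_pos[of 2 5] by simp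
  have ln4: "ln (4::real) = 2 * ln 2" using ln_mult_pos[of 2 2] by simp
  have gr: "gain_rate 4 = ln 2" "gain_loss 4 = 1" by (simp_all add: gain_rate_small gain_loss_small)
  have x1: "2156 \<le> exp (7.68::real)"
    using b ln_11_bounds ln_mult_pos[of 2 1078] ln_mult_pos[of 2 539] ln_mult_pos[of 7 77] ln_mult_pos[of 7 11]
    by (intro le_exp_of_ln_le) auto
  \<comment> \<open>\<open>6.055 = 7.68 - 1.625\<close> is again \<open>u1 - c1\<close>.\<close>
  have lnv: "ln (6.055::real) \<le> 1.803" "1 \<le> ln (6.055::real)"
    using ln_artanh_bounds(2)[of "6.055/6" 1] ln_two_term_bounds(1)[of "6.055"] ln_mult_pos[of 6 "6.055/6"] ln_mult_pos[of 2 3] b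
    by (simp_all add: power_divide)
  have s: "7.68 \<le> s_fun 4"
  proof -
    have "(7.68::real) \<le> 4 * 1.38629\<^sup>2" by (simp add: power2_eq_square)
    also have "\<dots> \<le> 4 * (ln (4::real))\<^sup>2" using b by (intro mult_left_mono power_mono) (auto simp: ln4)
    finally show ?thesis by (simp add: s_fun_def)
  qed
  have "omega 4 H \<le> real 4 + 15.7 / ln (ln H)"
  proof (rule omega_le_of_numeric[where mu = "ln 3.7" and B = 256 and S = 21000 and ?u1.0 = "7.68"
        and eps = "1.625 - 1 - ln 3.7 + ln 2" and ?c1.0 = "1.625" and g = "9.88"])
    show "\<bar>poly (omit_poly 4 k) x\<bar> \<le> 256" if "k \<le> 4" "0 \<le> x" "x \<le> real 4" for x k
      using omit_poly_bound[of k 4 x] that by simp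
    show "\<bar>poly (node_poly 4) x\<bar> \<le> exp (ln 3.7)" if "0 \<le> x" "x \<le> real 4" for x
      using node_poly_4_bound[of x] that by simp
    show "(\<Sum>j = 1..4. exp (real j) - 1) * 256 \<le> (21000::real)" using sum_exp_bounds(3) by simp
    have "((1 + 1/2) * 7.68 + (ln (42000::real) - 11/12 - ln 3.7 + ln 2)) \<le> (1.625 - 1 - ln 3.7 + ln 2) * 2156"
      using b by (simp add: ln42000 mu)
    also have "\<dots> \<le> (1.625 - 1 - ln 3.7 + ln 2) * exp 7.68"
      using x1 b by (intro mult_left_mono) (auto simp: mu)
    finally show "((gain_loss 4 + 1/2) * 7.68 + (ln (2 * 21000) - 11/12 - ln 3.7 + gain_rate 4)) / exp 7.68
        \<le> 1.625 - 1 - ln 3.7 + ln 2"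
      by (simp add: gr divide_le_eq)
    have *: "(4 + 1) / exp (7.68::real) \<le> 5 / 2156" using x1 by (intro frac_le) auto
    define T where "T = ((4 + 1) * 7.68 + ((4 + 1) / exp 7.68 + ln 2 + 4 + 1/12 + (4 + 1/2) * ln (4 + 1))) / exp (7.68::real)"
    from * have "((4 + 1) * 7.68 + ((4 + 1) / exp 7.68 + ln 2 + 4 + 1/12 + (4 + 1/2) * ln (4 + 1))) / exp (7.68::real)
        \<le> 50.5 / 2156"
      using x1 b by (intro frac_le) auto
    then have "T \<le> 50.5 / 2156" by (simp only: T_def)
    moreover have eqT: "(real 4 + 1) * ln (real 4 + 1) - real 4 - gain_rate 4 + real 4 * 1.625
        + ((real 4 + gain_loss 4) * 7.68 + ((real 4 + gain_loss 4) / exp 7.68 + ln 2 + real 4 + 1/12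
          + (real 4 + 1/2) * ln (real 4 + 1))) / exp 7.68 = 5 * ln 5 - 4 - ln 2 + 4 * 1.625 + T"
      by (simp add: T_def gr)
    ultimately show "(real 4 + 1) * ln (real 4 + 1) - real 4 - gain_rate 4 + real 4 * 1.625
        + ((real 4 + gain_loss 4) * 7.68 + ((real 4 + gain_loss 4) / exp 7.68 + ln 2 + real 4 + 1/12
          + (real 4 + 1/2) * ln (real 4 + 1))) / exp 7.68 \<le> 9.88"
      unfolding eqT using b by simp
    show "exp 7.68 * (7.68 - 1.625) \<le> ln H"
    proof -
      have "exp 7.68 * (7.68 - 1.625) \<le> exp (s_fun 4) * s_fun 4" using s by (intro mult_mono) auto
      then show ?thesis using assms by (simp add: mult.commute)
    qed
  qed (use assms b lnv in \<open>simp_all add: gr ln42000 mu\<close>)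
  then show ?thesis by (simp add: omega_bound_def)
qed

section \<open>Large degrees\<close>

text \<open>The inequality \<open>main\<close> of \<open>omega_le_of_log_inequality\<close>, divided
  by \<open>m^2 * L * m * L^2\<close>, in the variables \<open>y = 1 / L\<close>,
  \<open>mu = 1 / m\<close>, \<open>k = K / m\<close> and \<open>t = h / L\<close>. At
  \<open>mu = 0\<close> the right side exceeds the left by \<open>k * y^2 + (1 + k) * y^3 - (1 + k)
  * (1 + 2 * k) * y^4 + k * (1 + k)^2 * y^5\<close>; by \<open>key\<close> this pays for all terms
  with \<open>mu\<close>.\<close>

lemma asymptotic_inequality:
  fixes y mu k t :: real
  assumes y: "0 < y" "y \<le> 5/16" and mu: "0 < mu" "mu \<le> 1/25" and k: "13/25 \<le> k" "k \<le> 19/25"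
    and t: "29/25 * y \<le> t" "t \<le> 2/5"
    and key: "8/5 * mu \<le> k * y\<^sup>2 + (1 + k) * y ^ 3 - (1 + k) * (1 + 2 * k) * y ^ 4"
  shows "(1 - (1 + k) * y + mu * (3/2 - t - k * y + y/1000) + mu\<^sup>2 * (1 + y + y/250) + mu ^ 3 * y)
      * (1 + mu * (y + 2 * y * t))
    < (1 - (1 + k) * y\<^sup>2) * (1 - k * y) * (1 - y + (1 + k) * y\<^sup>2 - mu * (y/2 + 1001/1000 * y\<^sup>2 - y * t))"
proof -
  define P where "P = 1 - (1 + k) * y"
  define q where "q = y + 2 * y * t"
  define b where "b = 3/2 - t - 519/1000 * y + 532/10000"
  have ky: "13/25 * y \<le> k * y" "k * y \<le> 19/25 * y" using k y by (auto intro: mult_right_mono)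
  have P: "0 \<le> P" "P \<le> 1 - 38/25 * y" 
  proof -
    have "P = 1 - y - k * y" by (simp add: P_def algebra_simps)
    then show "0 \<le> P" "P \<le> 1 - 38/25 * y" using ky y by linarith+
  qed
  have t0: "0 \<le> t" using t y by linarith
  have yt: "0 \<le> y * t" using y t0 by simp
  have yt': "y * t \<le> 5/16 * (2/5)" using y t t0 by (intro mult_mono) auto
  have q: "0 \<le> q" "q \<le> 9/16" using yt yt' y by (auto simp: q_def)
  have b: "b \<le> 3/2 + 6/100" using t y unfolding b_def by linarith
  have "mu * (3/2 - t - k * y + y/1000) + mu\<^sup>2 * (1 + y + y/250) + mu ^ 3 * y
      = mu * (3/2 - t - k * y + y/1000 + (mu * (1 + y + y/250) + mu\<^sup>2 * y))"
    by (simp add: power2_eq_square power3_eq_cube algebra_simps)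
  also have "\<dots> \<le> mu * b"
  proof (rule mult_left_mono)
    have "mu * (1 + y + y/250) \<le> 1/25 * (1 + 5/16 + 5/16/250)"
      using mu y by (intro mult_mono) auto
    moreover have "mu\<^sup>2 * y \<le> (1/25)\<^sup>2 * (5/16)"
      using mu y by (intro mult_mono power_mono) auto
    ultimately show "3/2 - t - k * y + y/1000 + (mu * (1 + y + y/250) + mu\<^sup>2 * y) \<le> b"
      using ky unfolding b_def by (simp add: power2_eq_square)
  qed (use mu in simp)
  finally have g: "1 - (1 + k) * y + mu * (3/2 - t - k * y + y/1000) + mu\<^sup>2 * (1 + y + y/250) + mu ^ 3 * y
      \<le> P + mu * b" by (simp add: P_def)
  have mq: "0 \<le> 1 + mu * q" using mu q by simp
  have "(1 - (1 + k) * y + mu * (3/2 - t - k * y + y/1000) + mu\<^sup>2 * (1 + y + y/250) + mu ^ 3 * y)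
      * (1 + mu * q) \<le> (P + mu * b) * (1 + mu * q)"
    using g mq by (rule mult_right_mono)
  also have "\<dots> = P + mu * (b + P * q + mu * (b * q))" by (simp add: algebra_simps)
  also have "\<dots> < P + mu * (8/5 - y/2)"
  proof -
    have "b * q \<le> (3/2 + 6/100) * (9/16)"
    proof -
      have "b * q \<le> (3/2 + 6/100) * q" using b q by (intro mult_right_mono) auto
      also have "\<dots> \<le> (3/2 + 6/100) * (9/16)" using q by (intro mult_left_mono) auto
      finally show ?thesis .
    qed
    then have "mu * (b * q) \<le> mu * ((3/2 + 6/100) * (9/16))" using mu by (intro mult_left_mono) auto
    also have "\<dots> \<le> 1/25 * ((3/2 + 6/100) * (9/16))" using mu by (intro mult_right_mono) auto
    finally have 1: "mu * (b * q) \<le> 352/10000" by simp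
    have 2: "P * q \<le> (1 - 38/25 * y) * q" using P q by (intro mult_right_mono) auto
    \<comment> \<open>The difference increases with \<open>t\<close>, so \<open>t\<close> is
      measured from its lower bound; what is left at \<open>z = 0\<close> is a polynomial in
      \<open>y\<close>, positive by completing the square.\<close>
    define z where "z = t - 29/25 * y"
    have z: "z \<ge> 0" using t by (simp add: z_def)
    have "8/5 - y/2 - b - (1 - 38/25 * y) * q - 352/10000
        = z * (1 - 2 * y + 76/25 * y\<^sup>2) + (116/10000 + y * (179/1000 - 4/5 * y + 2204/625 * y\<^sup>2))"
      unfolding b_def q_def z_def by (simp add: power2_eq_square field_simps)
    moreover have "z * (1 - 2 * y + 76/25 * y\<^sup>2) \<ge> 0" using z y by simp
    moreover have "179/1000 - 4/5 * y + 2204/625 * y\<^sup>2 \<ge> 0"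
    proof -
      have "179/1000 - 4/5 * y + 2204/625 * y\<^sup>2 = 2204/625 * (y - 125/1102)\<^sup>2 + (179/1000 - 50/1102)"
        by (simp add: power2_eq_square field_simps)
      then show ?thesis by simp
    qed
    then have "y * (179/1000 - 4/5 * y + 2204/625 * y\<^sup>2) \<ge> 0" using y by simp
    ultimately have "b + P * q + mu * (b * q) < 8/5 - y/2" using 1 2 by linarith
    then show ?thesis using mu by simp
  qed
  also have "\<dots> \<le> (P + k * y\<^sup>2 + (1 + k) * y ^ 3 - (1 + k) * (1 + 2 * k) * y ^ 4 + k * (1 + k)\<^sup>2 * y ^ 5) - mu * (y/2)"
  proof -
    have "k * (1 + k)\<^sup>2 * y ^ 5 \<ge> 0" using k y by simp
    then show ?thesis using key by (simp add: right_diff_distrib)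
  qed
  also have "\<dots> = (1 - (1 + k) * y\<^sup>2) * (1 - k * y) * (1 - y + (1 + k) * y\<^sup>2) - mu * (y/2)"
    unfolding P_def by (simp add: power2_eq_square power3_eq_cube power4_eq_xxxx numeral_eq_Suc algebra_simps)
  also have "\<dots> \<le> (1 - (1 + k) * y\<^sup>2) * (1 - k * y) * (1 - y + (1 + k) * y\<^sup>2 - mu * (y/2 + 1001/1000 * y\<^sup>2 - y * t))"
  proof -
    define R where "R = (1 - (1 + k) * y\<^sup>2) * (1 - k * y)"
    have y2: "y\<^sup>2 \<le> y" using y by (simp add: power2_eq_square)
    have k2: "0 \<le> (1 + k) * y\<^sup>2" "(1 + k) * y\<^sup>2 \<le> 1"
    proof -
      have "(1 + k) * y\<^sup>2 \<le> 2 * (5/16)\<^sup>2" using k y by (intro mult_mono power_mono) auto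
      then show "(1 + k) * y\<^sup>2 \<le> 1" by (simp add: power2_eq_square)
      show "0 \<le> (1 + k) * y\<^sup>2" using k by simp
    qed
    have R: "0 \<le> R" "R \<le> 1"
      unfolding R_def using k2 ky y by (auto intro!: mult_nonneg_nonneg mult_le_one)
    have "1001/1000 * y\<^sup>2 \<le> y * t"
      using mult_left_mono[OF t(1), of y] y by (simp add: power2_eq_square)
    then have "R * (mu * (y/2 + 1001/1000 * y\<^sup>2 - y * t)) \<le> R * (mu * (y/2))"
      using mu R by (intro mult_left_mono) auto
    also have "\<dots> \<le> 1 * (mu * (y/2))" using R mu y by (intro mult_right_mono) auto
    finally show ?thesis unfolding R_def[symmetric] by (simp add: right_diff_distrib)
  qed
  finally show ?thesis unfolding q_def .
qed

lemma exp_quartic_lower: "x \<ge> 0 \<Longrightarrow> 1 + x + x\<^sup>2 / 2 + x ^ 3 / 6 + x ^ 4 / 24 \<le> exp (x::real)"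
  using sum_power_fact_le_exp[of x 4] by (simp add: numeral_eq_Suc fact_numeral)

text \<open>This is \<open>key\<close> for \<open>k = 13/25\<close>, multiplied by
  \<open>m * L^4\<close>, with \<open>m = exp L\<close>; \<open>16/5\<close> is below
  \<open>ln 25\<close>.\<close>

lemma growth_inequality:
  fixes L :: real
  assumes "L \<ge> 16/5"
  shows "8/5 * L ^ 4 \<le> exp L * (13/25 * L\<^sup>2 + 38/25 * L - 1938/625)"
proof -
  define d where "d = L - 16/5"
  have d: "d \<ge> 0" "L = d + 16/5" using assms by (auto simp: d_def)
  define E where "E = 1 + d + d\<^sup>2 / 2 + d ^ 3 / 6 + d ^ 4 / 24"
  define A where "A = 13/25 * d\<^sup>2 + 606/125 * d + 886/125"
  have A: "13/25 * L\<^sup>2 + 38/25 * L - 1938/625 = A"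
    unfolding A_def d(2) by (simp add: power2_eq_square field_simps)
  have A0: "A \<ge> 0" using d by (simp add: A_def)
  have e: "49/2 * E \<le> exp L"
  proof -
    have "49/2 \<le> exp (16/5::real)"
    proof -
      have "ln (49/2::real) = 2 * ln 7 - ln 2" using ln_divide_pos[of 49 2] ln_mult_pos[of 7 7] by simp
      then have "ln (49/2::real) \<le> 16/5" using ln_7_bounds ln_2_bounds by simp
      then show ?thesis using ln_le_cancel_iff[of "49/2" "exp (16/5)"] by simp
    qed
    then have "49/2 * E \<le> exp (16/5) * exp d"
      using exp_quartic_lower[OF d(1)] d unfolding E_def by (intro mult_mono) auto
    then show ?thesis by (simp add: d(2) flip: exp_add) (simp add: add.commute)
  qed
  have "8/5 * L ^ 4 \<le> 49/2 * E * A"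
  proof -
    \<comment> \<open>Shifting by \<open>16/5\<close> and truncating the exponential series leaves a
      polynomial in \<open>d\<close> with positive coefficients only.\<close>
    have "49/2 * E * A - 8/5 * L ^ 4 = 18387/3125 + 51698/625 * d + 3001/25 * d\<^sup>2 + 60443/750 * d ^ 3
        + 19081/600 * d ^ 4 + 21217/3000 * d ^ 5 + 637/1200 * d ^ 6"
      unfolding E_def A_def d(2) by (simp add: power2_eq_square power3_eq_cube power4_eq_xxxx numeral_eq_Suc field_simps)
    also have "\<dots> \<ge> 0" using d by (intro add_nonneg_nonneg mult_nonneg_nonneg) auto
    finally show ?thesis by simp
  qed
  also have "\<dots> \<le> exp L * A" using e A0 by (rule mult_right_mono)
  finally show ?thesis by (simp only: A)
qed

text \<open>The primes 2, 3 and 5 already suffice, with each floor replaced by its worst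
  case.\<close>

lemma gain_rate_lower:
  assumes "m \<ge> 25"
  shows "13/25 * real m \<le> gain_rate m"
proof -
  have sub: "{2, 3, 5} \<subseteq> extra_primes m" using assms by (auto simp: extra_primes_def)
  have n: "(real m + 2) / real p - 2 \<le> real (Suc m div p - 1)" if "p > 0" "p \<le> Suc m" for p
  proof -
    have "Suc m = p * (Suc m div p) + Suc m mod p" by simp
    moreover have "Suc m mod p < p" using that by simp
    ultimately have "Suc m + 1 \<le> p * (Suc m div p) + p" by linarith
    then have "real (Suc m + 1) \<le> real (p * (Suc m div p) + p)" by (simp only: of_nat_le_iff)
    then have "(real m + 2) / real p \<le> real (Suc m div p) + 1"
      using that by (simp add: divide_le_eq algebra_simps)
    moreover have "Suc m div p \<ge> 1" using that by (simp add: Suc_leI div_greater_zero_iff)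
    ultimately show ?thesis by (simp add: of_nat_diff)
  qed
  have "13/25 * real m \<le> (\<Sum>p\<in>{2, 3, 5}. ((real m + 2) / real p - 2) * (ln (real p) / (real p - 1)))"
  proof -
    have x: "real m \<ge> 25" using assms by simp
    have "(real m / 2 - 1) * 0.693 \<le> (real m / 2 - 1) * ln 2"
      using x ln_2_bounds by (intro mult_left_mono) auto
    moreover have "((real m - 4) / 3) * 0.549 \<le> ((real m - 4) / 3) * (ln 3 / 2)"
      using x ln_3_bounds by (intro mult_left_mono) auto
    moreover have "((real m - 8) / 5) * 0.402 \<le> ((real m - 8) / 5) * (ln 5 / 4)"
      using x ln_5_bounds by (intro mult_left_mono) auto
    moreover have "(\<Sum>p\<in>{2, 3, 5}. ((real m + 2) / real p - 2) * (ln (real p) / (real p - 1)))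
        = (real m / 2 - 1) * ln 2 + ((real m - 4) / 3) * (ln 3 / 2) + ((real m - 8) / 5) * (ln 5 / 4)"
      by (simp add: field_simps)
    moreover have "13/25 * real m \<le> (real m / 2 - 1) * 0.693 + ((real m - 4) / 3) * 0.549 + ((real m - 8) / 5) * 0.402"
      using x by (simp add: field_simps)
    ultimately show ?thesis by linarith
  qed
  also have "\<dots> \<le> (\<Sum>p\<in>{2, 3, 5}. real (Suc m div p - 1) * (ln (real p) / (real p - 1)))"
    using assms by (intro sum_mono mult_right_mono n) auto
  also have "\<dots> \<le> gain_rate m"
    unfolding gain_rate_def using sub
    by (intro sum_mono2 finite_extra_primes)
       (auto simp: extra_primes_def dest: prime_gt_1_nat intro!: mult_nonneg_nonneg divide_nonneg_nonneg)
  finally show ?thesis .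
qed

text \<open>\<open>Kup\<close> is kept as a hypothesis because it rests on the numerical value of
  \<open>kappa\<close>, obtained later.\<close>

lemma omega_bound_ge_25:
  assumes m: "m \<ge> 25" and H: "s_fun m * exp (s_fun m) \<le> ln H" "H > 0"
    and Kup: "gain_rate m \<le> 19/25 * real m"
  shows "omega m H \<le> omega_bound m H"
proof -
  define x where "x = real m"
  define L where "L = ln (real m)"
  define K where "K = gain_rate m"
  define s where "s = real m * L\<^sup>2"
  \<comment> \<open>Admissible because \<open>ln (m + 1) \<le> harm m\<close>, and it makes
    \<open>ln s\<close> equal to \<open>L + 2 * h\<close>.\<close>
  define h where "h = ln L"
  define c1 where "c1 = (real m + 1/2) * L - real m + 1 - h - K + 1/1000"
  define g where "g = (real m + 1) * (L + 1 / real m) - real m - K + real m * c1 + 1/250"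
  define k where "k = K / x"
  define y where "y = 1 / L"
  define mu where "mu = 1 / x"
  define t where "t = y * h"
  define C where "C = (1 - (1 + 1 * k) / L\<^sup>2) * (1 - k / L) * (x\<^sup>2 * L)"
  have x: "x \<ge> 25" using m by (simp add: x_def)
  have L: "L \<ge> 16/5"
  proof -
    have "ln 25 \<le> L" using m by (simp add: L_def)
    then show ?thesis using ln_5_bounds ln_mult_pos[of 5 5] by simp
  qed
  have k: "13/25 \<le> k" "k \<le> 19/25"
    using gain_rate_lower[OF m] Kup x by (auto simp: k_def K_def x_def field_simps)
  have K: "K = k * x" using x by (simp add: k_def)
  have y: "0 < y" "y \<le> 5/16" using L by (auto simp: y_def field_simps)
  have mu: "0 < mu" "mu \<le> 1/25" using x by (auto simp: mu_def field_simps)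
  have h: "29/25 \<le> h"
  proof -
    have "29/25 \<le> ln (16/5::real)"
      using ln_divide_pos[of 16 5] ln_mult_pos[of 2 8] ln_mult_pos[of 2 4] ln_mult_pos[of 2 2] ln_2_bounds ln_5_bounds by simp
    also have "\<dots> \<le> h" using L by (simp add: h_def)
    finally show ?thesis .
  qed
  have t: "29/25 * y \<le> t" using h y by (simp add: t_def)
  have hL: "h \<le> 2/5 * L"
  proof -
    have "h \<le> L / exp 1" unfolding h_def using L by (intro ln_le_scaled) auto
    also have "\<dots> \<le> L / (5/2)"
      using L exp_lower_Taylor_quadratic[of "1::real"] by (intro divide_left_mono) auto
    finally show ?thesis by simp
  qed
  have t': "t \<le> 2/5" using hL L by (simp add: t_def y_def field_simps)
  have expL: "exp L = x" using x by (simp add: L_def x_def)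
  have key: "8/5 * mu \<le> k * y\<^sup>2 + (1 + k) * y ^ 3 - (1 + k) * (1 + 2 * k) * y ^ 4"
  proof -
    have "8/5 * L ^ 4 \<le> x * (13/25 * L\<^sup>2 + 38/25 * L - 1938/625)"
      using growth_inequality[OF L] by (simp add: expL)
    then have "8/5 * L ^ 4 * (mu * y ^ 4) \<le> x * (13/25 * L\<^sup>2 + 38/25 * L - 1938/625) * (mu * y ^ 4)"
      using mu y by (intro mult_right_mono) auto
    moreover have "8/5 * L ^ 4 * (mu * y ^ 4) = 8/5 * mu"
      using L by (simp add: y_def field_simps)
    moreover have "x * (13/25 * L\<^sup>2 + 38/25 * L - 1938/625) * (mu * y ^ 4)
        = 13/25 * y\<^sup>2 + 38/25 * y ^ 3 - 1938/625 * y ^ 4"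
      using L x by (simp add: y_def mu_def field_simps power2_eq_square power3_eq_cube power4_eq_xxxx)
    moreover have "13/25 * y\<^sup>2 + 38/25 * y ^ 3 - 1938/625 * y ^ 4
        \<le> k * y\<^sup>2 + (1 + k) * y ^ 3 - (1 + k) * (1 + 2 * k) * y ^ 4"
    proof -
      \<comment> \<open>The bound is extended from \<open>k = 13/25\<close> to larger
        \<open>k\<close>, the difference having \<open>k - 13/25\<close> as a factor.\<close>
      have "k * y\<^sup>2 + (1 + k) * y ^ 3 - (1 + k) * (1 + 2 * k) * y ^ 4
          - (13/25 * y\<^sup>2 + 38/25 * y ^ 3 - 1938/625 * y ^ 4)
          = (k - 13/25) * (y\<^sup>2 * (1 + y - (2 * k + 101/25) * y\<^sup>2))"
        by (simp add: power2_eq_square power3_eq_cube power4_eq_xxxx field_simps)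
      moreover have "(2 * k + 101/25) * y\<^sup>2 \<le> 6 * (5/16)\<^sup>2"
        using k y by (intro mult_mono power_mono) auto
      then have "0 \<le> 1 + y - (2 * k + 101/25) * y\<^sup>2" using y by (simp add: power2_eq_square)
      then have "0 \<le> (k - 13/25) * (y\<^sup>2 * (1 + y - (2 * k + 101/25) * y\<^sup>2))" using k by simp
      ultimately show ?thesis by linarith
    qed
    ultimately show ?thesis by linarith
  qed
  have c1x: "c1 = x * L\<^sup>2 * (y - (1 + k) * y\<^sup>2 + mu * (y/2 + 1001/1000 * y\<^sup>2 - y * t))"
    using x L unfolding c1_def K t_def y_def mu_def x_def[symmetric] by (simp add: field_simps power2_eq_square)
  have gx: "g = x\<^sup>2 * L * (1 - (1 + k) * y + mu * (3/2 - t - k * y + y/1000) + mu\<^sup>2 * (1 + y + y/250) + mu ^ 3 * y)"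
    using x L unfolding g_def c1_def K t_def y_def mu_def x_def[symmetric]
    by (simp add: field_simps power2_eq_square power3_eq_cube)
  have sx: "s + ln s = x * L\<^sup>2 * (1 + mu * (y + 2 * y * t))"
  proof -
    have "ln s = L + 2 * h"
      using x L unfolding s_def h_def L_def x_def by (simp add: ln_mult_pos ln_realpow)
    then show ?thesis
      using x L unfolding s_def t_def y_def mu_def x_def[symmetric] by (simp add: field_simps power2_eq_square)
  qed
  have scx: "s - c1 = x * L\<^sup>2 * (1 - y + (1 + k) * y\<^sup>2 - mu * (y/2 + 1001/1000 * y\<^sup>2 - y * t))"
    unfolding c1x s_def x_def[symmetric] by (simp add: algebra_simps)
  have Cx: "C = x\<^sup>2 * L * ((1 - (1 + k) * y\<^sup>2) * (1 - k * y))"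
    using L unfolding C_def y_def by (simp add: field_simps)
  have main: "g * (s + ln s) < C * (s - c1)"
  proof -
    let ?A = "(1 - (1 + k) * y + mu * (3/2 - t - k * y + y/1000) + mu\<^sup>2 * (1 + y + y/250) + mu ^ 3 * y)
      * (1 + mu * (y + 2 * y * t))"
    let ?B = "(1 - (1 + k) * y\<^sup>2) * (1 - k * y) * (1 - y + (1 + k) * y\<^sup>2 - mu * (y/2 + 1001/1000 * y\<^sup>2 - y * t))"
    have "?A < ?B" by (rule asymptotic_inequality) fact+
    moreover have "0 < (x\<^sup>2 * L) * (x * L\<^sup>2)" using x L by simp
    ultimately have "((x\<^sup>2 * L) * (x * L\<^sup>2)) * ?A < ((x\<^sup>2 * L) * (x * L\<^sup>2)) * ?B"
      by (rule mult_strict_left_mono)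
    then show ?thesis unfolding gx sx Cx scx by (simp only: mult_ac)
  qed
  have xL: "16/5 * x \<le> x * L" using L x by simp
  have c1_low: "1 \<le> c1"
  proof -
    have "K \<le> 19/25 * x" using Kup by (simp add: K_def x_def)
    moreover have "c1 = x * L + L / 2 - x + 1 - h - K + 1/1000"
      by (simp add: c1_def x_def algebra_simps)
    ultimately show ?thesis using xL hL x L by linarith
  qed
  have c1_up: "c1 + 1 \<le> s"
  proof -
    have "s = x * L * L" by (simp add: s_def x_def power2_eq_square)
    moreover have "x * L * (16/5) \<le> x * L * L" using L x by (intro mult_left_mono) auto
    moreover have "c1 = x * L + L / 2 - x + 1 - h - K + 1/1000"
      by (simp add: c1_def x_def algebra_simps)
    moreover have "K \<ge> 0" unfolding K_def by (rule gain_rate_nonneg)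
    moreover have "25 * L \<le> x * L" using x L by (intro mult_right_mono) auto
    ultimately show ?thesis using xL x h L by linarith
  qed
  have sfun: "s_fun m = s" using m by (simp add: s_fun_def s_def L_def)
  have "omega m H \<le> real m + C / ln (ln H)"
  proof (rule omega_le_of_log_inequality[where h = h and m = m and C = C, folded L_def, folded K_def s_def,
        folded c1_def, folded g_def])
    show "m \<ge> 5" using m by simp
    show "s * exp s \<le> ln H" using H by (simp add: sfun)
    show "0 \<le> h" using h by simp
    show "h \<le> ln (harm m)"
    proof -
      have "L \<le> ln (real m + 1)" using m by (simp add: L_def)
      also have "\<dots> \<le> harm m" by (rule harm_ge_ln)
      finally show ?thesis unfolding h_def using L by (intro ln_mono) auto
    qed
    show "K \<le> real m" using Kup by (simp add: K_def)
  qed fact+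
  also have "\<dots> \<le> omega_bound m H"
  proof -
    have s1: "s \<ge> 1" using c1_low c1_up by linarith
    have "kappa_m m \<le> k" using m s1 sfun kappa_m_le[of m] by (simp add: k_def K_def x_def)
    then have "C \<le> (1 - (1 + 1 * kappa_m m) / L\<^sup>2) * (1 - kappa_m m / L) * (x\<^sup>2 * L)"
      unfolding C_def
    proof (rule bound_coefficient_mono)
      show "1 + 1 * k \<le> L\<^sup>2" using power_mono[OF L, of 2] k by (simp add: power2_eq_square)
    qed (use L k in auto)
    moreover have "\<not> m \<le> 14" "5 \<le> m" using m by auto
    ultimately show ?thesis
      unfolding omega_bound_large[OF \<open>5 \<le> m\<close>] using ln_ln_pos[of s H] s1 H sfun
      by (intro add_left_mono divide_right_mono) (auto simp: L_def x_def)
  qed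
  finally show ?thesis .
qed

section \<open>The constant \<open>\<kappa>\<close>\<close>

lemma summable_ln_over_power:
  assumes "k \<ge> 2"
  shows "summable (\<lambda>n. ln (real n) / real n ^ k)"
proof (rule summable_comparison_test)
  show "summable (\<lambda>n. real n powr (-3/2))" by (subst summable_real_powr_iff) simp
  show "\<exists>N. \<forall>n\<ge>N. norm (ln (real n) / real n ^ k) \<le> real n powr (-3/2)"
  proof (intro exI[of _ 1] allI impI)
    fix n :: nat assume n: "n \<ge> 1"
    have "(ln (real n))\<^sup>2 \<le> real n" using n by (intro ln_squared_le) simp
    then have "ln (real n) \<le> sqrt (real n)" by (rule real_le_rsqrt)
    moreover have "real n ^ 2 \<le> real n ^ k" using n assms by (intro power_increasing) auto
    ultimately have "ln (real n) / real n ^ k \<le> sqrt (real n) / real n ^ 2"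
      using n by (intro frac_le) auto
    also have "\<dots> = real n powr (-3/2)"
    proof -
      have "sqrt (real n) = real n powr (1/2)" by (simp add: powr_half_sqrt)
      moreover have "real n ^ 2 = real n powr 2" using n by (simp add: powr_numeral)
      ultimately have "sqrt (real n) / real n ^ 2 = real n powr (1/2 - 2)" by (simp only: powr_diff)
      then show ?thesis by simp
    qed
    finally show "norm (ln (real n) / real n ^ k) \<le> real n powr (-3/2)" using n by simp
  qed
qed

lemma ln_eq_sum_multiplicity:
  assumes "n \<ge> 1"
  shows "ln (real n) = (\<Sum>p\<in>prime_factors n. real (multiplicity p n) * ln (real p))"
proof -
  have "real n = (\<Prod>p\<in>prime_factors n. real p ^ multiplicity p n)"
    using arg_cong[OF prime_factorization_nat[of n], of real] assms by (simp only: of_nat_prod of_nat_power)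
  then have "ln (real n) = ln (\<Prod>p\<in>prime_factors n. real p ^ multiplicity p n)" by simp
  also have "\<dots> = (\<Sum>p\<in>prime_factors n. ln (real p ^ multiplicity p n))"
    by (rule ln_prod) (auto simp: in_prime_factors_iff prime_gt_0_nat)
  also have "\<dots> = (\<Sum>p\<in>prime_factors n. real (multiplicity p n) * ln (real p))"
    by (rule sum.cong) (auto simp: in_prime_factors_iff prime_gt_0_nat ln_realpow)
  finally show ?thesis .
qed

text \<open>This and \<open>log_zeta_sum\<close> are \<open>\<zeta>(k)\<close> and
  \<open>- \<zeta>'(k)\<close>. For \<open>k > 0\<close> the index \<open>0\<close> contributes
  nothing, since division by zero gives \<open>0\<close>.\<close>

definition zeta_sum :: "nat \<Rightarrow> real" where "zeta_sum k = (\<Sum>n. 1 / real n ^ k)"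

definition log_zeta_sum :: "nat \<Rightarrow> real" where "log_zeta_sum k = (\<Sum>n. ln (real n) / real n ^ k)"

lemma summable_inverse_power:
  assumes "k \<ge> 2"
  shows "summable (\<lambda>n. 1 / real n ^ k)"
  using inverse_power_summable[OF assms, where 'a = real] by (simp add: divide_inverse)

lemma zeta_sum_pos: "k \<ge> 2 \<Longrightarrow> zeta_sum k > 0"
  unfolding zeta_sum_def by (rule suminf_pos2[of _ 1]) (auto intro: summable_inverse_power)

text \<open>Double counting in \<open>ln n = \<Sum>p. multiplicity p n * ln p\<close>: this is the logarithmic derivative of
  the Euler product, without complex analysis.\<close>

theorem prime_log_sums:
  assumes k: "k \<ge> 2"
  shows "(\<lambda>p. if prime p then ln (real p) / (real p ^ k - 1) else 0) sums (log_zeta_sum k / zeta_sum k)"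
proof -
  define A where "A = {n::nat. n \<ge> 1}"
  define P where "P = {p::nat. prime p}"
  define f where "f = (\<lambda>(n, p). real (multiplicity p n) * ln (real p) / real n ^ k)"
  have nonneg: "f np \<ge> 0" if "np \<in> A \<times> P" for np
    using that by (auto simp: f_def A_def P_def prime_gt_0_nat Suc_leI intro!: mult_nonneg_nonneg divide_nonneg_nonneg)
  have row: "((\<lambda>p. f (n, p)) has_sum (ln (real n) / real n ^ k)) P" if "n \<in> A" for n
  proof (rule has_sum_finite_neutralI)
    show "finite (prime_factors n)" "prime_factors n \<subseteq> P" by (auto simp: P_def in_prime_factors_iff)
    show "f (n, p) = 0" if "p \<in> P - prime_factors n" for p
    proof -
      have "\<not> p dvd n" using that \<open>n \<in> A\<close> by (auto simp: P_def A_def in_prime_factors_iff)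
      then show ?thesis by (simp add: f_def not_dvd_imp_multiplicity_0)
    qed
    show "ln (real n) / real n ^ k = (\<Sum>p\<in>prime_factors n. f (n, p))"
      using ln_eq_sum_multiplicity[of n] that by (simp add: f_def A_def flip: sum_divide_distrib)
  qed
  have S: "((\<lambda>n. ln (real n) / real n ^ k) has_sum log_zeta_sum k) A"
  proof -
    have "((\<lambda>n. ln (real n) / real n ^ k) has_sum log_zeta_sum k) UNIV"
      unfolding log_zeta_sum_def
    proof (rule sums_nonneg_imp_has_sum[OF summable_sums[OF summable_ln_over_power[OF k]]])
      fix n show "0 \<le> ln (real n) / real n ^ k" by (cases n) auto
    qed
    then show ?thesis
      by (rule has_sum_cong_neutral[THEN iffD1, rotated -1]) (auto simp: A_def not_le)
  qed
  have Z: "((\<lambda>n. 1 / real n ^ k) has_sum zeta_sum k) A"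
  proof -
    have "((\<lambda>n. 1 / real n ^ k) has_sum zeta_sum k) UNIV"
      unfolding zeta_sum_def
      by (rule sums_nonneg_imp_has_sum[OF summable_sums[OF summable_inverse_power[OF k]]]) simp
    then show ?thesis
      by (rule has_sum_cong_neutral[THEN iffD1, rotated -1]) (use k in \<open>auto simp: A_def not_le\<close>)
  qed
  have sm: "f summable_on (A \<times> P)"
    by (rule summable_on_SigmaI[OF row]) (use S nonneg in \<open>auto simp: summable_on_def\<close>)
  have fS: "(f has_sum log_zeta_sum k) (A \<times> P)"
    by (rule has_sum_SigmaI[OF row S sm])
  have fS': "((\<lambda>(p, n). f (n, p)) has_sum log_zeta_sum k) (P \<times> A)"
    using fS has_sum_swap by blast
  \<comment> \<open>The sum \<open>v\<close> of \<open>multiplicity p n / n ^ k\<close> is not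
    expanded in powers of \<open>p\<close>: once it is known to converge, replacing \<open>n\<close>
    by \<open>p * n\<close> gives \<open>v = (zeta_sum k + v) / p ^ k\<close>, which is solved for
    \<open>v\<close>.\<close>
  have col: "((\<lambda>n. f (n, p)) has_sum (zeta_sum k * (ln (real p) / (real p ^ k - 1)))) A" if "p \<in> P" for p
  proof -
    have p: "prime p" using that by (simp add: P_def)
    have p2: "p \<ge> 2" using p by (rule prime_ge_2_nat)
    have lnp: "ln (real p) > 0" using p2 by simp
    have pk: "real p ^ k > 1" using p2 k by (intro one_less_power) auto
    have "(\<lambda>n. f (n, p)) summable_on A"
    proof (rule summable_on_comparison_test)
      show "(\<lambda>n. ln (real n) / real n ^ k) summable_on A" using S by (auto simp: summable_on_def)
      show "f (n, p) \<le> ln (real n) / real n ^ k" "0 \<le> f (n, p)" if "n \<in> A" for n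
      proof -
        show "0 \<le> f (n, p)" using that \<open>p \<in> P\<close> nonneg by auto
        have "f (n, p) = (\<Sum>q\<in>{p}. f (n, q))" by simp
        also have "\<dots> \<le> ln (real n) / real n ^ k"
          by (rule has_sum_mono_neutral[OF has_sum_finite row[OF that]]) (use that \<open>p \<in> P\<close> nonneg in auto)
        finally show "f (n, p) \<le> ln (real n) / real n ^ k" .
      qed
    qed
    then obtain w where "((\<lambda>n. f (n, p)) has_sum w) A" by (auto simp: summable_on_def)
    then have "((\<lambda>n. f (n, p) * (1 / ln (real p))) has_sum (w * (1 / ln (real p)))) A"
      by (rule has_sum_cmult_left)
    then obtain v where v: "((\<lambda>n. real (multiplicity p n) / real n ^ k) has_sum v) A" and w: "v = w / ln (real p)"
      using lnp by (simp add: f_def)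
    have "((\<lambda>n. real (multiplicity p n) / real n ^ k) has_sum v) ((\<lambda>n. p * n) ` A)"
      using v
    proof (rule has_sum_cong_neutral[THEN iffD1, rotated -1])
      fix n assume n: "n \<in> A - (\<lambda>n. p * n) ` A"
      have "\<not> p dvd n"
      proof
        assume "p dvd n"
        then obtain j where "n = p * j" by blast
        then show False using n by (auto simp: A_def)
      qed
      then show "real (multiplicity p n) / real n ^ k = 0" by (simp add: not_dvd_imp_multiplicity_0)
    qed (use p2 in \<open>auto simp: A_def\<close>)
    moreover have "inj_on (\<lambda>n. p * n) A" using p2 by (auto simp: inj_on_def)
    ultimately have "((\<lambda>n. real (multiplicity p (p * n)) / real (p * n) ^ k) has_sum v) A"
      by (simp add: has_sum_reindex o_def)
    also have "?this \<longleftrightarrow> ((\<lambda>n. (1 / real n ^ k + real (multiplicity p n) / real n ^ k) * (1 / real p ^ k)) has_sum v) A"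
    proof (rule has_sum_cong)
      fix n assume "n \<in> A"
      then have "multiplicity p (p * n) = Suc (multiplicity p n)"
        using p by (intro multiplicity_times_same) (auto simp: A_def)
      then show "real (multiplicity p (p * n)) / real (p * n) ^ k
          = (1 / real n ^ k + real (multiplicity p n) / real n ^ k) * (1 / real p ^ k)"
        by (simp add: power_mult_distrib add_divide_distrib algebra_simps)
    qed
    finally have "((\<lambda>n. (1 / real n ^ k + real (multiplicity p n) / real n ^ k) * (1 / real p ^ k)) has_sum v) A" .
    moreover have "((\<lambda>n. (1 / real n ^ k + real (multiplicity p n) / real n ^ k) * (1 / real p ^ k))
        has_sum ((zeta_sum k + v) * (1 / real p ^ k))) A"
      by (intro has_sum_cmult_left has_sum_add Z v)
    ultimately have "v = (zeta_sum k + v) * (1 / real p ^ k)" by (rule has_sum_unique)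
    then have "v = (zeta_sum k + v) / real p ^ k" by simp
    moreover have "real p ^ k \<noteq> 0" using pk by linarith
    ultimately have "v * real p ^ k = zeta_sum k + v" using nonzero_eq_divide_eq by blast
    then have "v * (real p ^ k - 1) = zeta_sum k" by (simp add: algebra_simps)
    then have "v = zeta_sum k / (real p ^ k - 1)" using pk by (simp add: field_simps)
    then have "w = zeta_sum k * (ln (real p) / (real p ^ k - 1))" using w lnp by (simp add: field_simps)
    then show ?thesis using \<open>((\<lambda>n. f (n, p)) has_sum w) A\<close> by simp
  qed
  have "((\<lambda>p. zeta_sum k * (ln (real p) / (real p ^ k - 1))) has_sum log_zeta_sum k) P"
    by (rule has_sum_SigmaD[OF fS']) (use col in simp)
  from has_sum_cmult_right[OF this, of "1 / zeta_sum k"]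
  have "((\<lambda>p. ln (real p) / (real p ^ k - 1)) has_sum (log_zeta_sum k / zeta_sum k)) P"
    using zeta_sum_pos[OF k] by simp
  then have "((\<lambda>p. if prime p then ln (real p) / (real p ^ k - 1) else 0) has_sum (log_zeta_sum k / zeta_sum k)) UNIV"
    by (rule has_sum_cong_neutral[THEN iffD1, rotated -1]) (auto simp: P_def)
  then show ?thesis by (rule has_sum_imp_sums)
qed

section \<open>Midpoint Euler--Maclaurin summation for \<open>ln x / x ^ k\<close>\<close>

definition log_pow :: "nat \<Rightarrow> real \<Rightarrow> real \<Rightarrow> real \<Rightarrow> real" where
  "log_pow a \<alpha> \<beta> x = (\<alpha> * ln x + \<beta>) / x ^ a"

text \<open>The family is closed under differentiation and contains primitives of both
  \<open>ln x / x ^ k\<close> and \<open>1 / x ^ k\<close> for \<open>k \<ge> 2\<close>.\<close>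

lemma has_derivative_log_pow:
  assumes "x > 0"
  shows "(log_pow a \<alpha> \<beta> has_real_derivative log_pow (Suc a) (- real a * \<alpha>) (\<alpha> - real a * \<beta>) x) (at x)"
proof -
  have "((\<lambda>x. (\<alpha> * ln x + \<beta>) / x ^ a) has_real_derivative
      ((\<alpha> * (1 / x)) * x ^ a - (\<alpha> * ln x + \<beta>) * (real a * x ^ (a - 1))) / (x ^ a * x ^ a)) (at x)"
    using assms by (auto intro!: derivative_eq_intros)
  also have "((\<alpha> * (1 / x)) * x ^ a - (\<alpha> * ln x + \<beta>) * (real a * x ^ (a - 1))) / (x ^ a * x ^ a)
      = log_pow (Suc a) (- real a * \<alpha>) (\<alpha> - real a * \<beta>) x"
    using assms unfolding log_pow_def by (cases a) (simp_all add: field_simps)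
  finally show ?thesis unfolding log_pow_def[abs_def] .
qed

text \<open>The parameters are updated before recursing, so that for a concrete order simplification
  ends in a single \<open>log_pow\<close> with explicit coefficients.\<close>

primrec log_pow_deriv :: "nat \<Rightarrow> nat \<Rightarrow> real \<Rightarrow> real \<Rightarrow> real \<Rightarrow> real" where
  "log_pow_deriv 0 a \<alpha> \<beta> = log_pow a \<alpha> \<beta>"
| "log_pow_deriv (Suc j) a \<alpha> \<beta> = log_pow_deriv j (Suc a) (- real a * \<alpha>) (\<alpha> - real a * \<beta>)"

lemma has_derivative_log_pow_deriv:
  assumes "x > 0"
  shows "(log_pow_deriv j a \<alpha> \<beta> has_real_derivative log_pow_deriv (Suc j) a \<alpha> \<beta> x) (at x)"
proof (induction j arbitrary: a \<alpha> \<beta>)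
  case 0
  show ?case using has_derivative_log_pow[OF assms] by (simp only: log_pow_deriv.simps)
next
  case (Suc j)
  from Suc[of "Suc a" "- real a * \<alpha>" "\<alpha> - real a * \<beta>"] show ?case by (simp only: log_pow_deriv.simps)
qed

lemma log_pow_deriv_eq: "\<exists>\<alpha>' \<beta>'. log_pow_deriv j a \<alpha> \<beta> = log_pow (a + j) \<alpha>' \<beta>'"
proof (induction j arbitrary: a \<alpha> \<beta>)
  case (Suc j)
  from Suc[of "Suc a" "- real a * \<alpha>" "\<alpha> - real a * \<beta>"] show ?case by simp
qed auto

lemma log_pow_tendsto_0:
  assumes "a \<ge> 1"
  shows "(log_pow a \<alpha> \<beta> \<longlongrightarrow> 0) at_top"
proof -
  have "((\<lambda>x::real. ln x / x) \<longlongrightarrow> 0) at_top" "((\<lambda>x::real. inverse x) \<longlongrightarrow> 0) at_top"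
    by real_asymp+
  then have "((\<lambda>x::real. \<alpha> * (ln x / x) + \<beta> * inverse x) \<longlongrightarrow> \<alpha> * 0 + \<beta> * 0) at_top"
    by (intro tendsto_add tendsto_mult tendsto_const)
  then have lim: "((\<lambda>x::real. \<alpha> * (ln x / x) + \<beta> * inverse x) \<longlongrightarrow> 0) at_top"
    by simp
  show ?thesis
  proof (rule Lim_null_comparison)
    show "\<forall>\<^sub>F x in at_top. norm (log_pow a \<alpha> \<beta> x) \<le> \<bar>\<alpha> * (ln x / x) + \<beta> * inverse x\<bar>"
      using eventually_ge_at_top[of 1]
    proof eventually_elim
      case (elim x)
      have "x ^ 1 \<le> x ^ a" using elim assms by (intro power_increasing) auto
      then have "\<bar>\<alpha> * ln x + \<beta>\<bar> / x ^ a \<le> \<bar>\<alpha> * ln x + \<beta>\<bar> / x" using elim by (intro divide_left_mono) auto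
      then show ?case using elim by (simp add: log_pow_def abs_divide divide_inverse distrib_right mult.assoc)
          (simp add: abs_mult flip: distrib_right mult.assoc)
    qed
    show "((\<lambda>x::real. \<bar>\<alpha> * (ln x / x) + \<beta> * inverse x\<bar>) \<longlongrightarrow> 0) at_top"
      using tendsto_rabs_zero[OF lim] .
  qed
qed

text \<open>The coefficients are those of the power series of \<open>(t/2) / sinh (t/2)\<close>,
  which inverts the central difference divided by \<open>t\<close>.\<close>

definition mid_sum :: "(nat \<Rightarrow> real \<Rightarrow> real) \<Rightarrow> real \<Rightarrow> real" where
  "mid_sum D x = D 0 x - D 2 x / 24 + 7 * D 4 x / 5760 - 31 * D 6 x / 967680"

text \<open>One step of the midpoint Euler--Maclaurin formula: the coefficients in \<open>mid_sum\<close> cancel the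
  third, fifth and seventh derivatives in the Taylor expansions around \<open>c\<close>.\<close>

lemma mid_sum_step:
  fixes D :: "nat \<Rightarrow> real \<Rightarrow> real"
  assumes D: "\<And>j x. c - 1/2 \<le> x \<Longrightarrow> x \<le> c + 1/2 \<Longrightarrow> (D j has_real_derivative D (Suc j) x) (at x)"
    and B: "\<And>x. c - 1/2 \<le> x \<Longrightarrow> x \<le> c + 1/2 \<Longrightarrow> \<bar>D 9 x\<bar> \<le> B"
  shows "\<bar>- D 1 c - (mid_sum D (c - 1/2) - mid_sum D (c + 1/2))\<bar> \<le> B / 470000"
proof -
  define r where "r i n h = D i (c + h) - (\<Sum>j<n. D (i + j) c / fact j * h ^ j)" for i n and h :: real
  have taylor: "\<bar>r i n h\<bar> \<le> B / (fact n * 2 ^ n)"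
    if hyp: "i + n = 9" "n > 0" "h = 1/2 \<or> h = - 1/2" for i n h
  proof -
    obtain t where t: "if c + h < c then c + h < t \<and> t < c else c < t \<and> t < c + h"
      "D i (c + h) = (\<Sum>j<n. (D (i + j) c / fact j) * (c + h - c) ^ j) + (D (i + n) t / fact n) * (c + h - c) ^ n"
    proof -
      have "\<exists>t. (if c + h < c then c + h < t \<and> t < c else c < t \<and> t < c + h) \<and>
          D i (c + h) = (\<Sum>j<n. (D (i + j) c / fact j) * (c + h - c) ^ j) + (D (i + n) t / fact n) * (c + h - c) ^ n"
        using hyp D by (intro Taylor[where diff = "\<lambda>j. D (i + j)" and a = "c - 1/2" and b = "c + 1/2"]) auto
      then show ?thesis using that by blast
    qed
    have "\<bar>D 9 t\<bar> \<le> B" using t(1) hyp by (intro B) (auto split: if_splits)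
    have "\<bar>r i n h\<bar> = \<bar>D 9 t\<bar> / fact n * \<bar>h\<bar> ^ n"
      using t(2) hyp by (simp add: r_def abs_mult power_abs)
    also have "\<bar>h\<bar> = 1/2" using hyp by auto
    also have "\<bar>D 9 t\<bar> / fact n * (1/2) ^ n \<le> B / fact n * (1/2) ^ n"
      using \<open>\<bar>D 9 t\<bar> \<le> B\<close> by (intro mult_right_mono divide_right_mono) auto
    finally show ?thesis by (simp add: power_divide)
  qed
  \<comment> \<open>Differences of Taylor remainders, all expressed by the ninth derivative.
    Weighted with the coefficients of \<open>mid_sum\<close>, their bounds add up to less than
    \<open>B / 470000\<close>.\<close>
  define x0 where "x0 = r 0 9 (1/2) - r 0 9 (-1/2)"
  define x2 where "x2 = r 2 7 (1/2) - r 2 7 (-1/2)"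
  define x4 where "x4 = r 4 5 (1/2) - r 4 5 (-1/2)"
  define x6 where "x6 = r 6 3 (1/2) - r 6 3 (-1/2)"
  have x: "\<bar>x0\<bar> \<le> B / 92897280" "\<bar>x2\<bar> \<le> B / 322560" "\<bar>x4\<bar> \<le> B / 1920" "\<bar>x6\<bar> \<le> B / 24"
  proof -
    have tri: "\<bar>u - v\<bar> \<le> 2 * w" if "\<bar>u\<bar> \<le> w" "\<bar>v\<bar> \<le> w" for u v w :: real
      using that by linarith
    show "\<bar>x0\<bar> \<le> B / 92897280"
      using tri[OF taylor[of 0 9 "1/2"] taylor[of 0 9 "-1/2"]] by (simp add: x0_def fact_numeral)
    show "\<bar>x2\<bar> \<le> B / 322560"
      using tri[OF taylor[of 2 7 "1/2"] taylor[of 2 7 "-1/2"]] by (simp add: x2_def fact_numeral)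
    show "\<bar>x4\<bar> \<le> B / 1920"
      using tri[OF taylor[of 4 5 "1/2"] taylor[of 4 5 "-1/2"]] by (simp add: x4_def fact_numeral)
    show "\<bar>x6\<bar> \<le> B / 24"
      using tri[OF taylor[of 6 3 "1/2"] taylor[of 6 3 "-1/2"]] by (simp add: x6_def fact_numeral)
  qed
  have "D 1 = D (Suc 0)" "D 3 = D (Suc (Suc (Suc 0)))" by (simp_all add: numeral_3_eq_3)
  then have eq: "- D 1 c - (mid_sum D (c - 1/2) - mid_sum D (c + 1/2)) = x0 - x2 / 24 + 7 * x4 / 5760 - 31 * x6 / 967680"
    unfolding mid_sum_def r_def x0_def x2_def x4_def x6_def
    by (simp add: lessThan_nat_numeral fact_numeral power_divide) (simp add: field_simps)
  have "\<bar>D 9 c\<bar> \<le> B" by (auto intro: B)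
  then have "B \<ge> 0" using abs_ge_zero[of "D 9 c"] by linarith
  then show ?thesis
    using x unfolding eq abs_le_iff by (elim conjE, (intro conjI; linarith))
qed

text \<open>The steps telescope over the centres \<open>N\<close>, \<open>N + 1\<close> and so on.
  With \<open>c * (c - 1) \<le> (c - 1/2)^2\<close> their errors are dominated by
  \<open>1 / (c - 1) - 1 / c\<close>, which telescopes too.\<close>

theorem mid_sum_estimate:
  fixes D :: "nat \<Rightarrow> real \<Rightarrow> real" and N :: nat
  assumes N: "N \<ge> 2"
    and D: "\<And>j x. x > 0 \<Longrightarrow> (D j has_real_derivative D (Suc j) x) (at x)"
    and B: "\<And>x. x \<ge> real N - 1/2 \<Longrightarrow> \<bar>D 9 x\<bar> \<le> A / x\<^sup>2"
    and lim: "\<And>j. (D j \<longlongrightarrow> 0) at_top" and A: "A \<ge> 0"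
  shows "\<bar>(\<Sum>n. - D 1 (real (n + N))) - mid_sum D (real N - 1/2)\<bar> \<le> A / (470000 * (real N - 1))"
proof -
  define U where "U n = mid_sum D (real (n + N) - 1/2)" for n
  define e where "e n = - D 1 (real (n + N)) - (U n - U (Suc n))" for n
  define b where "b n = A / 470000 * (1 / (real (n + N) - 1) - 1 / real (n + N))" for n
  have e: "\<bar>e n\<bar> \<le> b n" for n
  proof -
    define c where "c = real (n + N)"
    have c: "c \<ge> 2" using N by (simp add: c_def)
    have "\<bar>- D 1 c - (mid_sum D (c - 1/2) - mid_sum D (c + 1/2))\<bar> \<le> (A / (c - 1/2)\<^sup>2) / 470000"
    proof (rule mid_sum_step)
      fix x assume x: "c - 1/2 \<le> x" "x \<le> c + 1/2"
      then show "(D j has_real_derivative D (Suc j) x) (at x)" for j using c by (intro D) auto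
      have "\<bar>D 9 x\<bar> \<le> A / x\<^sup>2" using x by (intro B) (auto simp: c_def)
      also have "\<dots> \<le> A / (c - 1/2)\<^sup>2" using x c A by (intro divide_left_mono power_mono) auto
      finally show "\<bar>D 9 x\<bar> \<le> A / (c - 1/2)\<^sup>2" .
    qed
    also have "\<dots> \<le> (A / (c * (c - 1))) / 470000"
    proof -
      have "0 < c * (c - 1)" using c by simp
      moreover have "c * (c - 1) \<le> (c - 1/2)\<^sup>2" by (simp add: power2_eq_square algebra_simps)
      ultimately show ?thesis using A c by (intro divide_right_mono divide_left_mono mult_pos_pos) auto
    qed
    also have "\<dots> = A / 470000 * (1 / (c - 1) - 1 / c)" using c by (simp add: field_simps)
    finally show ?thesis unfolding e_def U_def b_def c_def by (simp add: algebra_simps)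
  qed
  have "(\<lambda>n. 1 / (real (n + N) - 1)) \<longlonglongrightarrow> 0"
    by (intro tendsto_divide_0[OF tendsto_const] filterlim_at_top_imp_at_infinity) real_asymp
  from telescope_sums'[OF this] have "(\<lambda>n. 1 / (real (n + N) - 1) - 1 / (real (Suc n + N) - 1)) sums (1 / (real N - 1))"
    by simp
  from sums_mult[OF this, of "A / 470000"] have b: "b sums (A / 470000 * (1 / (real N - 1)))"
    unfolding b_def[abs_def] by simp
  have sb: "summable b" using b by (rule sums_summable)
  have summ_e: "summable e"
    by (rule summable_comparison_test'[OF sb, of 0]) (simp add: e)
  have "\<bar>suminf e\<bar> \<le> suminf b"
  proof (rule order.trans[OF summable_rabs])
    show s: "summable (\<lambda>n. \<bar>e n\<bar>)"
      by (rule summable_comparison_test'[OF sb, of 0]) (simp add: e)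
    show "(\<Sum>n. \<bar>e n\<bar>) \<le> suminf b" by (rule suminf_le[OF e s sb])
  qed
  also have "suminf b = A / (470000 * (real N - 1))" using sums_unique[OF b] by simp
  finally have err: "\<bar>suminf e\<bar> \<le> A / (470000 * (real N - 1))" .
  have Ulim: "U \<longlonglongrightarrow> 0"
  proof -
    have "(mid_sum D \<longlongrightarrow> 0 - 0 / 24 + 7 * 0 / 5760 - 31 * 0 / 967680) at_top"
      unfolding mid_sum_def[abs_def] by (intro tendsto_intros lim) auto
    then have "(mid_sum D \<longlongrightarrow> 0) at_top" by simp
    moreover have "filterlim (\<lambda>n. real (n + N) - 1/2) at_top sequentially" by real_asymp
    ultimately show ?thesis unfolding U_def[abs_def] by (rule filterlim_compose)
  qed
  have "(\<lambda>n. U n - U (Suc n)) sums (U 0 - 0)" by (rule telescope_sums'[OF Ulim])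
  from sums_add[OF summable_sums[OF summ_e] this]
  have "(\<lambda>n. - D 1 (real (n + N))) sums (suminf e + U 0)" by (simp add: e_def)
  from sums_unique[OF this] show ?thesis using err by (simp add: U_def)
qed

lemma ln_le_linear_31: "x \<ge> 31 \<Longrightarrow> ln x \<le> 3/25 * x" for x :: real
proof -
  assume x: "x \<ge> 31"
  have "ln (x / 31) \<le> x / 31 - 1" using x by (intro ln_le_minus_one) auto
  then have "ln x \<le> ln 31 + x / 31 - 1" using x by (simp add: ln_divide_pos)
  then show ?thesis using ln_31_bounds x by simp
qed

text \<open>One power of \<open>x\<close> absorbs the logarithm, two are kept for summation, and the
  others are bounded by powers of \<open>31\<close>.\<close>

lemma log_pow_bound:
  assumes "x \<ge> 31"
  shows "\<bar>log_pow (b + 3) \<alpha> \<beta> x\<bar> \<le> (3/25 * \<bar>\<alpha>\<bar> + \<bar>\<beta>\<bar> / 31) / 31 ^ b / x\<^sup>2"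
proof -
  have x: "x > 0" using assms by simp
  have "\<bar>\<alpha> * ln x + \<beta>\<bar> \<le> \<bar>\<alpha>\<bar> * ln x + \<bar>\<beta>\<bar>"
    using assms abs_triangle_ineq[of "\<alpha> * ln x" \<beta>] by (simp add: abs_mult)
  also have "\<dots> \<le> \<bar>\<alpha>\<bar> * (3/25 * x) + \<bar>\<beta>\<bar> / 31 * x"
  proof (rule add_mono)
    show "\<bar>\<alpha>\<bar> * ln x \<le> \<bar>\<alpha>\<bar> * (3/25 * x)" using ln_le_linear_31[OF assms] by (intro mult_left_mono) auto
    show "\<bar>\<beta>\<bar> \<le> \<bar>\<beta>\<bar> / 31 * x" using mult_left_mono[OF assms, of "\<bar>\<beta>\<bar>"] by simp
  qed
  also have "\<dots> = (3/25 * \<bar>\<alpha>\<bar> + \<bar>\<beta>\<bar> / 31) * x" by (simp add: algebra_simps)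
  finally have "\<bar>\<alpha> * ln x + \<beta>\<bar> / x ^ (b + 3) \<le> (3/25 * \<bar>\<alpha>\<bar> + \<bar>\<beta>\<bar> / 31) * x / x ^ (b + 3)"
    using x by (intro divide_right_mono) auto
  also have "\<dots> = (3/25 * \<bar>\<alpha>\<bar> + \<bar>\<beta>\<bar> / 31) / x ^ b / x\<^sup>2"
    using x by (simp add: power_add power3_eq_cube power2_eq_square)
  also have "\<dots> \<le> (3/25 * \<bar>\<alpha>\<bar> + \<bar>\<beta>\<bar> / 31) / 31 ^ b / x\<^sup>2"
    using assms x by (intro divide_right_mono divide_left_mono power_mono) auto
  finally show ?thesis using x by (simp add: log_pow_def abs_divide)
qed

text \<open>The case \<open>N = 32\<close>: \<open>63/2 = 32 - 1/2\<close> and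
  \<open>14570000 = 470000 * 31\<close>.\<close>

lemma log_pow_series_estimate:
  fixes \<alpha> \<beta> \<alpha>9 \<beta>9 :: real
  assumes a: "a \<ge> 1" and d9: "log_pow_deriv 9 a \<alpha> \<beta> = log_pow (a + 9) \<alpha>9 \<beta>9"
  shows "\<bar>(\<Sum>n. - log_pow (Suc a) (- real a * \<alpha>) (\<alpha> - real a * \<beta>) (real (n + 32)))
      - mid_sum (\<lambda>j. log_pow_deriv j a \<alpha> \<beta>) (63/2)\<bar>
    \<le> (3/25 * \<bar>\<alpha>9\<bar> + \<bar>\<beta>9\<bar> / 31) / 31 ^ (a + 6) / 14570000"
proof -
  have "\<bar>(\<Sum>n. - log_pow_deriv 1 a \<alpha> \<beta> (real (n + 32))) - mid_sum (\<lambda>j. log_pow_deriv j a \<alpha> \<beta>) (real 32 - 1/2)\<bar>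
      \<le> ((3/25 * \<bar>\<alpha>9\<bar> + \<bar>\<beta>9\<bar> / 31) / 31 ^ (a + 6)) / (470000 * (real 32 - 1))"
  proof (rule mid_sum_estimate)
    show "\<bar>log_pow_deriv 9 a \<alpha> \<beta> x\<bar> \<le> (3/25 * \<bar>\<alpha>9\<bar> + \<bar>\<beta>9\<bar> / 31) / 31 ^ (a + 6) / x\<^sup>2" if "real 32 - 1/2 \<le> x" for x
      using log_pow_bound[of x "a + 6" \<alpha>9 \<beta>9] that unfolding d9 by (simp add: add.assoc)
    show "(log_pow_deriv j a \<alpha> \<beta> \<longlongrightarrow> 0) at_top" for j
      using log_pow_deriv_eq[of j a \<alpha> \<beta>] log_pow_tendsto_0[of "a + j"] a by force
    show "(log_pow_deriv j a \<alpha> \<beta> has_real_derivative log_pow_deriv (Suc j) a \<alpha> \<beta> x) (at x)" if "x > 0" for j x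
      using that by (rule has_derivative_log_pow_deriv)
  qed auto
  then show ?thesis by simp
qed

lemma ln_63_2_bounds: "3.449987545831587373 \<le> ln (63/2::real)" "ln (63/2::real) \<le> 3.449987545831587382"
  using ln_divide_pos[of 63 2] ln_mult_pos[of 3 21] ln_mult_pos[of 3 7] ln_2_bounds ln_3_bounds ln_7_bounds by simp_all

text \<open>Lower bounds for \<open>10\<^sup>1\<^sup>8 ln n\<close>.\<close>

definition ln_table :: "nat list" where
  "ln_table = [0, 0, 693147180559945309, 1098612288668109690, 1386294361119890618, 1609437912434100373, 1791759469228054999, 1945910149055313303, 2079441541679835927, 2197224577336219380, 2302585092994045682, 2397895272798370541, 2484906649788000308, 2564949357461536733, 2639057329615258612, 2708050201102210063, 2772588722239781236, 2833213344056216077, 2890371757896164689, 2944438979166440457, 2995732273553990991, 3044522437723422993, 3091042453358315850, 3135494215929149687, 3178053830347945617, 3218875824868200746, 3258096538021482042, 3295836866004329070, 3332204510175203921, 3367295829986474024, 3401197381662155372, 3433987204485146243]"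

lemma ln_table_bounds:
  assumes "n < 32"
  shows "real (ln_table ! n) / 10 ^ 18 \<le> ln (real n)" "ln (real n) \<le> (real (ln_table ! n) + 7) / 10 ^ 18"
proof -
  \<comment> \<open>\<open>ln 0 = 0\<close> here; the entry only aligns the list with its
    index.\<close>
  have c0: "real (ln_table ! 0) / 10 ^ 18 \<le> ln (real 0)" "ln (real 0) \<le> (real (ln_table ! 0) + 7) / 10 ^ 18"
    by (simp_all add: ln_table_def)
  have c1: "real (ln_table ! 1) / 10 ^ 18 \<le> ln (real 1)" "ln (real 1) \<le> (real (ln_table ! 1) + 7) / 10 ^ 18"
    by (simp_all add: ln_table_def)
  have c2: "real (ln_table ! 2) / 10 ^ 18 \<le> ln (real 2)" "ln (real 2) \<le> (real (ln_table ! 2) + 7) / 10 ^ 18"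
    using ln_2_bounds
    by (simp_all add: ln_table_def)
  have c3: "real (ln_table ! 3) / 10 ^ 18 \<le> ln (real 3)" "ln (real 3) \<le> (real (ln_table ! 3) + 7) / 10 ^ 18"
    using ln_3_bounds
    by (simp_all add: ln_table_def)
  have c4: "real (ln_table ! 4) / 10 ^ 18 \<le> ln (real 4)" "ln (real 4) \<le> (real (ln_table ! 4) + 7) / 10 ^ 18"
    using ln_2_bounds ln_mult_pos[of 2 2]
    by (simp_all add: ln_table_def)
  have c5: "real (ln_table ! 5) / 10 ^ 18 \<le> ln (real 5)" "ln (real 5) \<le> (real (ln_table ! 5) + 7) / 10 ^ 18"
    using ln_5_bounds
    by (simp_all add: ln_table_def)
  have c6: "real (ln_table ! 6) / 10 ^ 18 \<le> ln (real 6)" "ln (real 6) \<le> (real (ln_table ! 6) + 7) / 10 ^ 18"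
    using ln_2_bounds ln_3_bounds ln_mult_pos[of 2 3]
    by (simp_all add: ln_table_def)
  have c7: "real (ln_table ! 7) / 10 ^ 18 \<le> ln (real 7)" "ln (real 7) \<le> (real (ln_table ! 7) + 7) / 10 ^ 18"
    using ln_7_bounds
    by (simp_all add: ln_table_def)
  have c8: "real (ln_table ! 8) / 10 ^ 18 \<le> ln (real 8)" "ln (real 8) \<le> (real (ln_table ! 8) + 7) / 10 ^ 18"
    using ln_2_bounds ln_mult_pos[of 2 4] ln_mult_pos[of 2 2]
    by (simp_all add: ln_table_def)
  have c9: "real (ln_table ! 9) / 10 ^ 18 \<le> ln (real 9)" "ln (real 9) \<le> (real (ln_table ! 9) + 7) / 10 ^ 18"
    using ln_3_bounds ln_mult_pos[of 3 3]
    by (simp_all add: ln_table_def)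
  have c10: "real (ln_table ! 10) / 10 ^ 18 \<le> ln (real 10)" "ln (real 10) \<le> (real (ln_table ! 10) + 7) / 10 ^ 18"
    using ln_2_bounds ln_5_bounds ln_mult_pos[of 2 5]
    by (simp_all add: ln_table_def)
  have c11: "real (ln_table ! 11) / 10 ^ 18 \<le> ln (real 11)" "ln (real 11) \<le> (real (ln_table ! 11) + 7) / 10 ^ 18"
    using ln_11_bounds
    by (simp_all add: ln_table_def)
  have c12: "real (ln_table ! 12) / 10 ^ 18 \<le> ln (real 12)" "ln (real 12) \<le> (real (ln_table ! 12) + 7) / 10 ^ 18"
    using ln_2_bounds ln_3_bounds ln_mult_pos[of 2 6] ln_mult_pos[of 2 3]
    by (simp_all add: ln_table_def)
  have c13: "real (ln_table ! 13) / 10 ^ 18 \<le> ln (real 13)" "ln (real 13) \<le> (real (ln_table ! 13) + 7) / 10 ^ 18"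
    using ln_13_bounds
    by (simp_all add: ln_table_def)
  have c14: "real (ln_table ! 14) / 10 ^ 18 \<le> ln (real 14)" "ln (real 14) \<le> (real (ln_table ! 14) + 7) / 10 ^ 18"
    using ln_2_bounds ln_7_bounds ln_mult_pos[of 2 7]
    by (simp_all add: ln_table_def)
  have c15: "real (ln_table ! 15) / 10 ^ 18 \<le> ln (real 15)" "ln (real 15) \<le> (real (ln_table ! 15) + 7) / 10 ^ 18"
    using ln_3_bounds ln_5_bounds ln_mult_pos[of 3 5]
    by (simp_all add: ln_table_def)
  have c16: "real (ln_table ! 16) / 10 ^ 18 \<le> ln (real 16)" "ln (real 16) \<le> (real (ln_table ! 16) + 7) / 10 ^ 18"
    using ln_2_bounds ln_mult_pos[of 2 8] ln_mult_pos[of 2 4] ln_mult_pos[of 2 2]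
    by (simp_all add: ln_table_def)
  have c17: "real (ln_table ! 17) / 10 ^ 18 \<le> ln (real 17)" "ln (real 17) \<le> (real (ln_table ! 17) + 7) / 10 ^ 18"
    using ln_17_bounds
    by (simp_all add: ln_table_def)
  have c18: "real (ln_table ! 18) / 10 ^ 18 \<le> ln (real 18)" "ln (real 18) \<le> (real (ln_table ! 18) + 7) / 10 ^ 18"
    using ln_2_bounds ln_3_bounds ln_mult_pos[of 2 9] ln_mult_pos[of 3 3]
    by (simp_all add: ln_table_def)
  have c19: "real (ln_table ! 19) / 10 ^ 18 \<le> ln (real 19)" "ln (real 19) \<le> (real (ln_table ! 19) + 7) / 10 ^ 18"
    using ln_19_bounds
    by (simp_all add: ln_table_def)
  have c20: "real (ln_table ! 20) / 10 ^ 18 \<le> ln (real 20)" "ln (real 20) \<le> (real (ln_table ! 20) + 7) / 10 ^ 18"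
    using ln_2_bounds ln_5_bounds ln_mult_pos[of 2 10] ln_mult_pos[of 2 5]
    by (simp_all add: ln_table_def)
  have c21: "real (ln_table ! 21) / 10 ^ 18 \<le> ln (real 21)" "ln (real 21) \<le> (real (ln_table ! 21) + 7) / 10 ^ 18"
    using ln_3_bounds ln_7_bounds ln_mult_pos[of 3 7]
    by (simp_all add: ln_table_def)
  have c22: "real (ln_table ! 22) / 10 ^ 18 \<le> ln (real 22)" "ln (real 22) \<le> (real (ln_table ! 22) + 7) / 10 ^ 18"
    using ln_2_bounds ln_11_bounds ln_mult_pos[of 2 11]
    by (simp_all add: ln_table_def)
  have c23: "real (ln_table ! 23) / 10 ^ 18 \<le> ln (real 23)" "ln (real 23) \<le> (real (ln_table ! 23) + 7) / 10 ^ 18"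
    using ln_23_bounds
    by (simp_all add: ln_table_def)
  have c24: "real (ln_table ! 24) / 10 ^ 18 \<le> ln (real 24)" "ln (real 24) \<le> (real (ln_table ! 24) + 7) / 10 ^ 18"
    using ln_2_bounds ln_3_bounds ln_mult_pos[of 2 12] ln_mult_pos[of 2 6] ln_mult_pos[of 2 3]
    by (simp_all add: ln_table_def)
  have c25: "real (ln_table ! 25) / 10 ^ 18 \<le> ln (real 25)" "ln (real 25) \<le> (real (ln_table ! 25) + 7) / 10 ^ 18"
    using ln_5_bounds ln_mult_pos[of 5 5]
    by (simp_all add: ln_table_def)
  have c26: "real (ln_table ! 26) / 10 ^ 18 \<le> ln (real 26)" "ln (real 26) \<le> (real (ln_table ! 26) + 7) / 10 ^ 18"
    using ln_2_bounds ln_13_bounds ln_mult_pos[of 2 13]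
    by (simp_all add: ln_table_def)
  have c27: "real (ln_table ! 27) / 10 ^ 18 \<le> ln (real 27)" "ln (real 27) \<le> (real (ln_table ! 27) + 7) / 10 ^ 18"
    using ln_3_bounds ln_mult_pos[of 3 9] ln_mult_pos[of 3 3]
    by (simp_all add: ln_table_def)
  have c28: "real (ln_table ! 28) / 10 ^ 18 \<le> ln (real 28)" "ln (real 28) \<le> (real (ln_table ! 28) + 7) / 10 ^ 18"
    using ln_2_bounds ln_7_bounds ln_mult_pos[of 2 14] ln_mult_pos[of 2 7]
    by (simp_all add: ln_table_def)
  have c29: "real (ln_table ! 29) / 10 ^ 18 \<le> ln (real 29)" "ln (real 29) \<le> (real (ln_table ! 29) + 7) / 10 ^ 18"
    using ln_29_bounds
    by (simp_all add: ln_table_def)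
  have c30: "real (ln_table ! 30) / 10 ^ 18 \<le> ln (real 30)" "ln (real 30) \<le> (real (ln_table ! 30) + 7) / 10 ^ 18"
    using ln_2_bounds ln_3_bounds ln_5_bounds ln_mult_pos[of 2 15] ln_mult_pos[of 3 5]
    by (simp_all add: ln_table_def)
  have c31: "real (ln_table ! 31) / 10 ^ 18 \<le> ln (real 31)" "ln (real 31) \<le> (real (ln_table ! 31) + 7) / 10 ^ 18"
    using ln_31_bounds
    by (simp_all add: ln_table_def)
  have "n = 0 \<or> n = 1 \<or> n = 2 \<or> n = 3 \<or> n = 4 \<or> n = 5 \<or> n = 6 \<or> n = 7 \<or> n = 8 \<or> n = 9 \<or> n = 10 \<or> n = 11 \<or> n = 12 \<or> n = 13 \<or> n = 14 \<or> n = 15 \<or> n = 16 \<or> n = 17 \<or> n = 18 \<or> n = 19 \<or> n = 20 \<or> n = 21 \<or> n = 22 \<or> n = 23 \<or> n = 24 \<or> n = 25 \<or> n = 26 \<or> n = 27 \<or> n = 28 \<or> n = 29 \<or> n = 30 \<or> n = 31"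
    using assms by presburger
  then show "real (ln_table ! n) / 10 ^ 18 \<le> ln (real n)" "ln (real n) \<le> (real (ln_table ! n) + 7) / 10 ^ 18"
    by (elim disjE; simp only: c0 c1 c2 c3 c4 c5 c6 c7 c8 c9 c10 c11 c12 c13 c14 c15 c16 c17 c18 c19 c20 c21 c22 c23 c24 c25 c26 c27 c28 c29 c30 c31)+
qed

section \<open>Enclosures of \<open>\<zeta>\<close> and its derivative at 2, 3, 5, 6 and 7\<close>

lemma enclosure:
  fixes T M e Ml Mh Hl Hd Hh Z lo hi :: real
  assumes "\<bar>T - M\<bar> \<le> e" "Ml \<le> M" "M \<le> Mh" "Hl \<le> Hd" "Hd \<le> Hh" "Z = T + Hd"
    "lo \<le> Hl + Ml - e" "Hh + Mh + e \<le> hi"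
  shows "lo \<le> Z" "Z \<le> hi"
  using assms by linarith+

lemma sum_ln_table_bounds:
  "(\<Sum>n<32. real (ln_table ! n) / 10 ^ 18 / real n ^ k) \<le> (\<Sum>n<32. ln (real n) / real n ^ k)"
  "(\<Sum>n<32. ln (real n) / real n ^ k) \<le> (\<Sum>n<32. (real (ln_table ! n) + 7) / 10 ^ 18 / real n ^ k)"
  by (intro sum_mono divide_right_mono ln_table_bounds; simp)+

text \<open>In this and the following bounds the terms below \<open>n = 32\<close> are summed from
  the table. The tail uses the primitive of \<open>- ln x / x ^ k\<close> with parameters
  \<open>k - 1\<close>, \<open>1 / (k - 1)\<close> and \<open>1 / (k - 1)^2\<close>, and for
  \<open>zeta_sum\<close> that of \<open>- 1 / x ^ k\<close>, with \<open>0\<close> and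
  \<open>1 / (k - 1)\<close>.\<close>

lemma log_zeta_sum_2_bounds: "0.93754825431567983 \<le> log_zeta_sum 2" "log_zeta_sum 2 \<le> 0.93754825431600394"
proof -
  have "log_pow_deriv 9 1 (1) (1) = log_pow (1 + 9) (- 362880) (663696)"
    by (simp add: numeral_eq_Suc)
  from log_pow_series_estimate[OF _ this]
  have tail: "\<bar>(\<Sum>n. ln (real (n + 32)) / real (n + 32) ^ 2) - mid_sum (\<lambda>j. log_pow_deriv j 1 (1) (1)) (63/2)\<bar> \<le> 0.00000000000016204"
    by (simp add: log_pow_def power2_eq_square)
  have "mid_sum (\<lambda>j. log_pow_deriv j 1 (1) (1)) (63/2) = 13128833145272/413592967112535 * ln (63/2) + 13130486396599/413592967112535"
    by (simp add: mid_sum_def log_pow_def numeral_eq_Suc add_divide_distrib diff_divide_distrib)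
  then have mid: "0.14126158296882131 \<le> mid_sum (\<lambda>j. log_pow_deriv j 1 (1) (1)) (63/2)"
    "mid_sum (\<lambda>j. log_pow_deriv j 1 (1) (1)) (63/2) \<le> 0.14126158296882132"
    using ln_63_2_bounds by simp_all
  have "0.79628667134702056 \<le> (\<Sum>n<32. real (ln_table ! n) / 10 ^ 18 / real n ^ 2)"
    by (simp add: ln_table_def lessThan_nat_numeral)
  moreover have "(\<Sum>n<32. (real (ln_table ! n) + 7) / 10 ^ 18 / real n ^ 2) \<le> 0.79628667134702058"
    by (simp add: ln_table_def lessThan_nat_numeral)
  ultimately have head: "0.79628667134702056 \<le> (\<Sum>n<32. ln (real n) / real n ^ 2)" "(\<Sum>n<32. ln (real n) / real n ^ 2) \<le> 0.79628667134702058"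
    using sum_ln_table_bounds[of 2] by linarith+
  have split: "log_zeta_sum 2 = (\<Sum>n. ln (real (n + 32)) / real (n + 32) ^ 2) + (\<Sum>n<32. ln (real n) / real n ^ 2)"
    unfolding log_zeta_sum_def by (rule suminf_split_initial_segment) (simp add: summable_ln_over_power)
  show "0.93754825431567983 \<le> log_zeta_sum 2" "log_zeta_sum 2 \<le> 0.93754825431600394"
    using enclosure[OF tail mid head split, of "0.93754825431567983" "0.93754825431600394"] by simp_all
qed

lemma zeta_sum_2_bounds: "1.64493406684819613 \<le> zeta_sum 2" "zeta_sum 2 \<le> 1.64493406684825457"
proof -
  have "log_pow_deriv 9 1 0 (1) = log_pow (1 + 9) 0 (- 362880)"
    by (simp add: numeral_eq_Suc)
  from log_pow_series_estimate[OF _ this]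
  have tail: "\<bar>(\<Sum>n. 1 / real (n + 32) ^ 2) - mid_sum (\<lambda>j. log_pow_deriv j 1 0 (1)) (63/2)\<bar> \<le> 0.00000000000002921"
    by (simp add: log_pow_def power2_eq_square)
  have mid: "mid_sum (\<lambda>j. log_pow_deriv j 1 0 (1)) (63/2) = 13128833145272/413592967112535"
    by (simp add: mid_sum_def log_pow_def numeral_eq_Suc)
  have head: "1.61319070032792434 \<le> (\<Sum>n<32. 1 / real n ^ 2)" "(\<Sum>n<32. 1 / real n ^ 2) \<le> 1.61319070032792435"
    by (simp_all add: lessThan_nat_numeral)
  have split: "zeta_sum 2 = (\<Sum>n. 1 / real (n + 32) ^ 2) + (\<Sum>n<32. 1 / real n ^ 2)"
    unfolding zeta_sum_def by (rule suminf_split_initial_segment) (simp add: summable_inverse_power)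
  show "1.64493406684819613 \<le> zeta_sum 2" "zeta_sum 2 \<le> 1.64493406684825457"
    using enclosure[OF tail eq_refl[OF mid[symmetric]] eq_refl[OF mid] head split, of "1.64493406684819613" "1.64493406684825457"] by simp_all
qed

lemma log_zeta_sum_3_bounds: "0.19812624288561226 \<le> log_zeta_sum 3" "log_zeta_sum 3 \<le> 0.19812624288566081"
proof -
  have "log_pow_deriv 9 2 (1/2) (1/4) = log_pow (2 + 9) (- 1814400) (2592720)"
    by (simp add: numeral_eq_Suc)
  from log_pow_series_estimate[OF _ this]
  have tail: "\<bar>(\<Sum>n. ln (real (n + 32)) / real (n + 32) ^ 3) - mid_sum (\<lambda>j. log_pow_deriv j 2 (1/2) (1/4)) (63/2)\<bar> \<le> 0.00000000000002426"
    by (simp add: log_pow_def power2_eq_square)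
  have "mid_sum (\<lambda>j. log_pow_deriv j 2 (1/2) (1/4)) (63/2) = 375046550992/744467340802563 * ln (63/2) + 729563213128/2895150769787745"
    by (simp add: mid_sum_def log_pow_def numeral_eq_Suc add_divide_distrib diff_divide_distrib)
  then have mid: "0.00199002403184326 \<le> mid_sum (\<lambda>j. log_pow_deriv j 2 (1/2) (1/4)) (63/2)"
    "mid_sum (\<lambda>j. log_pow_deriv j 2 (1/2) (1/4)) (63/2) \<le> 0.00199002403184327"
    using ln_63_2_bounds by simp_all
  have "0.19613621885379326 \<le> (\<Sum>n<32. real (ln_table ! n) / 10 ^ 18 / real n ^ 3)"
    by (simp add: ln_table_def lessThan_nat_numeral)
  moreover have "(\<Sum>n<32. (real (ln_table ! n) + 7) / 10 ^ 18 / real n ^ 3) \<le> 0.19613621885379328"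
    by (simp add: ln_table_def lessThan_nat_numeral)
  ultimately have head: "0.19613621885379326 \<le> (\<Sum>n<32. ln (real n) / real n ^ 3)" "(\<Sum>n<32. ln (real n) / real n ^ 3) \<le> 0.19613621885379328"
    using sum_ln_table_bounds[of 3] by linarith+
  have split: "log_zeta_sum 3 = (\<Sum>n. ln (real (n + 32)) / real (n + 32) ^ 3) + (\<Sum>n<32. ln (real n) / real n ^ 3)"
    unfolding log_zeta_sum_def by (rule suminf_split_initial_segment) (simp add: summable_ln_over_power)
  show "0.19812624288561226 \<le> log_zeta_sum 3" "log_zeta_sum 3 \<le> 0.19812624288566081"
    using enclosure[OF tail mid head split, of "0.19812624288561226" "0.19812624288566081"] by simp_all
qed

lemma zeta_sum_3_bounds: "1.20205690315958942 \<le> zeta_sum 3" "zeta_sum 3 \<le> 1.20205690315959886"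
proof -
  have "log_pow_deriv 9 2 0 (1/2) = log_pow (2 + 9) 0 (- 1814400)"
    by (simp add: numeral_eq_Suc)
  from log_pow_series_estimate[OF _ this]
  have tail: "\<bar>(\<Sum>n. 1 / real (n + 32) ^ 3) - mid_sum (\<lambda>j. log_pow_deriv j 2 0 (1/2)) (63/2)\<bar> \<le> 0.00000000000000471"
    by (simp add: log_pow_def power2_eq_square)
  have mid: "mid_sum (\<lambda>j. log_pow_deriv j 2 0 (1/2)) (63/2) = 375046550992/744467340802563"
    by (simp add: mid_sum_def log_pow_def numeral_eq_Suc)
  have head: "1.20155312477948724 \<le> (\<Sum>n<32. 1 / real n ^ 3)" "(\<Sum>n<32. 1 / real n ^ 3) \<le> 1.20155312477948725"
    by (simp_all add: lessThan_nat_numeral)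
  have split: "zeta_sum 3 = (\<Sum>n. 1 / real (n + 32) ^ 3) + (\<Sum>n<32. 1 / real n ^ 3)"
    unfolding zeta_sum_def by (rule suminf_split_initial_segment) (simp add: summable_inverse_power)
  show "1.20205690315958942 \<le> zeta_sum 3" "zeta_sum 3 \<le> 1.20205690315959886"
    using enclosure[OF tail eq_refl[OF mid[symmetric]] eq_refl[OF mid] head split, of "1.20205690315958942" "1.20205690315959886"] by simp_all
qed

lemma log_zeta_sum_5_bounds: "0.02857378050946268 \<le> log_zeta_sum 5" "log_zeta_sum 5 \<le> 0.02857378050946322"
proof -
  have "log_pow_deriv 9 4 (1/4) (1/16) = log_pow (4 + 9) (- 19958400) (20355120)"
    by (simp add: numeral_eq_Suc)
  from log_pow_series_estimate[OF _ this]
  have tail: "\<bar>(\<Sum>n. ln (real (n + 32)) / real (n + 32) ^ 5) - mid_sum (\<lambda>j. log_pow_deriv j 4 (1/4) (1/16)) (63/2)\<bar> \<le> 0.00000000000000026"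
    by (simp add: log_pow_def power2_eq_square)
  have "mid_sum (\<lambda>j. log_pow_deriv j 4 (1/4) (1/16)) (63/2) = 249884228168/984930291881790849 * ln (63/2) + 19708094180639/310253041942764117435"
    by (simp add: mid_sum_def log_pow_def numeral_eq_Suc add_divide_distrib diff_divide_distrib)
  then have mid: "0.00000093881045293 \<le> mid_sum (\<lambda>j. log_pow_deriv j 4 (1/4) (1/16)) (63/2)"
    "mid_sum (\<lambda>j. log_pow_deriv j 4 (1/4) (1/16)) (63/2) \<le> 0.00000093881045294"
    using ln_63_2_bounds by simp_all
  have "0.02857284169901001 \<le> (\<Sum>n<32. real (ln_table ! n) / 10 ^ 18 / real n ^ 5)"
    by (simp add: ln_table_def lessThan_nat_numeral)
  moreover have "(\<Sum>n<32. (real (ln_table ! n) + 7) / 10 ^ 18 / real n ^ 5) \<le> 0.02857284169901002"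
    by (simp add: ln_table_def lessThan_nat_numeral)
  ultimately have head: "0.02857284169901001 \<le> (\<Sum>n<32. ln (real n) / real n ^ 5)" "(\<Sum>n<32. ln (real n) / real n ^ 5) \<le> 0.02857284169901002"
    using sum_ln_table_bounds[of 5] by linarith+
  have split: "log_zeta_sum 5 = (\<Sum>n. ln (real (n + 32)) / real (n + 32) ^ 5) + (\<Sum>n<32. ln (real n) / real n ^ 5)"
    unfolding log_zeta_sum_def by (rule suminf_split_initial_segment) (simp add: summable_ln_over_power)
  show "0.02857378050946268 \<le> log_zeta_sum 5" "log_zeta_sum 5 \<le> 0.02857378050946322"
    using enclosure[OF tail mid head split, of "0.02857378050946268" "0.02857378050946322"] by simp_all
qed

lemma zeta_sum_5_bounds: "1.03692775514336986 \<le> zeta_sum 5" "zeta_sum 5 \<le> 1.03692775514337000"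
proof -
  have "log_pow_deriv 9 4 0 (1/4) = log_pow (4 + 9) 0 (- 19958400)"
    by (simp add: numeral_eq_Suc)
  from log_pow_series_estimate[OF _ this]
  have tail: "\<bar>(\<Sum>n. 1 / real (n + 32) ^ 5) - mid_sum (\<lambda>j. log_pow_deriv j 4 0 (1/4)) (63/2)\<bar> \<le> 0.00000000000000006"
    by (simp add: log_pow_def power2_eq_square)
  have mid: "mid_sum (\<lambda>j. log_pow_deriv j 4 0 (1/4)) (63/2) = 249884228168/984930291881790849"
    by (simp add: mid_sum_def log_pow_def numeral_eq_Suc)
  have head: "1.03692750143584338 \<le> (\<Sum>n<32. 1 / real n ^ 5)" "(\<Sum>n<32. 1 / real n ^ 5) \<le> 1.03692750143584339"
    by (simp_all add: lessThan_nat_numeral)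
  have split: "zeta_sum 5 = (\<Sum>n. 1 / real (n + 32) ^ 5) + (\<Sum>n<32. 1 / real n ^ 5)"
    unfolding zeta_sum_def by (rule suminf_split_initial_segment) (simp add: summable_inverse_power)
  show "1.03692775514336986 \<le> zeta_sum 5" "zeta_sum 5 \<le> 1.03692775514337000"
    using enclosure[OF tail eq_refl[OF mid[symmetric]] eq_refl[OF mid] head split, of "1.03692775514336986" "1.03692775514337000"] by simp_all
qed

lemma log_zeta_sum_6_bounds: "0.01285216513179569 \<le> log_zeta_sum 6" "log_zeta_sum 6 \<le> 0.01285216513179577"
proof -
  have "log_pow_deriv 9 5 (1/5) (1/25) = log_pow (5 + 9) (- 51891840) (46536624)"
    by (simp add: numeral_eq_Suc)
  from log_pow_series_estimate[OF _ this]
  have tail: "\<bar>(\<Sum>n. ln (real (n + 32)) / real (n + 32) ^ 6) - mid_sum (\<lambda>j. log_pow_deriv j 5 (1/5) (1/25)) (63/2)\<bar> \<le> 0.00000000000000003"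
    by (simp add: log_pow_def power2_eq_square)
  have "mid_sum (\<lambda>j. log_pow_deriv j 5 (1/5) (1/25)) (63/2) = 1998235735936/310253041942764117435 * ln (63/2) + 126179139458704/97729708211970696992025"
    by (simp add: mid_sum_def log_pow_def numeral_eq_Suc add_divide_distrib diff_divide_distrib)
  then have mid: "0.00000002351131532 \<le> mid_sum (\<lambda>j. log_pow_deriv j 5 (1/5) (1/25)) (63/2)"
    "mid_sum (\<lambda>j. log_pow_deriv j 5 (1/5) (1/25)) (63/2) \<le> 0.00000002351131533"
    using ln_63_2_bounds by simp_all
  have "0.01285214162048040 \<le> (\<Sum>n<32. real (ln_table ! n) / 10 ^ 18 / real n ^ 6)"
    by (simp add: ln_table_def lessThan_nat_numeral)
  moreover have "(\<Sum>n<32. (real (ln_table ! n) + 7) / 10 ^ 18 / real n ^ 6) \<le> 0.01285214162048041"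
    by (simp add: ln_table_def lessThan_nat_numeral)
  ultimately have head: "0.01285214162048040 \<le> (\<Sum>n<32. ln (real n) / real n ^ 6)" "(\<Sum>n<32. ln (real n) / real n ^ 6) \<le> 0.01285214162048041"
    using sum_ln_table_bounds[of 6] by linarith+
  have split: "log_zeta_sum 6 = (\<Sum>n. ln (real (n + 32)) / real (n + 32) ^ 6) + (\<Sum>n<32. ln (real n) / real n ^ 6)"
    unfolding log_zeta_sum_def by (rule suminf_split_initial_segment) (simp add: summable_ln_over_power)
  show "0.01285216513179569 \<le> log_zeta_sum 6" "log_zeta_sum 6 \<le> 0.01285216513179577"
    using enclosure[OF tail mid head split, of "0.01285216513179569" "0.01285216513179577"] by simp_all
qed

lemma zeta_sum_6_bounds: "1.01734306198444912 \<le> zeta_sum 6" "zeta_sum 6 \<le> 1.01734306198444916"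
proof -
  have "log_pow_deriv 9 5 0 (1/5) = log_pow (5 + 9) 0 (- 51891840)"
    by (simp add: numeral_eq_Suc)
  from log_pow_series_estimate[OF _ this]
  have tail: "\<bar>(\<Sum>n. 1 / real (n + 32) ^ 6) - mid_sum (\<lambda>j. log_pow_deriv j 5 0 (1/5)) (63/2)\<bar> \<le> 0.00000000000000001"
    by (simp add: log_pow_def power2_eq_square)
  have mid: "mid_sum (\<lambda>j. log_pow_deriv j 5 0 (1/5)) (63/2) = 1998235735936/310253041942764117435"
    by (simp add: mid_sum_def log_pow_def numeral_eq_Suc)
  have head: "1.01734305554378469 \<le> (\<Sum>n<32. 1 / real n ^ 6)" "(\<Sum>n<32. 1 / real n ^ 6) \<le> 1.01734305554378470"
    by (simp_all add: lessThan_nat_numeral)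
  have split: "zeta_sum 6 = (\<Sum>n. 1 / real (n + 32) ^ 6) + (\<Sum>n<32. 1 / real n ^ 6)"
    unfolding zeta_sum_def by (rule suminf_split_initial_segment) (simp add: summable_inverse_power)
  show "1.01734306198444912 \<le> zeta_sum 6" "zeta_sum 6 \<le> 1.01734306198444916"
    using enclosure[OF tail eq_refl[OF mid[symmetric]] eq_refl[OF mid] head split, of "1.01734306198444912" "1.01734306198444916"] by simp_all
qed

lemma log_zeta_sum_7_bounds: "0.00603351696087562 \<le> log_zeta_sum 7" "log_zeta_sum 7 \<le> 0.00603351696087567"
proof -
  have "log_pow_deriv 9 6 (1/6) (1/36) = log_pow (6 + 9) (- 121080960) (97053936)"
    by (simp add: numeral_eq_Suc)
  from log_pow_series_estimate[OF _ this]
  have tail: "\<bar>(\<Sum>n. ln (real (n + 32)) / real (n + 32) ^ 7) - mid_sum (\<lambda>j. log_pow_deriv j 6 (1/6) (1/36)) (63/2)\<bar> \<le> 0.00000000000000001"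
    by (simp add: log_pow_def power2_eq_square)
  have "mid_sum (\<lambda>j. log_pow_deriv j 6 (1/6) (1/36)) (63/2) = 9986154268352/58637824927182418195215 * ln (63/2) + 105197385974752/3694182970412492346298545"
    by (simp add: mid_sum_def log_pow_def numeral_eq_Suc add_divide_distrib diff_divide_distrib)
  then have mid: "0.00000000061601718 \<le> mid_sum (\<lambda>j. log_pow_deriv j 6 (1/6) (1/36)) (63/2)"
    "mid_sum (\<lambda>j. log_pow_deriv j 6 (1/6) (1/36)) (63/2) \<le> 0.00000000061601719"
    using ln_63_2_bounds by simp_all
  have "0.00603351634485845 \<le> (\<Sum>n<32. real (ln_table ! n) / 10 ^ 18 / real n ^ 7)"
    by (simp add: ln_table_def lessThan_nat_numeral)
  moreover have "(\<Sum>n<32. (real (ln_table ! n) + 7) / 10 ^ 18 / real n ^ 7) \<le> 0.00603351634485847"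
    by (simp add: ln_table_def lessThan_nat_numeral)
  ultimately have head: "0.00603351634485845 \<le> (\<Sum>n<32. ln (real n) / real n ^ 7)" "(\<Sum>n<32. ln (real n) / real n ^ 7) \<le> 0.00603351634485847"
    using sum_ln_table_bounds[of 7] by linarith+
  have split: "log_zeta_sum 7 = (\<Sum>n. ln (real (n + 32)) / real (n + 32) ^ 7) + (\<Sum>n<32. ln (real n) / real n ^ 7)"
    unfolding log_zeta_sum_def by (rule suminf_split_initial_segment) (simp add: summable_ln_over_power)
  show "0.00603351696087562 \<le> log_zeta_sum 7" "log_zeta_sum 7 \<le> 0.00603351696087567"
    using enclosure[OF tail mid head split, of "0.00603351696087562" "0.00603351696087567"] by simp_all
qed

lemma zeta_sum_7_bounds: "1.00834927738192281 \<le> zeta_sum 7" "zeta_sum 7 \<le> 1.00834927738192285"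
proof -
  have "log_pow_deriv 9 6 0 (1/6) = log_pow (6 + 9) 0 (- 121080960)"
    by (simp add: numeral_eq_Suc)
  from log_pow_series_estimate[OF _ this]
  have tail: "\<bar>(\<Sum>n. 1 / real (n + 32) ^ 7) - mid_sum (\<lambda>j. log_pow_deriv j 6 0 (1/6)) (63/2)\<bar> \<le> 0.00000000000000001"
    by (simp add: log_pow_def power2_eq_square)
  have mid: "mid_sum (\<lambda>j. log_pow_deriv j 6 0 (1/6)) (63/2) = 9986154268352/58637824927182418195215"
    by (simp add: mid_sum_def log_pow_def numeral_eq_Suc)
  have head: "1.00834927721162056 \<le> (\<Sum>n<32. 1 / real n ^ 7)" "(\<Sum>n<32. 1 / real n ^ 7) \<le> 1.00834927721162057"
    by (simp_all add: lessThan_nat_numeral)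
  have split: "zeta_sum 7 = (\<Sum>n. 1 / real (n + 32) ^ 7) + (\<Sum>n<32. 1 / real n ^ 7)"
    unfolding zeta_sum_def by (rule suminf_split_initial_segment) (simp add: summable_inverse_power)
  show "1.00834927738192281 \<le> zeta_sum 7" "zeta_sum 7 \<le> 1.00834927738192285"
    using enclosure[OF tail eq_refl[OF mid[symmetric]] eq_refl[OF mid] head split, of "1.00834927738192281" "1.00834927738192285"] by simp_all
qed

section \<open>The series for \<open>\<kappa>\<close> and its accelerated tail\<close>

definition prime_term :: "nat \<Rightarrow> real" where
  "prime_term n = (if prime n then ln (real n) / (real n * (real n - 1)) else 0)"

lemma kappa_eq: "kappa = suminf prime_term"
  by (simp add: kappa_def prime_term_def[abs_def])

lemma prime_term_nonneg: "prime_term n \<ge> 0"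
  by (auto simp: prime_term_def dest: prime_gt_1_nat)

lemma summable_prime_term: "summable prime_term"
proof (rule summable_comparison_test')
  show "summable (\<lambda>n. 2 * (ln (real n) / real n ^ 2))"
    by (intro summable_mult summable_ln_over_power) simp
  fix n :: nat assume "n \<ge> 0"
  show "norm (prime_term n) \<le> 2 * (ln (real n) / real n ^ 2)"
  proof (cases "prime n")
    case True
    then have n: "real n \<ge> 2" using prime_ge_2_nat[of n] by simp
    have "ln (real n) / (real n * (real n - 1)) \<le> ln (real n) / (real n ^ 2 / 2)"
    proof (rule divide_left_mono)
      have "real n * (real n / 2) \<le> real n * (real n - 1)" using n by (intro mult_left_mono) auto
      then show "real n ^ 2 / 2 \<le> real n * (real n - 1)" by (simp add: power2_eq_square)
    qed (use n in auto)
    then show ?thesis using True n by (simp add: prime_term_def mult.commute)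
  next
    case False
    then show ?thesis by (cases n) (auto simp: prime_term_def)
  qed
qed

text \<open>Since \<open>(m + 1) / p - 1 \<le> m / p\<close>, the bound is valid for every
  \<open>m\<close> and not only in the limit, so the digits of \<open>kappa\<close> supply
  \<open>Kup\<close>.\<close>

lemma gain_rate_le_kappa: "gain_rate m \<le> real m * kappa"
proof -
  have "gain_rate m \<le> (\<Sum>p\<in>extra_primes m. real m * prime_term p)"
    unfolding gain_rate_def
  proof (rule sum_mono)
    fix p assume "p \<in> extra_primes m"
    then have p: "prime p" "2 * real p \<le> real m + 1" by (auto simp: extra_primes_def)
    then have p2: "real p \<ge> 2" using prime_ge_2_nat[of p] by simp
    have "p * (Suc m div p) \<le> Suc m" by simp
    then have "real (p * (Suc m div p)) \<le> real (Suc m)" by (simp only: of_nat_le_iff)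
    then have "real p * real (Suc m div p) \<le> real m + 1" by simp
    moreover have "Suc m div p \<ge> 1"
    proof -
      have "real p \<le> real (Suc m)" using p p2 by simp
      then have "p \<le> Suc m" by (simp only: of_nat_le_iff)
      then show ?thesis using p prime_gt_0_nat[of p] by (simp add: Suc_leI div_greater_zero_iff)
    qed
    ultimately have "real p * real (Suc m div p - 1) \<le> real m" using p2 by (simp add: of_nat_diff algebra_simps)
    then have "real (Suc m div p - 1) \<le> real m / real p" using p2 by (simp add: field_simps)
    then have "real (Suc m div p - 1) * (ln (real p) / (real p - 1)) \<le> real m / real p * (ln (real p) / (real p - 1))"
      using p2 by (intro mult_right_mono) auto
    then show "real (Suc m div p - 1) * (ln (real p) / (real p - 1)) \<le> real m * prime_term p"
      using p by (simp add: prime_term_def)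
  qed
  also have "\<dots> = real m * (\<Sum>p\<in>extra_primes m. prime_term p)" by (simp add: sum_distrib_left)
  also have "\<dots> \<le> real m * kappa"
    unfolding kappa_eq
    by (intro mult_left_mono sum_le_suminf summable_prime_term finite_extra_primes) (auto simp: prime_term_nonneg)
  finally show ?thesis .
qed

text \<open>Exponents and signs are those of \<open>x\<^sup>2 / (1 - x) = - (\<Sum>k\<ge>2. \<mu>(k) x ^ k / (1 - x ^ k))\<close>,
  truncated before \<open>k = 10\<close>.\<close>

definition tail_coeff :: "real \<Rightarrow> real" where
  "tail_coeff n = 1 / (n * (n - 1)) - 1 / (n ^ 2 - 1) - 1 / (n ^ 3 - 1) - 1 / (n ^ 5 - 1) + 1 / (n ^ 6 - 1) - 1 / (n ^ 7 - 1)"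

text \<open>With \<open>x = 1 / n\<close>, the terms for 2 and 3 cancel all orders below
  \<open>x^5\<close> and leave \<open>x^5 * y\<close> with \<open>y = 1 - x + x^2 + ...\<close>;
  those for 5, 6 and 7 cancel these three coefficients and thereby five more orders. What remains is
  close to \<open>- x^10\<close>, the first omitted term.\<close>

lemma tail_coeff_bounds:
  assumes n: "n \<ge> (29::real)"
  shows "- (6/5) / n ^ 10 \<le> tail_coeff n" "tail_coeff n \<le> 0"
proof -
  define x where "x = 1 / n"
  have x: "0 < x" "x \<le> 1/29" using n by (auto simp: x_def field_simps)
  have pk: "x ^ k \<le> 1/29" if "k \<ge> 1" for k
  proof -
    have "x ^ k \<le> x ^ 1" using x that by (intro power_decreasing) auto
    then show ?thesis using x by simp
  qed
  have conv: "1 / (n ^ k - 1) = x ^ k / (1 - x ^ k)" if "k \<ge> 1" for k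
  proof -
    have "n ^ k > 1" using n that by (intro one_less_power) auto
    moreover have "n ^ k \<noteq> 0" using n by simp
    ultimately show ?thesis by (simp add: x_def power_divide divide_simps)
  qed
  have 0: "1 / (n * (n - 1)) = x ^ 2 / (1 - x)"
    using n by (simp add: x_def field_simps power2_eq_square)
  define y where "y = 1 / ((1 + x) * (1 - x ^ 3))"
  have nz: "1 - x \<noteq> 0" "1 + x \<noteq> 0" "1 - x ^ 2 \<noteq> 0" "1 - x ^ 3 \<noteq> 0"
    using x pk[of 2] pk[of 3] by auto
  have f2: "1 - x ^ 2 = (1 - x) * (1 + x)" by (simp add: power2_eq_square algebra_simps)
  have A: "x ^ 2 / (1 - x) - x ^ 2 / (1 - x ^ 2) - x ^ 3 / (1 - x ^ 3) = x ^ 5 * y"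
  proof -
    have "x ^ 2 / (1 - x) = (x ^ 2 * (1 + x)) / ((1 - x) * (1 + x))" using nz by simp
    then have "x ^ 2 / (1 - x) - x ^ 2 / (1 - x ^ 2) = (x ^ 2 * (1 + x) - x ^ 2) / (1 - x ^ 2)"
      unfolding f2 by (simp only: diff_divide_distrib)
    also have "x ^ 2 * (1 + x) - x ^ 2 = x ^ 3" by (simp add: algebra_simps power2_eq_square power3_eq_cube)
    finally have "x ^ 2 / (1 - x) - x ^ 2 / (1 - x ^ 2) = x ^ 3 / (1 - x ^ 2)" .
    moreover have "x ^ 3 / (1 - x ^ 2) - x ^ 3 / (1 - x ^ 3) = ((1 - x) * x ^ 5) / ((1 - x ^ 2) * (1 - x ^ 3))"
    proof (subst diff_frac_eq)
      have "x ^ 3 * (1 - x ^ 3) - x ^ 3 * (1 - x ^ 2) = (1 - x) * x ^ 5"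
        by (simp add: algebra_simps numeral_eq_Suc)
      then show "(x ^ 3 * (1 - x ^ 3) - x ^ 3 * (1 - x ^ 2)) / ((1 - x ^ 2) * (1 - x ^ 3))
          = ((1 - x) * x ^ 5) / ((1 - x ^ 2) * (1 - x ^ 3))" by simp
    qed (use nz in simp_all)
    moreover have "((1 - x) * x ^ 5) / ((1 - x ^ 2) * (1 - x ^ 3)) = x ^ 5 * y"
      unfolding f2 y_def mult.assoc using nz by (subst mult_divide_mult_cancel_left) simp_all
    ultimately show ?thesis by simp
  qed
  have y: "y = 1 - x + x ^ 2 + x ^ 6 * y"
  proof -
    define d where "d = (1 + x) * (1 - x ^ 3)"
    have dy: "d * y = 1" unfolding d_def y_def using nz by simp
    have "(1 - x + x ^ 2) * d + x ^ 6 = 1"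
      unfolding d_def by (simp add: algebra_simps power2_eq_square power3_eq_cube numeral_eq_Suc)
    then have "y = ((1 - x + x ^ 2) * d + x ^ 6) * y" by simp
    also have "\<dots> = (1 - x + x ^ 2) * (d * y) + x ^ 6 * y" by (simp only: distrib_right mult.assoc)
    finally show ?thesis by (simp only: dy mult_1_right)
  qed
  define q where "q k = 1 / (1 - x ^ k)" for k
  have q: "1 \<le> q k" "q k \<le> 11/10" "q k = 1 + x ^ k * q k" if "k \<ge> 1" for k
  proof -
    have "0 \<le> x ^ k" using x by simp
    then show "1 \<le> q k" "q k \<le> 11/10" using pk[OF that] by (auto simp: q_def divide_simps)
    show "q k = 1 + x ^ k * q k" using pk[OF that] by (simp add: q_def field_simps)
  qed
  have "tail_coeff n = x ^ 5 * y - x ^ 5 * q 5 + x ^ 6 * q 6 - x ^ 7 * q 7"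
    unfolding tail_coeff_def 0 A[symmetric] q_def by (simp add: conv)
  also have "\<dots> = x ^ 5 * (y - q 5 + x * q 6 - x ^ 2 * q 7)"
    by (simp add: algebra_simps numeral_eq_Suc)
  also have "y - q 5 + x * q 6 - x ^ 2 * q 7
      = (1 - x + x ^ 2 + x ^ 6 * y) - (1 + x ^ 5 * q 5) + x * (1 + x ^ 6 * q 6) - x ^ 2 * (1 + x ^ 7 * q 7)"
    using y q(3)[of 5] q(3)[of 6] q(3)[of 7] by simp
  also have "\<dots> = x ^ 5 * (x * y - q 5 + x ^ 2 * q 6 - x ^ 4 * q 7)"
    by (simp add: algebra_simps numeral_eq_Suc)
  finally have eq: "tail_coeff n = x ^ 10 * (x * y - q 5 + x ^ 2 * q 6 - x ^ 4 * q 7)"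
    by (simp add: mult.assoc[symmetric] flip: power_add)
  have y0: "0 \<le> y" using x pk[of 3] by (simp add: y_def)
  have y1: "y \<le> 11/10"
  proof -
    have "1 * (1 - 1/29) \<le> (1 + x) * (1 - x ^ 3)" using x pk[of 3] by (intro mult_mono) auto
    then have "y \<le> 1 / (1 - 1/29)" unfolding y_def by (intro divide_left_mono) auto
    then show ?thesis by simp
  qed
  have "x * y \<le> 1/29 * (11/10)" using x y0 y1 by (intro mult_mono) auto
  moreover have "x ^ 2 * q 6 \<le> 1/29 * (11/10)" using pk[of 2] q[of 6] by (intro mult_mono) auto
  moreover have "0 \<le> x ^ 4 * q 7" using q[of 7] by simp
  ultimately have up: "x * y - q 5 + x ^ 2 * q 6 - x ^ 4 * q 7 \<le> 0" using q(1)[of 5] by simp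
  have "x ^ 4 * q 7 \<le> 1/29 * (11/10)" using pk[of 4] q[of 7] by (intro mult_mono) auto
  moreover have "0 \<le> x * y" "0 \<le> x ^ 2 * q 6" using x y0 q[of 6] by simp_all
  ultimately have lo: "- (6/5) \<le> x * y - q 5 + x ^ 2 * q 6 - x ^ 4 * q 7" using q(2)[of 5] by simp
  show "tail_coeff n \<le> 0" unfolding eq using up x by (simp add: mult_nonneg_nonpos)
  have "x ^ 10 * (- (6/5)) \<le> tail_coeff n" unfolding eq using lo x by (intro mult_left_mono) auto
  then show "- (6/5) / n ^ 10 \<le> tail_coeff n" by (simp add: x_def power_divide)
qed

definition prime_tail :: "nat \<Rightarrow> real" where
  "prime_tail n = (if prime n then ln (real n) * tail_coeff (real n) else 0)"

lemma prime_tail_sums: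
  "prime_tail sums (kappa - log_zeta_sum 2 / zeta_sum 2 - log_zeta_sum 3 / zeta_sum 3
    - log_zeta_sum 5 / zeta_sum 5 + log_zeta_sum 6 / zeta_sum 6 - log_zeta_sum 7 / zeta_sum 7)"
proof -
  have "(\<lambda>n. prime_term n - (if prime n then ln (real n) / (real n ^ 2 - 1) else 0)
      - (if prime n then ln (real n) / (real n ^ 3 - 1) else 0)
      - (if prime n then ln (real n) / (real n ^ 5 - 1) else 0)
      + (if prime n then ln (real n) / (real n ^ 6 - 1) else 0)
      - (if prime n then ln (real n) / (real n ^ 7 - 1) else 0))
    sums (kappa - log_zeta_sum 2 / zeta_sum 2 - log_zeta_sum 3 / zeta_sum 3
    - log_zeta_sum 5 / zeta_sum 5 + log_zeta_sum 6 / zeta_sum 6 - log_zeta_sum 7 / zeta_sum 7)"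
    unfolding kappa_eq
    by (intro sums_diff sums_add prime_log_sums summable_sums summable_prime_term) simp_all
  also have "(\<lambda>n. prime_term n - (if prime n then ln (real n) / (real n ^ 2 - 1) else 0)
      - (if prime n then ln (real n) / (real n ^ 3 - 1) else 0)
      - (if prime n then ln (real n) / (real n ^ 5 - 1) else 0)
      + (if prime n then ln (real n) / (real n ^ 6 - 1) else 0)
      - (if prime n then ln (real n) / (real n ^ 7 - 1) else 0)) = prime_tail"
    by (rule ext) (simp add: prime_term_def prime_tail_def tail_coeff_def right_diff_distrib distrib_left)
  finally show ?thesis .
qed

text \<open>The decay is so fast that all integers from 29 on may be counted instead of the primes.
  With \<open>ln x \<le> x / 8\<close> a term is at most \<open>(3/20) / x^9\<close>; seven powers
  are bounded by \<open>29^7\<close> and two telescope.\<close>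

lemma prime_tail_suminf_bounds:
  "- 4 / 10 ^ 13 \<le> (\<Sum>n. prime_tail (n + 29))" "(\<Sum>n. prime_tail (n + 29)) \<le> 0"
proof -
  have sm: "summable (\<lambda>n. prime_tail (n + 29))"
    using sums_summable[OF prime_tail_sums] by (rule summable_ignore_initial_segment)
  have "prime_tail (n + 29) \<le> 0" for n
    using tail_coeff_bounds(2)[of "real (n + 29)"] by (simp add: prime_tail_def mult_nonneg_nonpos)
  then show "(\<Sum>n. prime_tail (n + 29)) \<le> 0"
    using suminf_le[OF _ sm summable_zero] by simp
  define C where "C = (3/20) / (29::real) ^ 7"
  define b where "b n = - C * (1 / real (n + 28) - 1 / real (Suc n + 28))" for n
  have "(\<lambda>n. 1 / real (n + 28)) \<longlonglongrightarrow> 0" by real_asymp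
  from sums_mult[OF telescope_sums'[OF this], of "- C"] have b: "b sums (- C * (1 / 28))"
    unfolding b_def[abs_def] by simp
  have le: "b n \<le> prime_tail (n + 29)" for n
  proof -
    define x where "x = real (n + 29)"
    have x: "x \<ge> 29" by (simp add: x_def)
    have lnx: "0 \<le> ln x" "ln x \<le> x / 8"
    proof -
      have "ln (x / 29) \<le> x / 29 - 1" using x by (intro ln_le_minus_one) auto
      then have "ln x \<le> ln 29 + x / 29 - 1" using x by (simp add: ln_divide_pos)
      then show "ln x \<le> x / 8" using ln_29_bounds x by simp
      show "0 \<le> ln x" using x by simp
    qed
    have b0: "b n \<le> 0"
    proof -
      have "1 / real (Suc n + 28) \<le> 1 / real (n + 28)" by (intro divide_left_mono) auto
      then show ?thesis unfolding b_def C_def by (simp add: mult_nonneg_nonneg)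
    qed
    have "ln x * (6/5 / x ^ 10) \<le> x / 8 * (6/5 / x ^ 10)" using lnx x by (intro mult_right_mono) auto
    also have "\<dots> = (3/20) / (x ^ 7 * x ^ 2)" using x by (simp add: field_simps flip: power_add power_Suc)
    also have "\<dots> \<le> (3/20) / (29 ^ 7 * (x * (x - 1)))"
    proof (rule divide_left_mono)
      show "29 ^ 7 * (x * (x - 1)) \<le> x ^ 7 * x ^ 2"
        using x by (intro mult_mono power_mono) (auto simp: power2_eq_square)
    qed (use x in auto)
    also have "\<dots> = C * (1 / (x - 1) - 1 / x)" using x by (simp add: C_def field_simps)
    also have "\<dots> = - b n" by (simp add: b_def x_def algebra_simps)
    finally have "- (ln x * (6/5 / x ^ 10)) \<ge> b n" by linarith
    moreover have "ln x * (- (6/5) / x ^ 10) \<le> ln x * tail_coeff x"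
      using lnx tail_coeff_bounds(1)[OF x] by (intro mult_left_mono)
    ultimately have "b n \<le> ln x * tail_coeff x" by simp
    then show ?thesis using b0 by (auto simp: prime_tail_def x_def)
  qed
  have "suminf b \<le> (\<Sum>n. prime_tail (n + 29))"
    by (rule suminf_le[OF le sums_summable[OF b] sm])
  moreover have "suminf b = - C * (1 / 28)" using sums_unique[OF b] by simp
  moreover have "- 4 / 10 ^ 13 \<le> - C * (1 / 28)" by (simp add: C_def)
  ultimately show "- 4 / 10 ^ 13 \<le> (\<Sum>n. prime_tail (n + 29))" by linarith
qed

section \<open>Convergence of \<open>kappa_m\<close>\<close>

lemma div_ratio_tendsto:
  assumes "p > 0"
  shows "(\<lambda>m. real (Suc m div p - 1) / real m) \<longlonglongrightarrow> 1 / real p"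
proof (rule tendsto_sandwich)
  show "(\<lambda>m. ((real m + 2) / real p - 2) / real m) \<longlonglongrightarrow> 1 / real p"
  proof -
    have "(\<lambda>m. (1 / real p) * ((real m + 2) / real m) - 2 / real m) \<longlonglongrightarrow> (1 / real p) * 1 - 0"
      by (intro tendsto_diff tendsto_mult tendsto_const; real_asymp)
    then show ?thesis by (simp add: diff_divide_distrib)
  qed
  show "(\<lambda>m. (real m + 1) / real p / real m) \<longlonglongrightarrow> 1 / real p"
  proof -
    have "(\<lambda>m. (1 / real p) * ((real m + 1) / real m)) \<longlonglongrightarrow> (1 / real p) * 1"
      by (intro tendsto_mult tendsto_const; real_asymp)
    then show ?thesis by simp
  qed
  show "\<forall>\<^sub>F m in sequentially. ((real m + 2) / real p - 2) / real m \<le> real (Suc m div p - 1) / real m"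
  proof (intro always_eventually allI divide_right_mono)
    fix m
    have "Suc m = p * (Suc m div p) + Suc m mod p" by simp
    moreover have "Suc m mod p < p" using assms by simp
    ultimately have "Suc m + 1 \<le> p * (Suc m div p) + p" by linarith
    then have "real (Suc m + 1) \<le> real (p * (Suc m div p) + p)" by (simp only: of_nat_le_iff)
    then have "(real m + 2) / real p \<le> real (Suc m div p) + 1"
      using assms by (simp add: divide_le_eq algebra_simps)
    moreover have "real (Suc m div p) \<le> real (Suc m div p - 1) + 1" by simp
    ultimately show "(real m + 2) / real p - 2 \<le> real (Suc m div p - 1)" by linarith
  qed simp
  show "\<forall>\<^sub>F m in sequentially. real (Suc m div p - 1) / real m \<le> (real m + 1) / real p / real m"
  proof (intro always_eventually allI divide_right_mono)
    fix m
    have "p * (Suc m div p - 1) \<le> p * (Suc m div p)" by (intro mult_le_mono) auto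
    also have "\<dots> \<le> Suc m" by simp
    finally have "real (p * (Suc m div p - 1)) \<le> real (Suc m)" by (simp only: of_nat_le_iff)
    then show "real (Suc m div p - 1) \<le> (real m + 1) / real p" using assms by (simp add: field_simps)
  qed simp
qed

text \<open>Both remainders are at most \<open>p - 1\<close>, hence
  \<open>m + 2 \<le> p * (v + 2)\<close> for every value \<open>v\<close> of the floor sum.\<close>

lemma Min_floor_sum:
  assumes "p \<ge> 1" "p \<le> Suc m"
  shows "Min ((\<lambda>j. j div p + (m - j) div p) ` {0..m}) = Suc m div p - 1"
proof (rule antisym[OF Min_floor_sum_le[OF assms]])
  show "Suc m div p - 1 \<le> Min ((\<lambda>j. j div p + (m - j) div p) ` {0..m})"
  proof (intro Min.boundedI)
    fix v assume "v \<in> (\<lambda>j. j div p + (m - j) div p) ` {0..m}"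
    then obtain j where j: "j \<le> m" "v = j div p + (m - j) div p" by auto
    have "j < p * Suc (j div p)" "m - j < p * Suc ((m - j) div p)"
      using assms by (simp_all add: dividend_less_times_div)
    then have "Suc m < p * (v + 2)" using j by (simp add: algebra_simps)
    then have "Suc m div p < v + 2" using assms by (simp add: less_mult_imp_div_less mult.commute)
    then show "Suc m div p - 1 \<le> v" by simp
  qed auto
qed

text \<open>Tannery's theorem: range of summation and terms vary with \<open>m\<close>, but all
  terms are dominated by \<open>2 * prime_term p\<close>. The point is to bound \<open>w_fun\<close>
  uniformly in \<open>p\<close>.\<close>

lemma kappa_m_tendsto: "kappa_m \<longlonglongrightarrow> kappa"
proof -
  define X where "X m = s_fun m * exp (s_fun m)" for m
  define f where "f p m = (if p \<in> extra_primes m then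
      (real (Suc m div p - 1) / real m) * (ln (real p) / (real p - 1)) * w_fun (real p) (X m) else 0)" for p m
  have km: "kappa_m m = (\<Sum>p. f p m)" for m
  proof -
    have "(\<Sum>p. f p m) = (\<Sum>p\<in>extra_primes m. f p m)"
      by (rule suminf_finite[OF finite_extra_primes]) (auto simp: f_def)
    also have "\<dots> = (\<Sum>p\<in>extra_primes m. (1 / real m) * (real (Min ((\<lambda>j. j div p + (m - j) div p) ` {0..m}))
        * (ln (real p) / (real p - 1)) * w_fun (real p) (X m)))"
    proof (rule sum.cong)
      fix p assume p: "p \<in> extra_primes m"
      then have "p \<ge> 1" by (auto simp: extra_primes_def prime_gt_0_nat Suc_leI)
      moreover have "real p \<le> real (Suc m)" using p by (simp add: extra_primes_def)
      then have "p \<le> Suc m" by (simp only: of_nat_le_iff)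
      ultimately show "f p m = (1 / real m) * (real (Min ((\<lambda>j. j div p + (m - j) div p) ` {0..m}))
          * (ln (real p) / (real p - 1)) * w_fun (real p) (X m))"
        using p by (simp add: f_def Min_floor_sum)
    qed simp
    finally show ?thesis
      by (simp add: kappa_m_def X_def extra_primes_def sum_distrib_left)
  qed
  \<comment> \<open>Growth beyond a power of \<open>m\<close> ensures that even \<open>p\<close> of
    size \<open>m / 2\<close> is small against \<open>sqrt (X m)\<close>.\<close>
  have X_ge: "\<forall>\<^sub>F m in sequentially. real m ^ 8 \<le> X m"
    using eventually_ge_at_top[of 5]
  proof eventually_elim
    case (elim m)
    have L: "ln (real m) \<ge> 8/5"
    proof -
      have "ln 5 \<le> ln (real m)" using elim by simp
      then show ?thesis using ln_5_ge by linarith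
    qed
    have "5 * (8/5) \<le> real m * ln (real m)" using elim L by (intro mult_mono) auto
    then have "8 * ln (real m) \<le> real m * ln (real m) * ln (real m)" using L by (intro mult_right_mono) auto
    then have s: "8 * ln (real m) \<le> s_fun m" using elim by (simp add: s_fun_def power2_eq_square mult.assoc)
    have "real m ^ 8 = exp (8 * ln (real m))"
      using elim exp_of_nat_mult[of 8 "ln (real m)"] by simp
    also have "\<dots> \<le> exp (s_fun m)" using s by simp
    also have "1 * exp (s_fun m) \<le> X m" unfolding X_def using s L by (intro mult_right_mono) auto
    finally show ?case by simp
  qed
  have X_lim: "filterlim X at_top sequentially"
  proof (rule filterlim_at_top_mono[OF _ X_ge])
    show "filterlim (\<lambda>m. real m ^ 8) at_top sequentially" by real_asymp
  qed
  have w_lim: "(\<lambda>m. w_fun (real p) (X m)) \<longlonglongrightarrow> 1" for p :: nat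
  proof -
    have "((\<lambda>x::real. x powr (-1)) \<longlongrightarrow> 0) at_top" "((\<lambda>x::real. ln x / x) \<longlongrightarrow> 0) at_top"
      by real_asymp+
    then have "((\<lambda>x::real. 1 - real p * x powr (-1) - (real p - 1) / ln (real p) * (ln x / x)) \<longlongrightarrow>
        1 - real p * 0 - (real p - 1) / ln (real p) * 0) at_top"
      by (intro tendsto_diff tendsto_mult tendsto_const)
    then have "((\<lambda>x::real. 1 - real p * x powr (-1) - (real p - 1) / ln (real p) * (ln x / x)) \<longlongrightarrow> 1) at_top"
      by simp
    moreover have "\<forall>\<^sub>F x in at_top. 1 - real p * x powr (-1) - (real p - 1) / ln (real p) * (ln x / x) = w_fun (real p) x"
      using eventually_gt_at_top[of 0] by eventually_elim (simp add: w_fun_def powr_minus divide_inverse)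
    ultimately have "(w_fun (real p) \<longlongrightarrow> 1) at_top" by (rule Lim_transform_eventually)
    then show ?thesis using X_lim by (rule filterlim_compose)
  qed
  have limit: "(f p \<longlonglongrightarrow> prime_term p)" for p
  proof (cases "prime p")
    case True
    then have p: "p > 0" by (rule prime_gt_0_nat)
    have "(\<lambda>m. (real (Suc m div p - 1) / real m) * (ln (real p) / (real p - 1)) * w_fun (real p) (X m))
        \<longlonglongrightarrow> (1 / real p) * (ln (real p) / (real p - 1)) * 1"
      by (intro tendsto_mult div_ratio_tendsto[OF p] tendsto_const w_lim)
    moreover have "\<forall>\<^sub>F m in sequentially. (real (Suc m div p - 1) / real m) * (ln (real p) / (real p - 1)) * w_fun (real p) (X m) = f p m"
      using eventually_ge_at_top[of "2 * p"] by eventually_elim (use True in \<open>auto simp: f_def extra_primes_def\<close>)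
    ultimately have "f p \<longlonglongrightarrow> (1 / real p) * (ln (real p) / (real p - 1)) * 1" by (rule Lim_transform_eventually)
    then show ?thesis using True by (simp add: prime_term_def)
  next
    case False
    then have "f p = (\<lambda>_. 0)" by (auto simp: f_def extra_primes_def)
    then show ?thesis using False by (simp add: prime_term_def)
  qed
  \<comment> \<open>From \<open>4 * p \<le> sqrt (X m)\<close> and \<open>ln x \<le> sqrt x\<close>
    both subtracted terms of \<open>w_fun\<close> are at most \<open>1\<close>, so its absolute
    value is at most \<open>1\<close>. The factor \<open>2\<close> comes from
    \<open>m + 1 \<le> 2 * m\<close>.\<close>
  have bound: "\<forall>\<^sub>F m in sequentially. \<forall>p. norm (f p m) \<le> 2 * prime_term p"
    using X_ge eventually_ge_at_top[of 5]
  proof eventually_elim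
    case (elim m)
    show ?case
    proof
      fix p
      show "norm (f p m) \<le> 2 * prime_term p"
      proof (cases "p \<in> extra_primes m")
        case False
        then show ?thesis by (simp add: f_def prime_term_nonneg)
      next
        case True
        then have p: "prime p" "2 * real p \<le> real m + 1" by (auto simp: extra_primes_def)
        then have p2: "real p \<ge> 2" using prime_ge_2_nat[of p] by simp
        define x where "x = X m"
        have m5: "real m \<ge> 5" using elim by simp
        have x8: "real m ^ 8 \<le> x" using elim by (simp add: x_def)
        have "(1::real) \<le> real m ^ 8" using m5 by (intro one_le_power) auto
        then have x1: "x \<ge> 1" using x8 by linarith
        have sq: "real m ^ 4 \<le> sqrt x"
        proof (rule real_le_rsqrt)
          show "(real m ^ 4)\<^sup>2 \<le> x" using x8 by (simp flip: power_mult)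
        qed
        have m4: "4 * real m \<le> real m ^ 4"
        proof -
          have "4 \<le> real m ^ 3" using power_mono[of 5 "real m" 3] m5 by simp
          then have "4 * real m \<le> real m ^ 3 * real m" using m5 by (intro mult_right_mono) auto
          then show ?thesis by (simp flip: power_Suc2)
        qed
        have pm: "real p \<le> real m" using p m5 by simp
        have sx: "4 * real p \<le> sqrt x" using pm m4 sq by linarith
        have sx0: "sqrt x > 0" using x1 by simp
        have lnx: "ln x \<le> sqrt x"
          using ln_squared_le[OF x1] by (rule real_le_rsqrt)
        have xx: "x = sqrt x * sqrt x" using x1 by simp
        have "real p / x \<le> 1"
        proof -
          have "sqrt x * 1 \<le> sqrt x * sqrt x" using x1 by (intro mult_left_mono) auto
          then have "real p \<le> x" using sx p2 xx by linarith
          then show ?thesis using x1 by simp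
        qed
        moreover have "(real p - 1) / ln (real p) * (ln x / x) \<le> 1"
        proof -
          have "1/2 \<le> ln (real p)" using ln2_ge_two_thirds ln_le_cancel_iff[of 2 "real p"] p2 by linarith
          then have "(real p - 1) / ln (real p) \<le> real p / (1/2)" using p2 by (intro frac_le) auto
          moreover have "ln x / x \<le> sqrt x / x" using lnx x1 by (intro divide_right_mono) auto
          moreover have "sqrt x / x = 1 / sqrt x" using x1 sqrt_divide_self_eq[of x] by (simp add: inverse_eq_divide)
          ultimately have "(real p - 1) / ln (real p) * (ln x / x) \<le> real p / (1/2) * (1 / sqrt x)"
            using p2 x1 by (intro mult_mono) auto
          also have "\<dots> \<le> 1" using sx sx0 p2 by (simp add: field_simps)
          finally show ?thesis .
        qed
        moreover have "w_fun (real p) x \<le> 1" using p2 x1 by (intro w_fun_le_1) auto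
        ultimately have w: "\<bar>w_fun (real p) x\<bar> \<le> 1" unfolding w_fun_def by linarith
        have "real (Suc m div p - 1) / real m \<le> 1 / real p * 2"
        proof -
          have "p * (Suc m div p - 1) \<le> p * (Suc m div p)" by (intro mult_le_mono) auto
          also have "\<dots> \<le> Suc m" by simp
          finally have "real (p * (Suc m div p - 1)) \<le> real (Suc m)" by (simp only: of_nat_le_iff)
          then have "real p * real (Suc m div p - 1) \<le> 2 * real m" using m5 by simp
          then show ?thesis using p2 m5 by (simp add: field_simps)
        qed
        then have "(real (Suc m div p - 1) / real m) * (ln (real p) / (real p - 1)) * \<bar>w_fun (real p) x\<bar>
            \<le> (1 / real p * 2) * (ln (real p) / (real p - 1)) * 1"
          using p2 w by (intro mult_mono) auto
        moreover have "norm (f p m) = (real (Suc m div p - 1) / real m) * (ln (real p) / (real p - 1)) * \<bar>w_fun (real p) x\<bar>"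
          using True p2 by (simp add: f_def x_def abs_mult)
        ultimately show ?thesis using p by (simp add: prime_term_def)
      qed
    qed
  qed
  have "(\<lambda>m. \<Sum>p. f p m) \<longlonglongrightarrow> suminf prime_term"
  proof -
    have "\<forall>\<^sub>F (p, m) in at_top \<times>\<^sub>F sequentially. norm (f p m) \<le> 2 * prime_term p"
      using eventually_prodI[OF eventually_True bound] by (rule eventually_mono) auto
    from tannerys_theorem[OF limit this summable_mult[OF summable_prime_term]] show ?thesis by simp
  qed
  then show ?thesis by (simp add: km kappa_eq flip: km)
qed

section \<open>The digits of \<open>\<kappa>\<close>\<close>

lemma log_zeta_quotient_2_bounds:
  "0.56996099309442340 \<le> log_zeta_sum 2 / zeta_sum 2" "log_zeta_sum 2 / zeta_sum 2 \<le> 0.56996099309464069"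
proof -
  note b = log_zeta_sum_2_bounds zeta_sum_2_bounds
  have "0.93754825431567983 / 1.64493406684825457 \<le> log_zeta_sum 2 / zeta_sum 2"
    "log_zeta_sum 2 / zeta_sum 2 \<le> 0.93754825431600394 / 1.64493406684819613"
    using b by (intro frac_le; simp)+
  then show "0.56996099309442340 \<le> log_zeta_sum 2 / zeta_sum 2" "log_zeta_sum 2 / zeta_sum 2 \<le> 0.56996099309464069"
    by simp_all
qed

lemma log_zeta_quotient_3_bounds:
  "0.16482268215825615 \<le> log_zeta_sum 3 / zeta_sum 3" "log_zeta_sum 3 / zeta_sum 3 \<le> 0.16482268215829784"
proof -
  note b = log_zeta_sum_3_bounds zeta_sum_3_bounds
  have "0.19812624288561226 / 1.20205690315959886 \<le> log_zeta_sum 3 / zeta_sum 3"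
    "log_zeta_sum 3 / zeta_sum 3 \<le> 0.19812624288566081 / 1.20205690315958942"
    using b by (intro frac_le; simp)+
  then show "0.16482268215825615 \<le> log_zeta_sum 3 / zeta_sum 3" "log_zeta_sum 3 / zeta_sum 3 \<le> 0.16482268215829784"
    by simp_all
qed

lemma log_zeta_quotient_5_bounds:
  "0.02755619219153020 \<le> log_zeta_sum 5 / zeta_sum 5" "log_zeta_sum 5 / zeta_sum 5 \<le> 0.02755619219153074"
proof -
  note b = log_zeta_sum_5_bounds zeta_sum_5_bounds
  have "0.02857378050946268 / 1.03692775514337000 \<le> log_zeta_sum 5 / zeta_sum 5"
    "log_zeta_sum 5 / zeta_sum 5 \<le> 0.02857378050946322 / 1.03692775514336986"
    using b by (intro frac_le; simp)+
  then show "0.02755619219153020 \<le> log_zeta_sum 5 / zeta_sum 5" "log_zeta_sum 5 / zeta_sum 5 \<le> 0.02755619219153074"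
    by simp_all
qed

lemma log_zeta_quotient_6_bounds:
  "0.01263306903251102 \<le> log_zeta_sum 6 / zeta_sum 6" "log_zeta_sum 6 / zeta_sum 6 \<le> 0.01263306903251111"
proof -
  note b = log_zeta_sum_6_bounds zeta_sum_6_bounds
  have "0.01285216513179569 / 1.01734306198444916 \<le> log_zeta_sum 6 / zeta_sum 6"
    "log_zeta_sum 6 / zeta_sum 6 \<le> 0.01285216513179577 / 1.01734306198444912"
    using b by (intro frac_le; simp)+
  then show "0.01263306903251102 \<le> log_zeta_sum 6 / zeta_sum 6" "log_zeta_sum 6 / zeta_sum 6 \<le> 0.01263306903251111"
    by simp_all
qed

lemma log_zeta_quotient_7_bounds:
  "0.00598355857063837 \<le> log_zeta_sum 7 / zeta_sum 7" "log_zeta_sum 7 / zeta_sum 7 \<le> 0.00598355857063843"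
proof -
  note b = log_zeta_sum_7_bounds zeta_sum_7_bounds
  have "0.00603351696087562 / 1.00834927738192285 \<le> log_zeta_sum 7 / zeta_sum 7"
    "log_zeta_sum 7 / zeta_sum 7 \<le> 0.00603351696087567 / 1.00834927738192281"
    using b by (intro frac_le; simp)+
  then show "0.00598355857063837 \<le> log_zeta_sum 7 / zeta_sum 7" "log_zeta_sum 7 / zeta_sum 7 \<le> 0.00598355857063843"
    by simp_all
qed

lemma prime_tail_head_bounds:
  "- 0.00032374615076682 \<le> (\<Sum>n<29. prime_tail n)" "(\<Sum>n<29. prime_tail n) \<le> - 0.00032374615076673"
proof -
  have eq: "(\<Sum>n<29. prime_tail n) = ln 2 * tail_coeff 2 + ln 3 * tail_coeff 3 + ln 5 * tail_coeff 5 + ln 7 * tail_coeff 7 + ln 11 * tail_coeff 11 + ln 13 * tail_coeff 13 + ln 17 * tail_coeff 17 + ln 19 * tail_coeff 19 + ln 23 * tail_coeff 23"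
    by (simp add: lessThan_nat_numeral prime_tail_def)
  have t2: "- 0.00031159778669777 \<le> ln 2 * tail_coeff 2" "ln 2 * tail_coeff 2 \<le> - 0.00031159778669776"
    using ln_2_bounds by (simp_all add: tail_coeff_def)
  have t3: "- 0.00001201153225748 \<le> ln 3 * tail_coeff 3" "ln 3 * tail_coeff 3 \<le> - 0.00001201153225747"
    using ln_3_bounds by (simp_all add: tail_coeff_def)
  have t5: "- 0.00000013084095684 \<le> ln 5 * tail_coeff 5" "ln 5 * tail_coeff 5 \<le> - 0.00000013084095683"
    using ln_5_bounds by (simp_all add: tail_coeff_def)
  have t7: "- 0.00000000588785608 \<le> ln 7 * tail_coeff 7" "ln 7 * tail_coeff 7 \<le> - 0.00000000588785607"
    using ln_7_bounds by (simp_all add: tail_coeff_def)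
  have t11: "- 0.00000000008398220 \<le> ln 11 * tail_coeff 11" "ln 11 * tail_coeff 11 \<le> - 0.00000000008398219"
    using ln_11_bounds by (simp_all add: tail_coeff_def)
  have t13: "- 0.00000000001716670 \<le> ln 13 * tail_coeff 13" "ln 13 * tail_coeff 13 \<le> - 0.00000000001716669"
    using ln_13_bounds by (simp_all add: tail_coeff_def)
  have t17: "- 0.00000000000132244 \<le> ln 17 * tail_coeff 17" "ln 17 * tail_coeff 17 \<le> - 0.00000000000132243"
    using ln_17_bounds by (simp_all add: tail_coeff_def)
  have t19: "- 0.00000000000045491 \<le> ln 19 * tail_coeff 19" "ln 19 * tail_coeff 19 \<le> - 0.00000000000045490"
    using ln_19_bounds by (simp_all add: tail_coeff_def)
  have t23: "- 0.00000000000007240 \<le> ln 23 * tail_coeff 23" "ln 23 * tail_coeff 23 \<le> - 0.00000000000007239"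
    using ln_23_bounds by (simp_all add: tail_coeff_def)
  show "- 0.00032374615076682 \<le> (\<Sum>n<29. prime_tail n)" "(\<Sum>n<29. prime_tail n) \<le> - 0.00032374615076673"
    unfolding eq using t2 t3 t5 t7 t11 t13 t17 t19 t23 by simp_all
qed

theorem kappa_bounds: "0.75536661083 \<le> kappa" "kappa < 0.75536661084"
proof -
  have "suminf prime_tail = (\<Sum>n. prime_tail (n + 29)) + (\<Sum>n<29. prime_tail n)"
    by (rule suminf_split_initial_segment[OF sums_summable[OF prime_tail_sums]])
  then have "kappa = log_zeta_sum 2 / zeta_sum 2 + log_zeta_sum 3 / zeta_sum 3 + log_zeta_sum 5 / zeta_sum 5
      - log_zeta_sum 6 / zeta_sum 6 + log_zeta_sum 7 / zeta_sum 7
      + (\<Sum>n. prime_tail (n + 29)) + (\<Sum>n<29. prime_tail n)"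
    using sums_unique[OF prime_tail_sums] by linarith
  \<comment> \<open>Folding the quotients into \<open>z\<close> makes them atoms for linear
    arithmetic.\<close>
  moreover define z where "z k = log_zeta_sum k / zeta_sum k" for k
  ultimately show "0.75536661083 \<le> kappa" "kappa < 0.75536661084"
    using log_zeta_quotient_2_bounds log_zeta_quotient_3_bounds log_zeta_quotient_5_bounds
      log_zeta_quotient_6_bounds log_zeta_quotient_7_bounds prime_tail_head_bounds prime_tail_suminf_bounds
    unfolding z_def[symmetric] by simp_all
qed

section \<open>The transcendence measure\<close>

theorem theorem1p1:
  fixes m :: nat and H :: real
  assumes "m \<ge> 2" and "H \<ge> 1" and "ln H \<ge> s_fun m * exp (s_fun m)"
  shows "omega m H \<le> omega_bound m H \<and> kappa_m \<longlonglongrightarrow> kappa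
         \<and> 0.75536661083 \<le> kappa \<and> kappa < 0.75536661084"
proof -
  have H: "H > 0" "s_fun m * exp (s_fun m) \<le> ln H" using assms by auto
  have "omega m H \<le> omega_bound m H"
  proof (cases "m \<ge> 25")
    case True
    have "gain_rate m \<le> real m * kappa" by (rule gain_rate_le_kappa)
    also have "\<dots> \<le> real m * (19/25)" using kappa_bounds by (intro mult_left_mono) auto
    finally show ?thesis using omega_bound_ge_25[OF True] H by (simp add: mult.commute)
  next
    case False
    then have "m = 2 \<or> m = 3 \<or> m = 4 \<or> m = 5 \<or> m = 6 \<or> m = 7 \<or> m = 8 \<or> m = 9 \<or> m = 10 \<or> m = 11 \<or> m = 12
        \<or> m = 13 \<or> m = 14 \<or> m = 15 \<or> m = 16 \<or> m = 17 \<or> m = 18 \<or> m = 19 \<or> m = 20 \<or> m = 21 \<or> m = 22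
        \<or> m = 23 \<or> m = 24"
      using assms(1) by presburger
    then show ?thesis
      using H
      by (elim disjE) (simp_all only: omega_bound_2 omega_bound_3 omega_bound_4 omega_bound_5 omega_bound_6
          omega_bound_7 omega_bound_8 omega_bound_9 omega_bound_10 omega_bound_11 omega_bound_12 omega_bound_13
          omega_bound_14 omega_bound_15 omega_bound_16 omega_bound_17 omega_bound_18 omega_bound_19 omega_bound_20
          omega_bound_21 omega_bound_22 omega_bound_23 omega_bound_24)
  qed
  then show ?thesis using kappa_m_tendsto kappa_bounds by simp
qed

end
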